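(* Let $p\ge 2$ and $n_1,n_2$ be positive integers with $p<n_1+n_2-2$, let $\boldsymbol{\mu}_1,\boldsymbol{\mu}_2\in\mathbb{R}^p$, and let $\boldsymbol{\Sigma}$ be a positive definite $p\times p$ matrix. Let $\mathbf{x}^{(1)}_1,\dots,\mathbf{x}^{(1)}_{n_1}$ be i.i.d. $\mathcal{N}_p(\boldsymbol{\mu}_1,\boldsymbol{\Sigma})$ and $\mathbf{x}^{(2)}_1,\dots,\mathbf{x}^{(2)}_{n_2}$ be i.i.d. $\mathcal{N}_p(\boldsymbol{\mu}_2,\boldsymbol{\Sigma})$, the two samples being independent, with sample means $\bar{\mathbf{x}}^{(1)},\bar{\mathbf{x}}^{(2)}$ and pooled sample covariance matrix $\mathbf{S}_{pl}$. Let $i\in\{1,2\}$ and let $\mathbf{x}\sim\mathcal{N}_p(\boldsymbol{\mu}_i,\boldsymbol{\Sigma})$ be a new observation (from group $i$) independent of both samples. Put $\lambda=1/n_1+1/n_2$, $\Delta=\sqrt{(\boldsymbol{\mu}_1-\boldsymbol{\mu}_2)^T\boldsymbol{\Sigma}^{-1}(\boldsymbol{\mu}_1-\boldsymbol{\mu}_2)}$ and $$\hat d=(\bar{\mathbf{x}}^{(1)}-\bar{\mathbf{x}}^{(2)})^T\mathbf{S}_{pl}^{-1}\left(\mathbf{x}-\tfrac12(\bar{\mathbf{x}}^{(1)}+\bar{\mathbf{x}}^{(2)})\right).$$ Then $\hat d$ has the stochastic representation $$\begin{aligned}\hat d\overset{d}{=}\ &\frac{n_1+n_2-2}{\xi}\Bigg((-1)^{i-1}\frac{\lambda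 n_i-2}{2\lambda n_i}\left(\lambda\xi_2+(\Delta+\sqrt{\lambda}\,w_0)^2\right)+\frac{(-1)^{i-1}}{\lambda n_i}\left(\Delta^2+\sqrt{\lambda}\,\Delta w_0\right)\\&+\sqrt{1+\frac{1}{n_1+n_2}+\frac{p-1}{n_1+n_2-p}\,u}\ \sqrt{\lambda\xi_2+(\Delta+\sqrt{\lambda}\,w_0)^2}\ z_0\Bigg),\end{aligned}$$ where $u\mid\xi_1,\xi_2,w_0\sim\mathcal{F}\left(p-1,\,n_1+n_2-p,\,(n_1+n_2)^{-1}\xi_1\right)$ with $\xi_1\mid\xi_2,w_0\sim\chi^2_{p-1}(\delta^2_{\xi_2,w_0})$ and $$\delta^2_{\xi_2,w_0}=\frac{n_1n_2}{n_i^2}\,\frac{\Delta^2\xi_2}{\lambda\xi_2+(\Delta+\sqrt{\lambda}\,w_0)^2},$$ $z_0,w_0\sim\mathcal{N}(0,1)$, $\xi\sim\chi^2_{n_1+n_2-p-1}$, $\xi_2\sim\chi^2_{p-1}$; here $\xi$, $z_0$ and $(u,\xi_1,\xi_2,w_0)$ are mutually independent, and $\xi_2$ and $w_0$ are independent as well.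
   Context: For $j=1,2$: $\bar{\mathbf{x}}^{(j)}=\frac1{n_j}\sum_{l=1}^{n_j}\mathbf{x}^{(j)}_l$ and $\mathbf{S}^{(j)}=\frac1{n_j-1}\sum_{l=1}^{n_j}(\mathbf{x}^{(j)}_l-\bar{\mathbf{x}}^{(j)})(\mathbf{x}^{(j)}_l-\bar{\mathbf{x}}^{(j)})^T$ (so $n_j\ge 2$ is implicit). The pooled estimator is $\mathbf{S}_{pl}=\frac{1}{n_1+n_2-2}\left[(n_1-1)\mathbf{S}^{(1)}+(n_2-1)\mathbf{S}^{(2)}\right]$. The symbol $\overset{d}{=}$ denotes equality in distribution. $\chi^2_m(\delta^2)$ is the non-central chi-squared distribution with $m$ degrees of freedom and non-centrality parameter $\delta^2$ (the law of $\|\mathbf{z}+\mathbf{v}\|^2$ with $\mathbf{z}\sim\mathcal{N}_m(\mathbf{0},\mathbf{I}_m)$, $\|\mathbf{v}\|^2=\delta^2$). $\mathcal{F}(m_1,m_2,\delta^2)$ is the non-central $F$-distribution: the law of $(\zeta/m_1)/(w/m_2)$ with independent $\zeta\sim\chi^2_{m_1}(\delta^2)$, $w\sim\chi^2_{m_2}$. *)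

theory Defs
  imports "HOL-Probability.Probability"
begin

definition pos_def_matrix :: "real^'n^'n \<Rightarrow> bool" where
  "pos_def_matrix A \<longleftrightarrow> transpose A = A \<and> (\<forall>v. v \<noteq> 0 \<longrightarrow> v \<bullet> (A *v v) > 0)"

definition mvn_density :: "real^'n \<Rightarrow> real^'n^'n \<Rightarrow> real^'n \<Rightarrow> real" where
  "mvn_density \<mu> \<Sigma> x =
     exp (- ((x - \<mu>) \<bullet> (matrix_inv \<Sigma> *v (x - \<mu>))) / 2) / sqrt ((2 * pi) ^ CARD('n) * det \<Sigma>)"

definition sample_mean :: "nat \<Rightarrow> (nat \<Rightarrow> real^'n) \<Rightarrow> real^'n" where
  "sample_mean m x = (1 / real m) *\<^sub>R (\<Sum>l=1..m. x l)"

(* For m = 1 division by zero makes this the zero matrix. *)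
definition sample_cov :: "nat \<Rightarrow> (nat \<Rightarrow> real^'n) \<Rightarrow> real^'n^'n" where
  "sample_cov m x = (1 / (real m - 1)) *\<^sub>R
     (\<Sum>l=1..m. (columnvector (x l - sample_mean m x) :: real^1^'n) **
                (rowvector (x l - sample_mean m x) :: real^'n^1))"

definition pooled_cov ::
  "nat \<Rightarrow> (nat \<Rightarrow> real^'n) \<Rightarrow> nat \<Rightarrow> (nat \<Rightarrow> real^'n) \<Rightarrow> real^'n^'n" where
  "pooled_cov m1 x1 m2 x2 = (1 / (real m1 + real m2 - 2)) *\<^sub>R
     ((real m1 - 1) *\<^sub>R sample_cov m1 x1 + (real m2 - 1) *\<^sub>R sample_cov m2 x2)"

definition discriminant ::
  "nat \<Rightarrow> (nat \<Rightarrow> real^'n) \<Rightarrow> nat \<Rightarrow> (nat \<Rightarrow> real^'n) \<Rightarrow> real^'n \<Rightarrow> real" where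
  "discriminant m1 x1 m2 x2 x =
     (sample_mean m1 x1 - sample_mean m2 x2) \<bullet>
       (matrix_inv (pooled_cov m1 x1 m2 x2) *v
         (x - (1 / 2) *\<^sub>R (sample_mean m1 x1 + sample_mean m2 x2)))"

definition std_normal_measure :: "real measure" where
  "std_normal_measure = density lborel std_normal_density"

(* The law of the squared norm of z + v for z standard normal in dimension m.  It depends on v only
   through its squared norm d2, and v is taken here to be sqrt d2 times the first unit vector. *)
definition noncentral_chi_squared :: "nat \<Rightarrow> real \<Rightarrow> real measure" where
  "noncentral_chi_squared m d2 =
     distr (\<Pi>\<^sub>M k\<in>{..<m}. std_normal_measure) borel
       (\<lambda>z. \<Sum>k<m. (z k + (if k = 0 then sqrt d2 else 0))\<^sup>2)"

definition chi_squared :: "nat \<Rightarrow> real measure" where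
  "chi_squared m = noncentral_chi_squared m 0"

definition noncentral_F :: "nat \<Rightarrow> nat \<Rightarrow> real \<Rightarrow> real measure" where
  "noncentral_F m1 m2 d2 =
     distr (noncentral_chi_squared m1 d2 \<Otimes>\<^sub>M chi_squared m2) borel
       (\<lambda>(\<zeta>, w). (\<zeta> / real m1) / (w / real m2))"

(* The Markov kernel K is a regular conditional distribution of X given Y. *)
definition cond_distributed ::
  "'a measure \<Rightarrow> 'c measure \<Rightarrow> ('a \<Rightarrow> 'c) \<Rightarrow> 'b measure \<Rightarrow> ('a \<Rightarrow> 'b) \<Rightarrow> ('c \<Rightarrow> 'b measure) \<Rightarrow> bool" where
  "cond_distributed M T Y S X K \<longleftrightarrow>
     Y \<in> measurable M T \<and> X \<in> measurable M S \<and> K \<in> measurable T (prob_algebra S) \<and>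
     (\<forall>A\<in>sets S. \<forall>B\<in>sets T.
        emeasure M {\<omega> \<in> space M. X \<omega> \<in> A \<and> Y \<omega> \<in> B} =
        (\<integral>\<^sup>+\<omega>. emeasure (K (Y \<omega>)) A * indicator B (Y \<omega>) \<partial>M))"

(* Mutual independence of three random variables with possibly different value types,
   as independence of the generated sigma-algebras. *)
definition (in prob_space) indep_vars3 ::
  "'b measure \<Rightarrow> ('a \<Rightarrow> 'b) \<Rightarrow> 'c measure \<Rightarrow> ('a \<Rightarrow> 'c) \<Rightarrow> 'd measure \<Rightarrow> ('a \<Rightarrow> 'd) \<Rightarrow> bool" where
  "indep_vars3 M1 X1 M2 X2 M3 X3 \<longleftrightarrow>
     random_variable M1 X1 \<and> random_variable M2 X2 \<and> random_variable M3 X3 \<and>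
     indep_sets (\<lambda>k. [sets (vimage_algebra (space M) X1 M1),
                      sets (vimage_algebra (space M) X2 M2),
                      sets (vimage_algebra (space M) X3 M3)] ! k) {..<3}"

lemma prob_space_std_normal: "prob_space std_normal_measure"
  unfolding std_normal_measure_def by (rule prob_space_normal_density) simp

lemma sets_std_normal [simp, measurable_cong]: "sets std_normal_measure = sets borel"
  by (simp add: std_normal_measure_def)

lemma prob_space_std_normal_PiM: "prob_space (\<Pi>\<^sub>M k\<in>{..<m}. std_normal_measure)"
  by (intro prob_space_PiM prob_space_std_normal)

(* The families of laws used as conditional distributions are Markov kernels. *)
lemma measurable_noncentral_chi_squared [measurable]:
  "noncentral_chi_squared m \<in> measurable borel (prob_algebra borel)"
  unfolding noncentral_chi_squared_def
  by (rule measurable_distr_prob_space2[where M = "\<Pi>\<^sub>M k\<in>{..<m}. std_normal_measure"])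
     (auto simp: space_prob_algebra prob_space_std_normal_PiM)

lemma measurable_noncentral_F [measurable]:
  "noncentral_F m1 m2 \<in> measurable borel (prob_algebra borel)"
proof -
  have [measurable]: "(\<lambda>_. chi_squared m2) \<in> measurable (borel :: real measure) (prob_algebra borel)"
    unfolding chi_squared_def
    using measurable_space[OF measurable_noncentral_chi_squared, of 0 m2] by simp
  show ?thesis
    unfolding noncentral_F_def by measurable
qed

end

theory Submission
  imports Defs
begin

text \<open>
  Write the pooled scatter matrix as a sum \<open>W\<close> of \<open>n\<^sub>1 + n\<^sub>2 - 2\<close> squares by an orthogonal change of basis
  in the space of observations; the difference \<open>y\<close> of the sample means, the grand mean and the new
  observation are independent of \<open>W\<close>, and the discriminant is a combination of \<open>y \<bullet> W\<inverse> y\<close> and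
  \<open>y \<bullet> W\<inverse> h\<close> with \<open>h\<close> the new observation minus the grand mean.

  For fixed \<open>y\<close> and \<open>h\<close>, rotate the feature space so that \<open>y\<close> and \<open>h\<close> lie in the span of the first two basis
  vectors.  If \<open>W\<theta> = y\<close>, then the combination of the rows of the data matrix with coefficients \<open>\<theta>\<close> is
  orthogonal to all rows but the first, so that \<open>\<theta>\<close> is read off the Gram-Schmidt coordinates of the first
  two rows relative to the others.  These coordinates are again independent standard normal variables, which
  yields the variables \<open>\<xi>\<close>, the denominator of \<open>u\<close> and one of three normal variables whose sum is the term with
  \<open>z\<^sub>0\<close>.  Integrating over the grand mean and the new observation, in a basis adapted to \<open>y\<close> and to
  \<open>\<mu>\<^sub>1 - \<mu>\<^sub>2\<close>, produces \<open>\<xi>\<^sub>1\<close> and the numerator of \<open>u\<close>, and integrating over \<open>y\<close> produces \<open>\<xi>\<^sub>2\<close> and \<open>w\<^sub>0\<close>.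

  Laws are compared by nested integrals of nonnegative functions, so each rotation may depend on the variables
  of the outer integrals without being a measurable function of them.
\<close>

section \<open>Orthonormal families for inner products on finite index sets\<close>

text \<open>The discriminant is centred at the midpoint of the sample means, which is correlated
  with their difference \<open>y\<close> when the sample sizes differ. The grand mean is independent
  of \<open>y\<close>, and the step from midpoint to grand mean is a multiple of \<open>y\<close>;
  this produces the coefficient with \<open>lam * n i - 2\<close>. The mean of \<open>h\<close> is
  the mean difference divided by \<open>lam * n i\<close>, up to sign. Only the two numbers
  \<open>y \<bullet> \<theta>\<close> and \<open>h \<bullet> \<theta>\<close> for the solution of
  \<open>W \<theta> = y\<close> are needed, so no density of \<open>W\<close> or of its inverse
  appears. The degrees of freedom are residual dimensions: \<open>W\<close> comes from
  \<open>m = n 1 + n 2 - 2\<close> columns, one row taken off \<open>p - 1\<close> others leaves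
  \<open>m - (p - 1)\<close>, one row taken off \<open>p - 2\<close> others leaves
  \<open>m - (p - 2)\<close>. The conditional variance
  \<open>1 + 1 / (n 1 + n 2) + \<zeta> / \<kappa>\<close> collects the new observation, the grand
  mean and the scatter matrix. Here \<open>\<zeta>\<close> is the squared length of the part of
  \<open>h\<close> orthogonal to \<open>y\<close>. Given the grand mean it is non-central
  chi-squared, with a parameter that is itself random; this is the origin of the two-stage law of
  \<open>u\<close>.\<close>

lemma homogeneous_system_nontrivial:
  fixes c :: "'k \<Rightarrow> 'i \<Rightarrow> real"
  assumes "finite K" "finite I" "card K < card I"
  shows "\<exists>v. (\<exists>i\<in>I. v i \<noteq> 0) \<and> (\<forall>k\<in>K. (\<Sum>i\<in>I. c k i * v i) = 0)"
  using assms
proof (induction K arbitrary: I c rule: finite_induct)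
  case empty
  then obtain i where "i \<in> I" by (metis card.empty card_gt_0_iff equals0I)
  then show ?case by (intro exI[of _ "\<lambda>_. 1"]) auto
next
  case (insert k K)
  show ?case
  proof (cases "\<forall>i\<in>I. c k i = 0")
    case True
    have "card K < card I" using insert by simp
    from insert.IH[OF insert.prems(1) this, of c] True show ?thesis by auto
  next
    case False
    then obtain i0 where i0: "i0 \<in> I" "c k i0 \<noteq> 0" by auto
    \<comment> \<open>Gaussian elimination: equation \<open>k\<close> is solved for the unknown
      \<open>i0\<close>, and subtracting multiples of it removes \<open>i0\<close> from the other
      equations. One equation and one unknown are lost, so the inequality of cardinalities
      persists.\<close>
    define J where "J = I - {i0}"
    have J: "finite J" "card K < card J" "I = insert i0 J" "i0 \<notin> J"
      using insert i0 by (auto simp: J_def)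
    obtain v where v: "\<exists>i\<in>J. v i \<noteq> 0"
      "\<And>l. l \<in> K \<Longrightarrow> (\<Sum>i\<in>J. (c l i - c l i0 * c k i / c k i0) * v i) = 0"
      using insert.IH[OF J(1,2), of "\<lambda>l i. c l i - c l i0 * c k i / c k i0"] by auto
    define s where "s = (\<Sum>i\<in>J. c k i * v i)"
    define w where "w = v(i0 := - s / c k i0)"
    have w: "(\<Sum>i\<in>I. c l i * w i) = - c l i0 * s / c k i0 + (\<Sum>i\<in>J. c l i * v i)" for l
    proof -
      have "(\<Sum>i\<in>J. c l i * w i) = (\<Sum>i\<in>J. c l i * v i)"
        using J(4) by (intro sum.cong) (auto simp: w_def)
      then show ?thesis using J by (simp add: w_def)
    qed
    have "(\<Sum>i\<in>I. c l i * w i) = 0" if "l \<in> insert k K" for l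
    proof (cases "l = k")
      case True then show ?thesis using i0 by (simp add: w s_def)
    next
      case False
      then have "l \<in> K" using that by simp
      have "(\<Sum>i\<in>J. (c l i - c l i0 * c k i / c k i0) * v i) = (\<Sum>i\<in>J. c l i * v i) - c l i0 * s / c k i0"
        unfolding s_def by (simp add: left_diff_distrib sum_subtractf sum_distrib_left sum_divide_distrib mult.assoc)
      then show ?thesis using v(2)[OF \<open>l \<in> K\<close>] w[of l] by simp
    qed
    moreover have "\<exists>i\<in>I. w i \<noteq> 0" using v(1) J by (auto simp: w_def)
    ultimately show ?thesis by auto
  qed
qed

text \<open>The form is kept abstract since it is used both for dot products and for \<open>u \<bullet> (\<Sigma>\<inverse> v)\<close>.\<close>

locale finite_ip =
  fixes I :: "'i set" and B :: "('i \<Rightarrow> real) \<Rightarrow> ('i \<Rightarrow> real) \<Rightarrow> real"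
  assumes fin: "finite I"
    and cong: "(\<And>i. i \<in> I \<Longrightarrow> u i = u' i) \<Longrightarrow> B u w = B u' w"
    and lin: "B (\<lambda>i. c * u i + v i) w = c * B u w + B v w"
    and sym: "B u v = B v u"
    and pos: "i \<in> I \<Longrightarrow> v i \<noteq> 0 \<Longrightarrow> B v v > 0"
begin

definition orthonormal :: "('j \<Rightarrow> 'i \<Rightarrow> real) \<Rightarrow> 'j set \<Rightarrow> bool" where
  "orthonormal e J \<longleftrightarrow> (\<forall>j\<in>J. \<forall>k\<in>J. B (e j) (e k) = (if j = k then 1 else 0))"

lemma zero: "B (\<lambda>i. 0) w = 0"
  using lin[of "-1" "\<lambda>i. 0" "\<lambda>i. 0" w] by simp

lemma scale: "B (\<lambda>i. c * u i) w = c * B u w"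
  using lin[of c u "\<lambda>i. 0" w] zero by simp

lemma scale_right: "B w (\<lambda>i. c * u i) = c * B w u"
  using scale sym by metis

lemma sum: "B (\<lambda>i. \<Sum>k\<in>K. c k * u k i) w = (\<Sum>k\<in>K. c k * B (u k) w)"
proof (induction K rule: infinite_finite_induct)
  case (insert k K)
  then show ?case using lin[of "c k" "u k" "\<lambda>i. \<Sum>k\<in>K. c k * u k i" w] by simp
qed (auto simp: zero)

lemma sum_right: "B w (\<lambda>i. \<Sum>k\<in>K. c k * u k i) = (\<Sum>k\<in>K. c k * B w (u k))"
  by (subst sym) (simp add: sum sym)

lemma diff: "B (\<lambda>i. u i - v i) w = B u w - B v w"
  using lin[of "-1" v u w] by simp

lemma cong_right: "(\<And>i. i \<in> I \<Longrightarrow> u i = u' i) \<Longrightarrow> B w u = B w u'"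
  using cong sym by metis

lemma normalize:
  assumes "i \<in> I" "v i \<noteq> 0"
  shows "B (\<lambda>i. 1 / sqrt (B v v) * v i) (\<lambda>i. 1 / sqrt (B v v) * v i) = 1"
proof -
  have p: "B v v > 0" using pos assms by blast
  have "B (\<lambda>i. 1 / sqrt (B v v) * v i) (\<lambda>i. 1 / sqrt (B v v) * v i)
     = 1 / sqrt (B v v) * (1 / sqrt (B v v) * B v v)"
    by (simp only: scale scale_right)
  then show ?thesis using p by (simp add: field_simps)
qed

text \<open>Orthogonality to the vectors \<open>e j\<close> is a homogeneous linear system in the
  coordinates with more unknowns than equations; a nontrivial solution is normalized.\<close>

lemma unit_orthogonal:
  assumes "finite J" "card J < card I"
  shows "\<exists>u. B u u = 1 \<and> (\<forall>j\<in>J. B (e j) u = 0)"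
proof -
  let ?d = "\<lambda>k i. if i = k then 1 else 0 :: real"
  obtain v i where v: "i \<in> I" "v i \<noteq> 0" "\<And>j. j \<in> J \<Longrightarrow> (\<Sum>k\<in>I. B (e j) (?d k) * v k) = 0"
    using homogeneous_system_nontrivial[OF assms(1) fin assms(2), of "\<lambda>j k. B (e j) (?d k)"] by auto
  have "B (e j) v = (\<Sum>k\<in>I. B (e j) (?d k) * v k)" for j
  proof -
    have "B (e j) v = B (e j) (\<lambda>i. \<Sum>k\<in>I. v k * ?d k i)"
      by (intro cong_right) (simp add: fin if_distrib[of "(*) _"] cong: if_cong)
    then show ?thesis by (simp add: sum_right mult.commute)
  qed
  then have z: "B (e j) v = 0" if "j \<in> J" for j using v(3) that by simp
  show ?thesis
    by (intro exI[of _ "\<lambda>i. 1 / sqrt (B v v) * v i"] conjI ballI normalize[of i])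
       (use v in \<open>simp_all only: scale_right z mult_zero_right not_False_eq_True\<close>)
qed

text \<open>Otherwise the nonzero difference \<open>w\<close> of the two sides, which is orthogonal
  to all \<open>e j\<close>, would join them to form \<open>card I + 1\<close> vectors (the index
  \<open>None\<close> is that of \<open>w\<close>). A linear relation between these exists by
  dimension, and pairing it with \<open>w\<close> and with each \<open>e j\<close> annihilates all
  its coefficients.\<close>

lemma expand:
  assumes J: "finite J" "card J = card I" and o: "orthonormal e J" and i: "i \<in> I"
  shows "v i = (\<Sum>j\<in>J. B v (e j) * e j i)"
proof (rule ccontr)
  assume neq: "v i \<noteq> (\<Sum>j\<in>J. B v (e j) * e j i)"
  define w where "w = (\<lambda>i. v i - (\<Sum>j\<in>J. B v (e j) * e j i))"
  have wi: "w i \<noteq> 0" using neq by (simp add: w_def)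
  have we: "B w (e j) = 0" if "j \<in> J" for j
  proof -
    have "(\<Sum>k\<in>J. B v (e k) * B (e k) (e j)) = (\<Sum>k\<in>J. if k = j then B v (e k) else 0)"
      using o that by (intro sum.cong) (auto simp: orthonormal_def)
    then show ?thesis using that J by (simp add: w_def diff sum)
  qed
  define f where "f = (\<lambda>j. case j of None \<Rightarrow> w | Some j \<Rightarrow> e j)"
  define K where "K = insert None (Some ` J)"
  have K: "finite K" "card I < card K" using J by (auto simp: K_def card_image)
  obtain d k where d: "k \<in> K" "d k \<noteq> 0" "\<And>i. i \<in> I \<Longrightarrow> (\<Sum>k\<in>K. f k i * d k) = 0"
    using homogeneous_system_nontrivial[OF fin K, of "\<lambda>i k. f k i"] by auto
  have "(\<Sum>k\<in>K. d k * B (f k) u) = B (\<lambda>i. 0) u" for u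
    unfolding sum[symmetric] using d(3) by (intro cong) (simp add: mult.commute)
  then have 0: "(\<Sum>k\<in>K. d k * B (f k) u) = 0" for u by (simp add: zero)
  have S: "(\<Sum>k\<in>K. d k * B (f k) u) = d None * B w u + (\<Sum>j\<in>J. d (Some j) * B (e j) u)" for u
    unfolding K_def using J by (simp add: sum.reindex f_def)
  have "d None * B w w = 0" using 0[of w] S[of w] we by (simp add: sym)
  then have dn: "d None = 0" using pos[where v = w, OF i wi] by simp
  have "d (Some j) = 0" if "j \<in> J" for j
  proof -
    have "(\<Sum>k\<in>J. d (Some k) * B (e k) (e j)) = (\<Sum>k\<in>J. if k = j then d (Some k) else 0)"
      using o that by (intro sum.cong) (auto simp: orthonormal_def)
    then show ?thesis using 0[of "e j"] S[of "e j"] that J dn by simp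
  qed
  then show False using d(1,2) dn by (auto simp: K_def)
qed

lemma parseval:
  assumes J: "finite J" "card J = card I" and o: "orthonormal e J"
  shows "B v w = (\<Sum>j\<in>J. B v (e j) * B w (e j))"
proof -
  have "B v w = B (\<lambda>i. \<Sum>j\<in>J. B v (e j) * e j i) w"
    by (intro cong expand[OF J o])
  then show ?thesis by (simp add: sum sym)
qed

text \<open>Gram-Schmidt on an arbitrary sequence: where a vector depends on its predecessors, \<open>e\<close> continues with
  any unit vector orthogonal to the previous ones.\<close>

lemma qr_aux:
  assumes "k \<le> card I"
  shows "\<exists>e. orthonormal e {..<k} \<and>
    (\<forall>j<k. B (a j) (e j) \<ge> 0 \<and> (\<forall>i\<in>I. a j i = (\<Sum>l\<le>j. B (a j) (e l) * e l i)))"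
  using assms
proof (induction k)
  case 0
  show ?case by (auto simp: orthonormal_def)
next
  case (Suc k)
  then obtain e where o: "orthonormal e {..<k}" and
    e: "\<And>j. j < k \<Longrightarrow> B (a j) (e j) \<ge> 0"
      "\<And>i j. j < k \<Longrightarrow> i \<in> I \<Longrightarrow> a j i = (\<Sum>l\<le>j. B (a j) (e l) * e l i)" by auto
  define r where "r = (\<lambda>i. a k i - (\<Sum>l<k. B (a k) (e l) * e l i))"
  have re: "B r (e j) = 0" if "j < k" for j
  proof -
    have "(\<Sum>l<k. B (a k) (e l) * B (e l) (e j)) = (\<Sum>l<k. if l = j then B (a k) (e l) else 0)"
      using o that by (intro sum.cong) (auto simp: orthonormal_def)
    then show ?thesis using that by (simp add: r_def diff sum)
  qed
  obtain u where u: "B u u = 1" "\<And>j. j < k \<Longrightarrow> B (e j) u = 0" "B (a k) u \<ge> 0"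
    "\<And>i. i \<in> I \<Longrightarrow> r i = B (a k) u * u i"
  proof (cases "\<exists>i\<in>I. r i \<noteq> 0")
    case False
    obtain u where u: "B u u = 1" "\<forall>j\<in>{..<k}. B (e j) u = 0"
      using unit_orthogonal[of "{..<k}" e] Suc.prems by auto
    have "B r u = B (\<lambda>i. 0) u" using False by (intro cong) auto
    moreover have "B r u = B (a k) u - (\<Sum>l<k. B (a k) (e l) * B (e l) u)" by (simp add: r_def diff sum)
    ultimately have "B (a k) u = 0" using u by (simp add: zero)
    then show ?thesis using that[of u] u False by auto
  next
    case True
    then obtain i where i: "i \<in> I" "r i \<noteq> 0" by auto
    define u where "u = (\<lambda>i. 1 / sqrt (B r r) * r i)"
    have p: "B r r > 0" using i pos by blast
    have uu: "B u u = 1" unfolding u_def by (rule normalize[of i]) fact+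
    have ue: "B (e j) u = 0" if "j < k" for j
      unfolding u_def scale_right sym[of "e j" r] using re[OF that] by simp
    have "B r u = B (a k) u - (\<Sum>l<k. B (a k) (e l) * B (e l) u)" by (simp add: r_def diff sum)
    then have "B (a k) u = B r u" using ue by simp
    also have "\<dots> = 1 / sqrt (B r r) * B r r" unfolding u_def by (rule scale_right)
    finally have au: "B (a k) u = sqrt (B r r)" using p by (simp add: real_div_sqrt)
    show ?thesis
      by (rule that[of u, OF uu ue]) (use au p in \<open>auto simp: u_def\<close>)
  qed
  define e' where "e' = e(k := u)"
  have eq: "e' j = e j" if "j < k" for j using that by (simp add: e'_def)
  have "orthonormal e' {..<Suc k}"
    using o u(1,2) u(2)[unfolded sym[of _ u]] by (auto simp: orthonormal_def e'_def less_Suc_eq)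
  moreover have "B (a j) (e' j) \<ge> 0 \<and> (\<forall>i\<in>I. a j i = (\<Sum>l\<le>j. B (a j) (e' l) * e' l i))" if "j < Suc k" for j
  proof (cases "j = k")
    case True
    have "a k i = (\<Sum>l\<le>k. B (a k) (e' l) * e' l i)" if "i \<in> I" for i
    proof -
      have "a k i = (\<Sum>l<k. B (a k) (e l) * e l i) + B (a k) u * u i"
        using u(4)[OF that] by (simp add: r_def)
      also have "(\<Sum>l<k. B (a k) (e l) * e l i) = (\<Sum>l<k. B (a k) (e' l) * e' l i)"
        by (intro sum.cong) (auto simp: eq)
      finally show ?thesis by (simp add: lessThan_Suc_atMost[symmetric] e'_def)
    qed
    then show ?thesis using True u(3) by (auto simp: e'_def)
  next
    case False
    then have j: "j < k" using that by simp
    have "(\<Sum>l\<le>j. B (a j) (e' l) * e' l i) = (\<Sum>l\<le>j. B (a j) (e l) * e l i)" for i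
      using j by (intro sum.cong) (auto simp: eq)
    then show ?thesis using e[OF j] by (auto simp: eq[OF j])
  qed
  ultimately show ?case by blast
qed

lemma qr:
  obtains e where "orthonormal e {..<card I}"
    "\<And>i j. i < j \<Longrightarrow> j < card I \<Longrightarrow> B (a i) (e j) = 0"
    "\<And>j. j < card I \<Longrightarrow> B (a j) (e j) \<ge> 0"
proof -
  obtain e where o: "orthonormal e {..<card I}" and
    e: "\<And>j. j < card I \<Longrightarrow> B (a j) (e j) \<ge> 0"
      "\<And>i j. j < card I \<Longrightarrow> i \<in> I \<Longrightarrow> a j i = (\<Sum>l\<le>j. B (a j) (e l) * e l i)"
    using qr_aux[of "card I" a] by auto
  have "B (a i) (e j) = 0" if "i < j" "j < card I" for i j
  proof -
    have "B (a i) (e j) = B (\<lambda>x. \<Sum>l\<le>i. B (a i) (e l) * e l x) (e j)"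
      using that by (intro cong e(2)) auto
    also have "\<dots> = (\<Sum>l\<le>i. B (a i) (e l) * B (e l) (e j))" by (rule sum)
    also have "\<dots> = 0" using o that by (intro sum.neutral) (auto simp: orthonormal_def)
    finally show ?thesis .
  qed
  then show ?thesis using that o e(1) by blast
qed

text \<open>Gram-Schmidt is run on the vectors \<open>a j\<close> for \<open>j < k\<close>,
  continued by \<open>v\<close> at every later position. It returns the orthonormal
  \<open>a j\<close> themselves: by Parseval the diagonal coefficient has square 1, and it is
  nonnegative, so it is 1 and not -1.\<close>

lemma qr_extend:
  assumes k: "k < card I" and o: "orthonormal a {..<k}"
  obtains e where "orthonormal e {..<card I}"
    "\<And>i j. j < k \<Longrightarrow> i \<in> I \<Longrightarrow> e j i = a j i"
    "\<And>j. k < j \<Longrightarrow> j < card I \<Longrightarrow> B v (e j) = 0"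
    "B v (e k) \<ge> 0"
proof -
  define a' where "a' = (\<lambda>i. if i < k then a i else v)"
  obtain e where e: "orthonormal e {..<card I}"
    "\<And>i j. i < j \<Longrightarrow> j < card I \<Longrightarrow> B (a' i) (e j) = 0"
    "\<And>j. j < card I \<Longrightarrow> B (a' j) (e j) \<ge> 0"
    using qr by blast
  have "\<forall>i\<in>I. e j i = a j i" if "j < k" for j
    using that
  proof (induction j rule: less_induct)
    case (less j)
    have aj: "a' j = a j" using less by (simp add: a'_def)
    have 1: "B (a j) (e l) = 0" if "l \<noteq> j" "l < card I" for l
    proof (cases "l < j")
      case True
      have "B (a j) (e l) = B (a j) (a l)" using less True by (intro cong_right) auto
      then show ?thesis using o less True by (auto simp: orthonormal_def)
    next
      case False
      then show ?thesis using e(2)[of j l] that aj by auto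
    qed
    have jI: "j < card I" using less k by simp
    have "B (a j) (a j) = (\<Sum>l<card I. B (a j) (e l) * B (a j) (e l))"
      using e(1) by (intro parseval) auto
    also have "\<dots> = (\<Sum>l<card I. if l = j then B (a j) (e l) * B (a j) (e l) else 0)"
      by (intro sum.cong) (auto simp: 1)
    finally have "(B (a j) (e j))\<^sup>2 = 1"
      using jI o less by (simp add: orthonormal_def power2_eq_square)
    then have 2: "B (a j) (e j) = 1"
      using e(3)[OF jI] aj by (simp add: power2_eq_1_iff)
    have "a j i = e j i" if "i \<in> I" for i
    proof -
      have "a j i = (\<Sum>l<card I. B (a j) (e l) * e l i)"
        using e(1) that by (intro expand) auto
      also have "\<dots> = (\<Sum>l<card I. if l = j then e l i else 0)"
        by (intro sum.cong) (auto simp: 1 2)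
      finally show ?thesis using jI by simp
    qed
    then show ?case by auto
  qed
  moreover have "B v (e j) = 0" if "k < j" "j < card I" for j
    using e(2)[OF that] by (simp add: a'_def)
  moreover have "B v (e k) \<ge> 0" using e(3)[OF k] by (simp add: a'_def)
  ultimately show ?thesis using that e(1) by blast
qed

end

definition dot :: "'i set \<Rightarrow> ('i \<Rightarrow> real) \<Rightarrow> ('i \<Rightarrow> real) \<Rightarrow> real" where
  "dot I u v = (\<Sum>i\<in>I. u i * v i)"

lemma finite_ip_dot: "finite I \<Longrightarrow> finite_ip I (dot I)"
proof (standard, goal_cases)
  case (5 i v)
  have "0 < v i * v i" using 5 by (metis not_real_square_gt_zero)
  then show ?case unfolding dot_def using 5 by (intro sum_pos2[of I i]) auto
qed (auto simp: dot_def sum.distrib sum_distrib_left algebra_simps intro!: sum.cong)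

text \<open>Expanding a coordinate unit vector in the family \<open>e\<close> gives the
  orthogonality relations for the columns of the matrix whose rows are the
  \<open>e j\<close>.\<close>

lemma dot_dual:
  assumes I: "finite I" and J: "finite J" "card J = card I"
    and o: "finite_ip.orthonormal (dot I) e J" and i: "i \<in> I" "i' \<in> I"
  shows "(\<Sum>j\<in>J. e j i * e j i') = (if i = i' then 1 else 0)"
proof -
  interpret finite_ip I "dot I" by (rule finite_ip_dot[OF I])
  have d: "dot I (\<lambda>k. if k = i then 1 else 0) v = v i" for v
    using I i by (simp add: dot_def if_distrib[of "\<lambda>x. x * _"] cong: if_cong)
  show ?thesis using expand[OF J o i(2), of "\<lambda>k. if k = i then 1 else 0"] by (auto simp: d)
qed

section \<open>Orthogonal invariance of the standard normal law\<close>

definition stdn :: "'i set \<Rightarrow> ('i \<Rightarrow> real) measure" where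
  "stdn I = (\<Pi>\<^sub>M i\<in>I. std_normal_measure)"

lemma prob_space_stdn: "prob_space (stdn I)"
  unfolding stdn_def by (intro prob_space_PiM prob_space_std_normal)

lemma sets_stdn [simp, measurable_cong]: "sets (stdn I) = sets (\<Pi>\<^sub>M i\<in>I. borel)"
  unfolding stdn_def by (intro sets_PiM_cong) auto

lemma space_stdn [simp]: "space (stdn I) = space (\<Pi>\<^sub>M i\<in>I. borel)"
  by (rule sets_eq_imp_space_eq) simp

lemma sets_PiM_lborel [simp, measurable_cong]: "sets (\<Pi>\<^sub>M i\<in>I. lborel) = sets (\<Pi>\<^sub>M i\<in>I. (borel :: real measure))"
  by (intro sets_PiM_cong) auto

lemma space_PiM_lborel [simp]: "space (\<Pi>\<^sub>M i\<in>I. lborel) = space (\<Pi>\<^sub>M i\<in>I. (borel :: real measure))"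
  by (rule sets_eq_imp_space_eq) (rule sets_PiM_lborel)

interpretation lb: product_sigma_finite "\<lambda>_. lborel :: real measure"
  by unfold_locales

lemma stdn_density:
  assumes "finite J"
  shows "stdn J = density (\<Pi>\<^sub>M j\<in>J. lborel) (\<lambda>y. \<Prod>j\<in>J. ennreal (std_normal_density (y j)))"
proof -
  interpret N: product_sigma_finite "\<lambda>_. std_normal_measure"
    by (intro product_sigma_finite.intro prob_space_imp_sigma_finite prob_space_std_normal)
  have "density (\<Pi>\<^sub>M j\<in>J. lborel) (\<lambda>y. \<Prod>j\<in>J. ennreal (std_normal_density (y j)))
    = (\<Pi>\<^sub>M j\<in>J. std_normal_measure)"
  proof (rule N.PiM_eqI)
    show "sets (density (\<Pi>\<^sub>M j\<in>J. lborel) (\<lambda>y. \<Prod>j\<in>J. ennreal (std_normal_density (y j))))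
      = sets (\<Pi>\<^sub>M j\<in>J. std_normal_measure)"
      by (simp add: sets_PiM_lborel) (intro sets_PiM_cong, auto)
  next
    fix A assume A: "\<And>i. i \<in> J \<Longrightarrow> A i \<in> sets std_normal_measure"
    then have A': "\<And>i. i \<in> J \<Longrightarrow> A i \<in> sets borel" by simp
    have [measurable]: "Pi\<^sub>E J A \<in> sets (\<Pi>\<^sub>M j\<in>J. borel)"
      using A' assms by (intro sets_PiM_I_finite) auto
    have "emeasure (density (\<Pi>\<^sub>M j\<in>J. lborel) (\<lambda>y. \<Prod>j\<in>J. ennreal (std_normal_density (y j)))) (Pi\<^sub>E J A)
      = (\<integral>\<^sup>+y. (\<Prod>j\<in>J. ennreal (std_normal_density (y j))) * indicator (Pi\<^sub>E J A) y \<partial>(\<Pi>\<^sub>M j\<in>J. lborel))"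
      by (subst emeasure_density) auto
    also have "\<dots> = (\<integral>\<^sup>+y. (\<Prod>j\<in>J. ennreal (std_normal_density (y j)) * indicator (A j) (y j)) \<partial>(\<Pi>\<^sub>M j\<in>J. lborel))"
    proof (rule nn_integral_cong)
      fix y assume y: "y \<in> space (\<Pi>\<^sub>M j\<in>J. (lborel :: real measure))"
      have "indicator (Pi\<^sub>E J A) y = (\<Prod>j\<in>J. indicator (A j) (y j) :: ennreal)"
      proof (cases "y \<in> Pi\<^sub>E J A")
        case False
        then obtain j where "j \<in> J" "y j \<notin> A j" using y by (auto simp: space_PiM PiE_def Pi_def)
        then have "(\<Prod>j\<in>J. indicator (A j) (y j) :: ennreal) = 0"
          using assms \<open>j \<in> J\<close> by (intro prod_zero) (auto intro!: bexI[of _ j])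
        then show ?thesis using False by simp
      qed (auto simp: PiE_def Pi_def intro!: prod.neutral[symmetric])
      then show "(\<Prod>j\<in>J. ennreal (std_normal_density (y j))) * indicator (Pi\<^sub>E J A) y
        = (\<Prod>j\<in>J. ennreal (std_normal_density (y j)) * indicator (A j) (y j))"
        by (simp add: prod.distrib)
    qed
    also have "\<dots> = (\<Prod>j\<in>J. \<integral>\<^sup>+x. ennreal (std_normal_density x) * indicator (A j) x \<partial>lborel)"
      by (subst lb.product_nn_integral_prod[OF assms]) (use A' in \<open>auto intro!: borel_measurable_times borel_measurable_indicator\<close>)
    also have "\<dots> = (\<Prod>j\<in>J. emeasure std_normal_measure (A j))"
      unfolding std_normal_measure_def using A' by (intro prod.cong refl emeasure_density[symmetric]) auto
    finally show "emeasure (density (\<Pi>\<^sub>M j\<in>J. lborel) (\<lambda>y. \<Prod>j\<in>J. ennreal (std_normal_density (y j)))) (Pi\<^sub>E J A)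
      = (\<Prod>i\<in>J. emeasure std_normal_measure (A i))" .
  qed fact
  then show ?thesis by (simp add: stdn_def)
qed

text \<open>Boxes go to boxes, so the one-dimensional invariance of Lebesgue measure is enough. The
  two signs of \<open>c\<close> are those in \<open>T x + y\<close> and \<open>T x - y\<close> in
  the proof of \<open>nn_integral_equivariant\<close>.\<close>

lemma distr_PiM_lborel_affine:
  fixes u :: "'i \<Rightarrow> real"
  assumes "finite J" "\<bar>c\<bar> = 1"
  shows "distr (\<Pi>\<^sub>M j\<in>J. lborel) (\<Pi>\<^sub>M j\<in>J. lborel) (\<lambda>y. \<lambda>j\<in>J. u j + c * y j) = (\<Pi>\<^sub>M j\<in>J. lborel)"
proof (rule lb.PiM_eqI)
  fix A :: "'i \<Rightarrow> real set" assume A: "\<And>i. i \<in> J \<Longrightarrow> A i \<in> sets lborel"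
  define T where "T = (\<lambda>y. \<lambda>j\<in>J. u j + c * y j)"
  define A' where "A' = (\<lambda>j. (\<lambda>x. u j + c * x) -` A j)"
  have A': "A' j \<in> sets lborel" if "j \<in> J" for j
    using measurable_sets[of "\<lambda>x. u j + c * x" lborel borel "A j"] A[OF that] by (auto simp: A'_def)
  have [measurable]: "T \<in> measurable (\<Pi>\<^sub>M j\<in>J. lborel) (\<Pi>\<^sub>M j\<in>J. lborel)"
    unfolding T_def by measurable
  have "emeasure (distr (\<Pi>\<^sub>M j\<in>J. lborel) (\<Pi>\<^sub>M j\<in>J. lborel) T) (Pi\<^sub>E J A)
    = emeasure (\<Pi>\<^sub>M j\<in>J. lborel) (T -` (Pi\<^sub>E J A) \<inter> space (\<Pi>\<^sub>M j\<in>J. lborel))"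
    using A assms by (subst emeasure_distr) (auto intro!: sets_PiM_I_finite)
  also have "T -` (Pi\<^sub>E J A) \<inter> space (\<Pi>\<^sub>M j\<in>J. lborel) = Pi\<^sub>E J A'"
    by (auto simp: T_def A'_def space_PiM PiE_def Pi_def extensional_def)
  also have "emeasure (\<Pi>\<^sub>M j\<in>J. lborel) (Pi\<^sub>E J A') = (\<Prod>j\<in>J. emeasure lborel (A' j))"
    using A' by (intro lb.emeasure_PiM assms)
  also have "\<dots> = (\<Prod>j\<in>J. emeasure lborel (A j))"
  proof (intro prod.cong refl)
    fix j assume j: "j \<in> J"
    have c: "c \<noteq> 0" using assms by auto
    have "lborel = distr lborel borel (\<lambda>x. u j + c * x)"
      using lborel_real_affine[OF c, of "u j"] assms by (simp add: density_1 one_ennreal_def[symmetric])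
    then have "emeasure lborel (A j) = emeasure (distr lborel borel (\<lambda>x. u j + c * x)) (A j)" by simp
    also have "\<dots> = emeasure lborel (A' j)"
      using A[OF j] by (subst emeasure_distr) (auto simp: A'_def)
    finally show "emeasure lborel (A' j) = emeasure lborel (A j)" by simp
  qed
  finally show "emeasure (distr (\<Pi>\<^sub>M j\<in>J. lborel) (\<Pi>\<^sub>M j\<in>J. lborel) (\<lambda>y. \<lambda>j\<in>J. u j + c * y j)) (Pi\<^sub>E J A)
    = (\<Prod>i\<in>J. emeasure lborel (A i))" unfolding T_def .
qed (use assms in auto)

lemma nn_integral_PiM_lborel_affine:
  assumes "finite J" "\<bar>c\<bar> = 1" and [measurable]: "f \<in> borel_measurable (\<Pi>\<^sub>M j\<in>J. borel)"
  shows "(\<integral>\<^sup>+y. f (\<lambda>j\<in>J. u j + c * y j) \<partial>(\<Pi>\<^sub>M j\<in>J. lborel)) = (\<integral>\<^sup>+y. f y \<partial>(\<Pi>\<^sub>M j\<in>J. (lborel :: real measure)))"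
proof -
  have "(\<integral>\<^sup>+y. f y \<partial>(\<Pi>\<^sub>M j\<in>J. (lborel :: real measure)))
    = (\<integral>\<^sup>+y. f y \<partial>(distr (\<Pi>\<^sub>M j\<in>J. lborel) (\<Pi>\<^sub>M j\<in>J. lborel) (\<lambda>y. \<lambda>j\<in>J. u j + c * y j)))"
    by (simp only: distr_PiM_lborel_affine[OF assms(1,2)])
  also have "\<dots> = (\<integral>\<^sup>+y. f (\<lambda>j\<in>J. u j + c * y j) \<partial>(\<Pi>\<^sub>M j\<in>J. lborel))"
    by (rule nn_integral_distr) measurable
  finally show ?thesis by simp
qed

text \<open>A substitution rule without determinants: evaluating the double integral of \<open>a (T x) * \<phi> (T x + y)\<close> in both
  orders, with the translation by \<open>y\<close> moved to the \<open>x\<close> side, shows that the image measure is a multiple of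
  Lebesgue measure.  For the densities below the factor is found by total mass.\<close>

lemma nn_integral_equivariant:
  fixes T :: "'x \<Rightarrow> 'i \<Rightarrow> real" and a \<phi> :: "('i \<Rightarrow> real) \<Rightarrow> ennreal"
  assumes L: "sigma_finite_measure L" and J: "finite J"
    and T [measurable]: "T \<in> measurable L (\<Pi>\<^sub>M j\<in>J. borel)"
    and shift: "\<And>y. y \<in> space (\<Pi>\<^sub>M j\<in>J. borel) \<Longrightarrow> \<exists>s\<in>measurable L L. distr L L s = L \<and>
      (\<forall>x\<in>space L. \<forall>j\<in>J. T (s x) j = T x j + y j)"
    and [measurable]: "a \<in> borel_measurable (\<Pi>\<^sub>M j\<in>J. borel)" "\<phi> \<in> borel_measurable (\<Pi>\<^sub>M j\<in>J. borel)"
    and one: "(\<integral>\<^sup>+y. \<phi> y \<partial>(\<Pi>\<^sub>M j\<in>J. lborel)) = 1"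
  shows "(\<integral>\<^sup>+x. a (T x) \<partial>L) = (\<integral>\<^sup>+x. \<phi> (T x) \<partial>L) * (\<integral>\<^sup>+y. a y \<partial>(\<Pi>\<^sub>M j\<in>J. lborel))"
proof -
  let ?L = "\<Pi>\<^sub>M j\<in>J. (lborel :: real measure)"
  interpret L: sigma_finite_measure L by fact
  interpret J: finite_product_sigma_finite "\<lambda>_. lborel :: real measure" J by unfold_locales fact
  interpret P: pair_sigma_finite L ?L ..
  have ext: "T x \<in> extensional J" if "x \<in> space L" for x
    using measurable_space[OF T that] by (simp add: space_PiM PiE_def)
  have "(\<integral>\<^sup>+x. a (T x) \<partial>L) = (\<integral>\<^sup>+x. a (T x) * (\<integral>\<^sup>+y. \<phi> (\<lambda>j\<in>J. T x j + 1 * y j) \<partial>?L) \<partial>L)"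
    using one by (simp only: nn_integral_PiM_lborel_affine[OF J] abs_one assms mult_1_right)
  also have "\<dots> = (\<integral>\<^sup>+x. \<integral>\<^sup>+y. a (T x) * \<phi> (\<lambda>j\<in>J. T x j + y j) \<partial>?L \<partial>L)"
    by (intro nn_integral_cong) (simp add: nn_integral_cmult)
  also have "\<dots> = (\<integral>\<^sup>+y. \<integral>\<^sup>+x. a (T x) * \<phi> (\<lambda>j\<in>J. T x j + y j) \<partial>L \<partial>?L)"
    by (rule P.Fubini'[symmetric]) measurable
  also have "\<dots> = (\<integral>\<^sup>+y. \<integral>\<^sup>+x. a (\<lambda>j\<in>J. T x j - y j) * \<phi> (T x) \<partial>L \<partial>?L)"
  proof (rule nn_integral_cong)
    fix y assume "y \<in> space ?L"
    then have y[measurable]: "y \<in> space (\<Pi>\<^sub>M j\<in>J. borel)" by (simp add: space_PiM_lborel)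
    obtain s where [measurable]: "s \<in> measurable L L" and s: "distr L L s = L"
      "\<And>x j. x \<in> space L \<Longrightarrow> j \<in> J \<Longrightarrow> T (s x) j = T x j + y j"
      using shift[OF y] by auto
    \<comment> \<open>Replacing \<open>x\<close> by \<open>s x\<close> preserves \<open>L\<close>
      and adds \<open>y\<close> to \<open>T x\<close>. Since translating back by \<open>y\<close>
      recovers \<open>T x\<close>, the integrand is \<open>g (T (s x))\<close>.\<close>
    define g where "g = (\<lambda>t. a (\<lambda>j\<in>J. t j - y j) * \<phi> t)"
    have [measurable]: "g \<in> borel_measurable (\<Pi>\<^sub>M j\<in>J. borel)"
      unfolding g_def by measurable
    have "(\<integral>\<^sup>+x. a (T x) * \<phi> (\<lambda>j\<in>J. T x j + y j) \<partial>L) = (\<integral>\<^sup>+x. g (T (s x)) \<partial>L)"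
    proof (rule nn_integral_cong)
      fix x assume x: "x \<in> space L"
      have sx: "s x \<in> space L" using measurable_space[of s L L x] x by simp
      have "T (s x) = (\<lambda>j\<in>J. T x j + y j)"
        using s(2)[OF x] ext[OF sx] by (auto simp: fun_eq_iff extensional_def)
      moreover have "(\<lambda>j\<in>J. (\<lambda>j\<in>J. T x j + y j) j - y j) = T x"
        using ext[OF x] by (auto simp: fun_eq_iff extensional_def)
      ultimately show "a (T x) * \<phi> (\<lambda>j\<in>J. T x j + y j) = g (T (s x))"
        by (simp add: g_def)
    qed
    also have "\<dots> = (\<integral>\<^sup>+x. g (T x) \<partial>distr L L s)"
      by (rule nn_integral_distr[symmetric]) measurable
    finally show "(\<integral>\<^sup>+x. a (T x) * \<phi> (\<lambda>j\<in>J. T x j + y j) \<partial>L)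
       = (\<integral>\<^sup>+x. a (\<lambda>j\<in>J. T x j - y j) * \<phi> (T x) \<partial>L)" by (simp add: s(1) g_def)
  qed
  also have "\<dots> = (\<integral>\<^sup>+x. \<integral>\<^sup>+y. a (\<lambda>j\<in>J. T x j - y j) * \<phi> (T x) \<partial>?L \<partial>L)"
    by (rule P.Fubini') measurable
  also have "\<dots> = (\<integral>\<^sup>+x. (\<integral>\<^sup>+y. a (\<lambda>j\<in>J. T x j + (-1) * y j) \<partial>?L) * \<phi> (T x) \<partial>L)"
    by (intro nn_integral_cong) (simp add: nn_integral_multc)
  also have "\<dots> = (\<integral>\<^sup>+x. (\<integral>\<^sup>+y. a y \<partial>?L) * \<phi> (T x) \<partial>L)"
    by (simp only: nn_integral_PiM_lborel_affine[OF J] abs_one abs_minus_cancel assms)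
  also have "\<dots> = (\<integral>\<^sup>+x. \<phi> (T x) \<partial>L) * (\<integral>\<^sup>+y. a y \<partial>?L)"
    by (subst nn_integral_cmult) (auto simp: mult.commute)
  finally show ?thesis .
qed

lemma prod_std_normal_density:
  "(\<Prod>j\<in>J. std_normal_density (y j)) = (1 / sqrt (2 * pi)) ^ card J * exp (- (\<Sum>j\<in>J. (y j)\<^sup>2) / 2)"
proof (induction J rule: infinite_finite_induct)
  case (insert j J)
  then show ?case
    by (simp add: std_normal_density_def exp_add[symmetric] add_divide_distrib)
qed auto

text \<open>The density depends on \<open>x\<close> only through \<open>T x\<close> and is there
  proportional to the standard normal density; the image of \<open>L\<close> under \<open>T\<close>,
  tested against such densities, is proportional to Lebesgue measure. \<open>L\<close> is left
  general: it is Lebesgue measure on a finite product of lines for rotations, and on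
  \<open>real^'p\<close> for Gaussian vectors with a covariance matrix.\<close>

lemma distr_density_std_normal:
  fixes T :: "'x \<Rightarrow> 'i \<Rightarrow> real"
  assumes L: "sigma_finite_measure L" and J: "finite J"
    and T [measurable]: "T \<in> measurable L (\<Pi>\<^sub>M j\<in>J. borel)"
    and shift: "\<And>y. y \<in> space (\<Pi>\<^sub>M j\<in>J. borel) \<Longrightarrow> \<exists>s\<in>measurable L L. distr L L s = L \<and>
      (\<forall>x\<in>space L. \<forall>j\<in>J. T (s x) j = T x j + y j)"
    and D: "\<And>x. x \<in> space L \<Longrightarrow> D x = C * exp (- (\<Sum>j\<in>J. (T x j)\<^sup>2) / 2)"
    and D': "prob_space (density L (\<lambda>x. ennreal (D x)))" "D \<in> borel_measurable L" and C: "C \<ge> 0"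
  shows "distr (density L (\<lambda>x. ennreal (D x))) (\<Pi>\<^sub>M j\<in>J. borel) T = stdn J"
proof -
  let ?L = "\<Pi>\<^sub>M j\<in>J. (lborel :: real measure)"
  note [measurable] = D'(2)
  define \<phi> where "\<phi> = (\<lambda>y. \<Prod>j\<in>J. ennreal (std_normal_density (y j)))"
  have phi_meas [measurable]: "\<phi> \<in> borel_measurable (\<Pi>\<^sub>M j\<in>J. borel)" unfolding \<phi>_def by measurable
  define K where "K = C * sqrt (2 * pi) ^ card J"
  have K: "K \<ge> 0" using C by (simp add: K_def)
  have "C * exp (- (\<Sum>j\<in>J. (T x j)\<^sup>2) / 2) = K * (\<Prod>j\<in>J. std_normal_density (T x j))" for x
    unfolding prod_std_normal_density K_def by (simp add: power_divide)
  moreover have "\<phi> (T x) = ennreal (\<Prod>j\<in>J. std_normal_density (T x j))" for x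
    unfolding \<phi>_def by (intro prod_ennreal) simp
  ultimately have Dphi: "ennreal (D x) = ennreal K * \<phi> (T x)" if "x \<in> space L" for x
    using that K by (simp add: D ennreal_mult prod_nonneg)
  have st: "stdn J = density ?L \<phi>" unfolding \<phi>_def by (rule stdn_density[OF J])
  have one: "(\<integral>\<^sup>+y. \<phi> y \<partial>?L) = 1"
  proof -
    interpret prob_space "stdn J" by (rule prob_space_stdn)
    have "(\<integral>\<^sup>+y. \<phi> y \<partial>?L) = (\<integral>\<^sup>+y. 1 \<partial>density ?L \<phi>)"
      by (subst nn_integral_density) auto
    also have "\<dots> = 1" unfolding st[symmetric] by (simp add: emeasure_space_1 del: space_stdn)
    finally show ?thesis .
  qed
  \<comment> \<open>The factor \<open>c\<close> absorbs both the normalizing constant of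
    \<open>D\<close> and the unknown scale of \<open>T\<close>; the test function 1 shows that it
    equals 1.\<close>
  define c where "c = ennreal K * (\<integral>\<^sup>+x. \<phi> (T x) \<partial>L)"
  have key: "(\<integral>\<^sup>+x. ennreal (D x) * f (T x) \<partial>L) = c * (\<integral>\<^sup>+y. \<phi> y * f y \<partial>?L)"
    if [measurable]: "f \<in> borel_measurable (\<Pi>\<^sub>M j\<in>J. borel)" for f
  proof -
    have "(\<integral>\<^sup>+x. ennreal (D x) * f (T x) \<partial>L) = (\<integral>\<^sup>+x. ennreal K * (\<phi> (T x) * f (T x)) \<partial>L)"
      by (intro nn_integral_cong) (simp add: Dphi mult.assoc)
    also have "\<dots> = ennreal K * (\<integral>\<^sup>+x. \<phi> (T x) * f (T x) \<partial>L)"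
      by (rule nn_integral_cmult) measurable
    also have "(\<integral>\<^sup>+x. \<phi> (T x) * f (T x) \<partial>L) = (\<integral>\<^sup>+x. \<phi> (T x) \<partial>L) * (\<integral>\<^sup>+y. \<phi> y * f y \<partial>?L)"
      by (rule nn_integral_equivariant[OF L J T shift _ phi_meas one]) simp_all
    finally show ?thesis by (simp add: c_def mult.assoc)
  qed
  have "c = 1"
  proof -
    interpret prob_space "density L (\<lambda>x. ennreal (D x))" by fact
    have "(\<integral>\<^sup>+x. ennreal (D x) \<partial>L) = (\<integral>\<^sup>+x. 1 \<partial>density L (\<lambda>x. ennreal (D x)))"
      by (subst nn_integral_density) auto
    also have "\<dots> = 1" using emeasure_space_1 by simp
    finally have "(\<integral>\<^sup>+x. ennreal (D x) \<partial>L) = 1" .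
    then show ?thesis using key[of "\<lambda>_. 1"] one by simp
  qed
  show ?thesis
  proof (rule measure_eqI)
    fix A assume "A \<in> sets (distr (density L (\<lambda>x. ennreal (D x))) (\<Pi>\<^sub>M j\<in>J. borel) T)"
    then have [measurable]: "A \<in> sets (\<Pi>\<^sub>M j\<in>J. borel)" by simp
    have "emeasure (distr (density L (\<lambda>x. ennreal (D x))) (\<Pi>\<^sub>M j\<in>J. borel) T) A
      = (\<integral>\<^sup>+x. indicator A x \<partial>distr (density L (\<lambda>x. ennreal (D x))) (\<Pi>\<^sub>M j\<in>J. borel) T)" by simp
    also have "\<dots> = (\<integral>\<^sup>+x. ennreal (D x) * indicator A (T x) \<partial>L)"
      by (subst nn_integral_distr) (auto simp: nn_integral_density)
    also have "\<dots> = (\<integral>\<^sup>+y. \<phi> y * indicator A y \<partial>?L)"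
      by (subst key) (auto simp: \<open>c = 1\<close>)
    also have "\<dots> = emeasure (stdn J) A"
      unfolding st by (subst emeasure_density) auto
    finally show "emeasure (distr (density L (\<lambda>x. ennreal (D x))) (\<Pi>\<^sub>M j\<in>J. borel) T) A = emeasure (stdn J) A" .
  qed simp
qed

text \<open>By Parseval the joint density is the same function of the new coordinates, and adding
  \<open>y\<close> to these amounts to translating \<open>v\<close> by the combination of the
  \<open>e j\<close> with coefficients \<open>y j\<close>.\<close>

lemma distr_stdn_orthonormal:
  fixes e :: "'j \<Rightarrow> 'i \<Rightarrow> real"
  assumes I: "finite I" and J: "finite J" "card J = card I"
    and o: "finite_ip.orthonormal (dot I) e J"
  shows "distr (stdn I) (\<Pi>\<^sub>M j\<in>J. borel) (\<lambda>v. \<lambda>j\<in>J. dot I (e j) v) = stdn J"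
proof -
  interpret ip: finite_ip I "dot I" by (rule finite_ip_dot[OF I])
  interpret I: finite_product_sigma_finite "\<lambda>_. lborel :: real measure" I by unfold_locales fact
  let ?L = "\<Pi>\<^sub>M i\<in>I. (lborel :: real measure)"
  let ?T = "\<lambda>v. \<lambda>j\<in>J. dot I (e j) v"
  let ?D = "\<lambda>y. \<Prod>i\<in>I. std_normal_density (y i)"
  have D: "(\<lambda>y. \<Prod>i\<in>I. ennreal (std_normal_density (y i))) = (\<lambda>y. ennreal (?D y))"
    by (intro ext prod_ennreal) simp
  have st: "stdn I = density ?L (\<lambda>y. ennreal (?D y))" using stdn_density[OF I] D by simp
  show ?thesis unfolding st
  proof (rule distr_density_std_normal[where C = "(1 / sqrt (2 * pi)) ^ card I"])
    show "sigma_finite_measure ?L" ..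
    show "?T \<in> measurable ?L (\<Pi>\<^sub>M j\<in>J. borel)" unfolding dot_def by measurable
    show "prob_space (density ?L (\<lambda>y. ennreal (?D y)))" unfolding st[symmetric] by (rule prob_space_stdn)
    show "?D \<in> borel_measurable ?L" by measurable
    show "?D x = (1 / sqrt (2 * pi)) ^ card I * exp (- (\<Sum>j\<in>J. (?T x j)\<^sup>2) / 2)" for x
    proof -
      have "(\<Sum>i\<in>I. (x i)\<^sup>2) = dot I x x" by (simp add: dot_def power2_eq_square)
      also have "\<dots> = (\<Sum>j\<in>J. (?T x j)\<^sup>2)"
        by (subst ip.parseval[OF J o]) (simp add: power2_eq_square ip.sym)
      finally show ?thesis by (simp add: prod_std_normal_density)
    qed
  next
    fix y :: "'j \<Rightarrow> real"
    define u where "u = (\<lambda>i. \<Sum>j\<in>J. y j * e j i)"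
    have u: "dot I (e j) u = y j" if "j \<in> J" for j
    proof -
      have "(\<Sum>k\<in>J. y k * dot I (e j) (e k)) = (\<Sum>k\<in>J. if k = j then y k else 0)"
        using o that by (intro sum.cong) (auto simp: ip.orthonormal_def)
      then show ?thesis unfolding u_def ip.sum_right using that J by simp
    qed
    have "(\<lambda>x. \<lambda>i\<in>I. u i + 1 * x i) \<in> measurable ?L ?L" by measurable
    moreover have "distr ?L ?L (\<lambda>x. \<lambda>i\<in>I. u i + 1 * x i) = ?L"
      by (rule distr_PiM_lborel_affine[OF I]) simp
    moreover have "dot I (e j) (\<lambda>i\<in>I. u i + 1 * x i) = dot I (e j) x + dot I (e j) u" for x j
      by (simp add: dot_def algebra_simps sum.distrib)
    ultimately show "\<exists>s\<in>measurable ?L ?L. distr ?L ?L s = ?L \<and>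
       (\<forall>x\<in>space ?L. \<forall>j\<in>J. ?T (s x) j = ?T x j + y j)"
      using u by (intro bexI[of _ "\<lambda>x. \<lambda>i\<in>I. u i + 1 * x i"]) auto
  qed (use J in auto)
qed

section \<open>Independent blocks and linear forms of a standard normal vector\<close>

interpretation sn: product_sigma_finite "\<lambda>_. std_normal_measure"
  by (intro product_sigma_finite.intro prob_space_imp_sigma_finite prob_space_std_normal)

lemma stdn_reindex:
  assumes "inj_on \<pi> I" "\<pi> ` I \<subseteq> K"
  shows "distr (stdn K) (stdn I) (\<lambda>\<omega>. \<lambda>i\<in>I. \<omega> (\<pi> i)) = stdn I"
  unfolding stdn_def using assms by (intro distr_PiM_reindex prob_space_std_normal) auto

lemma measurable_reindex:
  assumes "\<pi> ` I \<subseteq> K"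
  shows "(\<lambda>\<omega>. \<lambda>i\<in>I. \<omega> (\<pi> i)) \<in> measurable (\<Pi>\<^sub>M i\<in>K. (borel :: real measure)) (\<Pi>\<^sub>M i\<in>I. borel)"
  using assms by (intro measurable_restrict measurable_component_singleton) auto

lemma nn_integral_stdn_reindex:
  assumes "inj_on \<pi> I" "\<pi> ` I \<subseteq> K" and [measurable]: "f \<in> borel_measurable (\<Pi>\<^sub>M i\<in>I. borel)"
  shows "(\<integral>\<^sup>+\<omega>. f (\<lambda>i\<in>I. \<omega> (\<pi> i)) \<partial>stdn K) = (\<integral>\<^sup>+x. f x \<partial>stdn I)"
proof -
  have [measurable]: "(\<lambda>\<omega>. \<lambda>i\<in>I. \<omega> (\<pi> i)) \<in> measurable (stdn K) (stdn I)"
    using measurable_reindex[OF assms(2)] by (simp cong: measurable_cong_sets)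
  show ?thesis
    by (subst stdn_reindex[OF assms(1,2), symmetric], subst nn_integral_distr) auto
qed

text \<open>Independence of disjoint blocks of coordinates, in integral form. The injections let
  each block be relabelled by an index set of choice, and the coordinates of \<open>K\<close>
  outside both images are integrated out.\<close>

lemma nn_integral_stdn_split:
  assumes I: "finite I" "inj_on \<pi> I" "\<pi> ` I \<subseteq> K" and J: "finite J" "inj_on \<rho> J" "\<rho> ` J \<subseteq> K"
    and dis: "\<pi> ` I \<inter> \<rho> ` J = {}"
    and f: "(\<lambda>(x, y). f x y) \<in> borel_measurable ((\<Pi>\<^sub>M i\<in>I. borel) \<Otimes>\<^sub>M (\<Pi>\<^sub>M j\<in>J. borel))"
  shows "(\<integral>\<^sup>+\<omega>. f (\<lambda>i\<in>I. \<omega> (\<pi> i)) (\<lambda>j\<in>J. \<omega> (\<rho> j)) \<partial>stdn K) = (\<integral>\<^sup>+x. \<integral>\<^sup>+y. f x y \<partial>stdn J \<partial>stdn I)"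
proof -
  note [measurable] = f
  have [measurable]: "(\<lambda>\<omega>. \<lambda>i\<in>I. \<omega> (\<pi> i)) \<in> measurable (\<Pi>\<^sub>M i\<in>L. (borel :: real measure)) (\<Pi>\<^sub>M i\<in>I. borel)"
    if "\<pi> ` I \<subseteq> L" for L using measurable_reindex[OF that] .
  have [measurable]: "(\<lambda>\<omega>. \<lambda>i\<in>J. \<omega> (\<rho> i)) \<in> measurable (\<Pi>\<^sub>M i\<in>L. (borel :: real measure)) (\<Pi>\<^sub>M i\<in>J. borel)"
    if "\<rho> ` J \<subseteq> L" for L using measurable_reindex[OF that] .
  have [measurable]: "(\<lambda>x. f x y) \<in> borel_measurable (\<Pi>\<^sub>M i\<in>I. borel)" if "y \<in> space (\<Pi>\<^sub>M j\<in>J. borel)" for y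
    using measurable_compose[OF measurable_Pair2'[OF that] f] by simp
  have [measurable]: "(\<lambda>y. f x y) \<in> borel_measurable (\<Pi>\<^sub>M i\<in>J. borel)" if "x \<in> space (\<Pi>\<^sub>M j\<in>I. borel)" for x
    using measurable_compose[OF measurable_Pair1'[OF that] f] by simp
  let ?K = "\<pi> ` I \<union> \<rho> ` J"
  define g where "g = (\<lambda>\<omega>. f (\<lambda>i\<in>I. \<omega> (\<pi> i)) (\<lambda>j\<in>J. \<omega> (\<rho> j)))"
  have gm: "g \<in> borel_measurable (\<Pi>\<^sub>M i\<in>?K. borel)"
  proof -
    have "(\<lambda>\<omega>. (\<lambda>i\<in>I. \<omega> (\<pi> i), \<lambda>j\<in>J. \<omega> (\<rho> j))) \<in> measurable (\<Pi>\<^sub>M i\<in>?K. (borel :: real measure))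
        ((\<Pi>\<^sub>M i\<in>I. borel) \<Otimes>\<^sub>M (\<Pi>\<^sub>M j\<in>J. borel))" by simp
    from measurable_compose[OF this f] show ?thesis by (simp add: g_def)
  qed
  have "(\<integral>\<^sup>+\<omega>. f (\<lambda>i\<in>I. \<omega> (\<pi> i)) (\<lambda>j\<in>J. \<omega> (\<rho> j)) \<partial>stdn K) = (\<integral>\<^sup>+\<omega>. g (\<lambda>i\<in>?K. \<omega> (id i)) \<partial>stdn K)"
    unfolding g_def by (intro nn_integral_cong arg_cong2[where f = f]) (auto simp: restrict_def)
  also have "\<dots> = (\<integral>\<^sup>+\<omega>. g \<omega> \<partial>stdn ?K)"
    using I J gm by (intro nn_integral_stdn_reindex) auto
  also have "\<dots> = (\<integral>\<^sup>+x. \<integral>\<^sup>+y. g (merge (\<pi> ` I) (\<rho> ` J) (x, y)) \<partial>stdn (\<rho> ` J) \<partial>stdn (\<pi> ` I))"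
    unfolding stdn_def
  proof (rule sn.product_nn_integral_fold)
    show "g \<in> borel_measurable (Pi\<^sub>M ?K (\<lambda>_. std_normal_measure))"
      using gm by (subst measurable_cong_sets[OF sets_PiM_cong refl]) auto
  qed (use I J dis in auto)
  also have "\<dots> = (\<integral>\<^sup>+x. \<integral>\<^sup>+y. f (\<lambda>i\<in>I. x (\<pi> i)) (\<lambda>j\<in>J. y (\<rho> j)) \<partial>stdn (\<rho> ` J) \<partial>stdn (\<pi> ` I))"
    unfolding g_def using dis
    by (intro nn_integral_cong arg_cong2[where f = f]) (auto simp: restrict_def merge_def fun_eq_iff)
  also have "\<dots> = (\<integral>\<^sup>+x. \<integral>\<^sup>+y. f (\<lambda>i\<in>I. x (\<pi> i)) y \<partial>stdn J \<partial>stdn (\<pi> ` I))"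
  proof (rule nn_integral_cong)
    fix x assume "x \<in> space (stdn (\<pi> ` I))"
    then have "(\<lambda>i\<in>I. x (\<pi> i)) \<in> space (\<Pi>\<^sub>M i\<in>I. borel)" by (auto simp: space_PiM)
    then show "(\<integral>\<^sup>+y. f (\<lambda>i\<in>I. x (\<pi> i)) (\<lambda>j\<in>J. y (\<rho> j)) \<partial>stdn (\<rho> ` J))
      = (\<integral>\<^sup>+y. f (\<lambda>i\<in>I. x (\<pi> i)) y \<partial>stdn J)"
      using J by (intro nn_integral_stdn_reindex) auto
  qed
  also have "\<dots> = (\<integral>\<^sup>+x. \<integral>\<^sup>+y. f x y \<partial>stdn J \<partial>stdn I)"
  proof (rule nn_integral_stdn_reindex)
    interpret sigma_finite_measure "stdn J" using prob_space_stdn prob_space_imp_sigma_finite by blast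
    show "(\<lambda>x. \<integral>\<^sup>+y. f x y \<partial>stdn J) \<in> borel_measurable (\<Pi>\<^sub>M i\<in>I. borel)"
      by measurable
  qed (use I in auto)
  finally show ?thesis .
qed

lemma nn_integral_stdn_orthonormal:
  assumes I: "finite I" and J: "finite J" "card J = card I"
    and o: "finite_ip.orthonormal (dot I) e J" and [measurable]: "f \<in> borel_measurable (\<Pi>\<^sub>M j\<in>J. borel)"
  shows "(\<integral>\<^sup>+v. f (\<lambda>j\<in>J. dot I (e j) v) \<partial>stdn I) = (\<integral>\<^sup>+z. f z \<partial>stdn J)"
proof -
  have [measurable]: "(\<lambda>v. \<lambda>j\<in>J. dot I (e j) v) \<in> measurable (stdn I) (\<Pi>\<^sub>M j\<in>J. borel)"
    unfolding dot_def by measurable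
  show ?thesis
    by (subst distr_stdn_orthonormal[OF I J o, symmetric], subst nn_integral_distr) auto
qed

lemma measurable_dot [measurable]: "dot I a \<in> borel_measurable (\<Pi>\<^sub>M i\<in>I. borel)"
  unfolding dot_def by measurable

lemma nn_integral_stdn_component:
  assumes "i \<in> I" and [measurable]: "f \<in> borel_measurable borel"
  shows "(\<integral>\<^sup>+z. f (z i) \<partial>stdn I) = (\<integral>\<^sup>+x. f x \<partial>std_normal_measure)"
proof -
  have "distr (stdn I) std_normal_measure (\<lambda>z. z i) = std_normal_measure"
    unfolding stdn_def by (rule distr_PiM_component) (use assms prob_space_std_normal in auto)
  then have "(\<integral>\<^sup>+x. f x \<partial>std_normal_measure) = (\<integral>\<^sup>+x. f x \<partial>distr (stdn I) std_normal_measure (\<lambda>z. z i))" by simp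
  also have "\<dots> = (\<integral>\<^sup>+z. f (z i) \<partial>stdn I)"
    using assms(1) by (intro nn_integral_distr) auto
  finally show ?thesis by simp
qed

text \<open>After a rotation that takes \<open>a\<close> to a nonnegative multiple of the first
  basis vector, the linear form is a multiple of one coordinate.\<close>

lemma nn_integral_stdn_dot:
  assumes I: "finite I" "I \<noteq> {}" and [measurable]: "f \<in> borel_measurable borel"
  shows "(\<integral>\<^sup>+z. f (dot I a z) \<partial>stdn I) = (\<integral>\<^sup>+x. f (sqrt (dot I a a) * x) \<partial>std_normal_measure)"
proof -
  interpret ip: finite_ip I "dot I" by (rule finite_ip_dot[OF I(1)])
  have c: "0 < card I" using I by (simp add: card_gt_0_iff)
  obtain e where e: "ip.orthonormal e {..<card I}" "\<And>j. 0 < j \<Longrightarrow> j < card I \<Longrightarrow> dot I a (e j) = 0"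
    "dot I a (e 0) \<ge> 0"
    using ip.qr_extend[OF c, of "\<lambda>_ _. 0" a] by (auto simp: ip.orthonormal_def)
  have p: "dot I a v = dot I a (e 0) * dot I (e 0) v" for v
  proof -
    have "dot I a v = (\<Sum>j<card I. dot I a (e j) * dot I v (e j))"
      by (rule ip.parseval) (use e in auto)
    also have "\<dots> = (\<Sum>j<card I. if j = 0 then dot I a (e j) * dot I v (e j) else 0)"
      by (intro sum.cong) (auto simp: e)
    finally show ?thesis using c by (simp add: ip.sym)
  qed
  have "dot I a a = (dot I a (e 0))\<^sup>2" using p[of a] by (simp add: power2_eq_square ip.sym)
  then have s: "sqrt (dot I a a) = dot I a (e 0)" using e(3) by simp
  have "(\<integral>\<^sup>+z. f (dot I a z) \<partial>stdn I) = (\<integral>\<^sup>+z. (\<lambda>x. f (sqrt (dot I a a) * x 0)) (\<lambda>j\<in>{..<card I}. dot I (e j) z) \<partial>stdn I)"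
    using c by (intro nn_integral_cong) (simp add: s p[symmetric])
  also have "\<dots> = (\<integral>\<^sup>+x. f (sqrt (dot I a a) * x 0) \<partial>stdn {..<card I})"
    using c by (intro nn_integral_stdn_orthonormal I e) auto
  also have "\<dots> = (\<integral>\<^sup>+x. f (sqrt (dot I a a) * x) \<partial>std_normal_measure)"
    using c by (intro nn_integral_stdn_component) auto
  finally show ?thesis .
qed

lemma nn_integral_normal_add:
  assumes [measurable]: "f \<in> borel_measurable borel"
  shows "(\<integral>\<^sup>+x. \<integral>\<^sup>+y. f (a * x + b * y) \<partial>std_normal_measure \<partial>std_normal_measure)
    = (\<integral>\<^sup>+x. f (sqrt (a\<^sup>2 + b\<^sup>2) * x) \<partial>std_normal_measure)"
proof -
  \<comment> \<open>The two normal variables are the coordinates of a vector indexed by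
    \<open>bool\<close>, and \<open>a * x + b * y\<close> is a linear form of it whose coefficients
    have squared norm \<open>a\<^sup>2 + b\<^sup>2\<close>.\<close>
  define c where "c = (\<lambda>t. if t then a else b)"
  have U: "finite (UNIV :: bool set)" "(UNIV :: bool set) \<noteq> {}" by auto
  interpret sigma_finite_measure std_normal_measure
    using prob_space_std_normal prob_space_imp_sigma_finite by blast
  have d: "dot UNIV c z = a * z True + b * z False" for z
    by (simp add: dot_def UNIV_bool c_def)
  have "(\<integral>\<^sup>+x. f (sqrt (a\<^sup>2 + b\<^sup>2) * x) \<partial>std_normal_measure) = (\<integral>\<^sup>+z. f (dot UNIV c z) \<partial>stdn UNIV)"
    by (subst nn_integral_stdn_dot[OF U]) (simp_all add: d, simp add: c_def power2_eq_square)
  also have "\<dots> = (\<integral>\<^sup>+z. (\<lambda>x y. f (a * x True + b * y False)) (\<lambda>i\<in>{True}. z i) (\<lambda>i\<in>{False}. z i) \<partial>stdn UNIV)"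
    by (simp add: d)
  also have "\<dots> = (\<integral>\<^sup>+x. \<integral>\<^sup>+y. f (a * x True + b * y False) \<partial>stdn {False} \<partial>stdn {True})"
    by (rule nn_integral_stdn_split) auto
  also have "\<dots> = (\<integral>\<^sup>+x. \<integral>\<^sup>+y. f (a * x True + b * y) \<partial>std_normal_measure \<partial>stdn {True})"
    by (intro nn_integral_cong nn_integral_stdn_component) auto
  also have "\<dots> = (\<integral>\<^sup>+x. \<integral>\<^sup>+y. f (a * x + b * y) \<partial>std_normal_measure \<partial>std_normal_measure)"
    by (rule nn_integral_stdn_component[where f = "\<lambda>x. \<integral>\<^sup>+y. f (a * x + b * y) \<partial>std_normal_measure"]) auto
  finally show ?thesis by simp
qed

lemma AE_std_normal_neq: "AE x in std_normal_measure. x \<noteq> c"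
proof -
  have "AE x in lborel. x \<noteq> c" by (rule AE_lborel_singleton)
  then show ?thesis unfolding std_normal_measure_def by (subst AE_density) auto
qed

lemma AE_stdn_dot_nonzero:
  assumes I: "finite I" and a: "dot I a a = 1"
  shows "AE z in stdn I. dot I a z \<noteq> 0"
proof -
  have I': "I \<noteq> {}" using a by (auto simp: dot_def)
  define S where "S = {z \<in> space (stdn I). dot I a z = 0}"
  have Sm: "S \<in> sets (stdn I)" unfolding S_def by measurable
  have "emeasure (stdn I) S = (\<integral>\<^sup>+z. indicator S z \<partial>stdn I)"
    by (rule nn_integral_indicator[OF Sm, symmetric])
  also have "\<dots> = (\<integral>\<^sup>+z. indicator {0} (dot I a z) \<partial>stdn I)"
    by (intro nn_integral_cong) (auto simp: S_def split: split_indicator)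
  also have "\<dots> = (\<integral>\<^sup>+x. indicator {0} x \<partial>std_normal_measure)"
    using nn_integral_stdn_dot[OF I I', of "indicator {0}" a] a by simp
  also have "\<dots> = (\<integral>\<^sup>+x. 0 \<partial>std_normal_measure)"
  proof (rule nn_integral_cong_AE)
    show "AE x in std_normal_measure. indicator {0} x = (0 :: ennreal)"
      using AE_std_normal_neq[of 0] by eventually_elim simp
  qed
  finally have z: "emeasure (stdn I) S = 0" by simp
  show ?thesis by (rule AE_I[OF _ z Sm]) (auto simp: S_def)
qed

section \<open>Chi-squared laws as squared norms of normal vectors\<close>

lemma noncentral_chi_squared_altdef:
  "noncentral_chi_squared m d2 = distr (stdn {..<m}) borel (\<lambda>z. \<Sum>k<m. (z k + (if k = 0 then sqrt d2 else 0))\<^sup>2)"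
  by (simp add: noncentral_chi_squared_def stdn_def)

lemma sets_noncentral_chi_squared [simp, measurable_cong]: "sets (noncentral_chi_squared m d) = sets borel"
  by (simp add: noncentral_chi_squared_def)

lemma sets_chi_squared [simp, measurable_cong]: "sets (chi_squared m) = sets borel"
  by (simp add: chi_squared_def)

lemma prob_space_noncentral_chi_squared: "prob_space (noncentral_chi_squared m d)"
  unfolding noncentral_chi_squared_altdef by (intro prob_space.prob_space_distr prob_space_stdn) measurable

lemma prob_space_chi_squared: "prob_space (chi_squared m)"
  unfolding chi_squared_def by (rule prob_space_noncentral_chi_squared)

text \<open>Rotating \<open>v\<close> into the direction of the first basis vector brings the sum
  into the shape fixed in the definition of the law. For empty \<open>I\<close> both sides evaluate
  \<open>f\<close> at 0.\<close>

lemma nn_integral_stdn_noncentral_chi_squared: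
  assumes I: "finite I" and [measurable]: "f \<in> borel_measurable borel"
  shows "(\<integral>\<^sup>+z. f (\<Sum>i\<in>I. (z i + v i)\<^sup>2) \<partial>stdn I) = (\<integral>\<^sup>+x. f x \<partial>noncentral_chi_squared (card I) (\<Sum>i\<in>I. (v i)\<^sup>2))"
proof (cases "I = {}")
  case True
  then show ?thesis
    by (simp add: noncentral_chi_squared_altdef nn_integral_distr stdn_def
      prob_space.emeasure_space_1[OF prob_space_stdn, unfolded stdn_def])
next
  case False
  interpret ip: finite_ip I "dot I" by (rule finite_ip_dot[OF I(1)])
  have c: "0 < card I" using I False by (simp add: card_gt_0_iff)
  obtain e where e: "ip.orthonormal e {..<card I}" "\<And>j. 0 < j \<Longrightarrow> j < card I \<Longrightarrow> dot I v (e j) = 0"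
    "dot I v (e 0) \<ge> 0"
    using ip.qr_extend[OF c, of "\<lambda>_ _. 0" v] by (auto simp: ip.orthonormal_def)
  have sq: "(\<Sum>i\<in>I. (x i)\<^sup>2) = (\<Sum>j<card I. (dot I (e j) x)\<^sup>2)" for x
  proof -
    have "(\<Sum>i\<in>I. (x i)\<^sup>2) = dot I x x" by (simp add: dot_def power2_eq_square)
    also have "\<dots> = (\<Sum>j<card I. dot I x (e j) * dot I x (e j))"
      by (rule ip.parseval) (use e in auto)
    finally show ?thesis by (simp add: power2_eq_square ip.sym)
  qed
  have "(\<Sum>i\<in>I. (v i)\<^sup>2) = (\<Sum>j<card I. if j = 0 then (dot I (e j) v)\<^sup>2 else 0)"
    unfolding sq by (intro sum.cong) (auto simp: e ip.sym)
  then have "sqrt (\<Sum>i\<in>I. (v i)\<^sup>2) = dot I v (e 0)" using c e(3) by (simp add: ip.sym)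
  then have d: "dot I (e j) v = (if j = 0 then sqrt (\<Sum>i\<in>I. (v i)\<^sup>2) else 0)" if "j < card I" for j
    using e(2) that by (auto simp: ip.sym)
  have add: "dot I (e j) (\<lambda>i. z i + v i) = dot I (e j) z + dot I (e j) v" for j z
    by (simp add: dot_def algebra_simps sum.distrib)
  let ?f = "\<lambda>x. f (\<Sum>j<card I. (x j + (if j = 0 then sqrt (\<Sum>i\<in>I. (v i)\<^sup>2) else 0))\<^sup>2)"
  have "(\<integral>\<^sup>+z. f (\<Sum>i\<in>I. (z i + v i)\<^sup>2) \<partial>stdn I) = (\<integral>\<^sup>+z. ?f (\<lambda>j\<in>{..<card I}. dot I (e j) z) \<partial>stdn I)"
    by (intro nn_integral_cong arg_cong[where f = f]) (simp add: sq add d)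
  also have "\<dots> = (\<integral>\<^sup>+z. ?f z \<partial>stdn {..<card I})"
    by (intro nn_integral_stdn_orthonormal I e) auto
  also have "\<dots> = (\<integral>\<^sup>+x. f x \<partial>noncentral_chi_squared (card I) (\<Sum>i\<in>I. (v i)\<^sup>2))"
    unfolding noncentral_chi_squared_altdef by (subst nn_integral_distr) auto
  finally show ?thesis .
qed

lemma nn_integral_stdn_chi_squared:
  assumes I: "finite I" and [measurable]: "f \<in> borel_measurable borel"
  shows "(\<integral>\<^sup>+z. f (\<Sum>i\<in>I. (z i)\<^sup>2) \<partial>stdn I) = (\<integral>\<^sup>+x. f x \<partial>chi_squared (card I))"
  using nn_integral_stdn_noncentral_chi_squared[OF assms, of "\<lambda>_. 0"] by (simp add: chi_squared_def)

section \<open>Gram matrices of Gaussian rows\<close>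

definition gram :: "'j set \<Rightarrow> ('p \<times> 'j \<Rightarrow> real) \<Rightarrow> 'p \<Rightarrow> 'p \<Rightarrow> real" where
  "gram J V a b = (\<Sum>j\<in>J. V (a, j) * V (b, j))"

definition lin_indep_rows :: "'p set \<Rightarrow> 'j set \<Rightarrow> ('p \<times> 'j \<Rightarrow> real) \<Rightarrow> bool" where
  "lin_indep_rows S J V \<longleftrightarrow> (\<forall>t. (\<forall>j\<in>J. (\<Sum>a\<in>S. t a * V (a, j)) = 0) \<longrightarrow> (\<forall>a\<in>S. t a = 0))"

lemma gram_apply: "(\<Sum>b\<in>S. gram J V a b * x b) = (\<Sum>j\<in>J. V (a, j) * (\<Sum>b\<in>S. x b * V (b, j)))"
  unfolding gram_def sum_distrib_right sum_distrib_left
  by (subst sum.swap) (simp add: mult_ac)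

text \<open>This makes linear independence of rows a measurable event.\<close>

lemma lin_indep_rows_iff_det:
  fixes S :: "'p::finite set"
  assumes J: "finite J"
  shows "lin_indep_rows S J V \<longleftrightarrow>
    det (\<chi> a b. if a \<in> S \<and> b \<in> S then gram J V a b else if a = b then 1 else 0 :: real^'p^'p) \<noteq> 0"
    (is "_ \<longleftrightarrow> det ?A \<noteq> 0")
proof -
  \<comment> \<open>The Gram block on \<open>S\<close> is padded by the identity, which acts
    trivially on the other coordinates, so that the kernel of \<open>?A\<close> reflects the rows in
    \<open>S\<close> alone.\<close>
  have Av: "(?A *v x) $ a = (if a \<in> S then (\<Sum>b\<in>S. gram J V a b * x $ b) else x $ a)" for x a
  proof (cases "a \<in> S")
    case True
    have "(?A *v x) $ a = (\<Sum>b\<in>UNIV. if b \<in> S then gram J V a b * x $ b else 0)"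
      unfolding matrix_vector_mult_def using True by (auto intro!: sum.cong)
    then show ?thesis using True by (simp add: sum.If_cases)
  next
    case False
    then show ?thesis unfolding matrix_vector_mult_def
      by (simp add: if_distrib[of "\<lambda>y. y * _"] cong: if_cong)
  qed
  note gs = gram_apply[where S = S and J = J and V = V]
  have "lin_indep_rows S J V \<longleftrightarrow> (\<forall>x. ?A *v x = 0 \<longrightarrow> x = 0)"
  proof (intro iffI allI impI)
    fix x assume l: "lin_indep_rows S J V" and x: "?A *v x = 0"
    then have x': "(?A *v x) $ a = 0" for a by simp
    \<comment> \<open>The quadratic form of a Gram matrix is a sum of squares, so a kernel vector
      makes the combination of the rows vanish in every column.\<close>
    have "(\<Sum>a\<in>S. x $ a * (\<Sum>b\<in>S. gram J V a b * x $ b)) = 0"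
      using x' unfolding Av by (intro sum.neutral) (metis mult_zero_right)
    also have "(\<Sum>a\<in>S. x $ a * (\<Sum>b\<in>S. gram J V a b * x $ b))
      = (\<Sum>j\<in>J. (\<Sum>a\<in>S. x $ a * V (a, j)) * (\<Sum>b\<in>S. x $ b * V (b, j)))"
      unfolding gs sum_distrib_right sum_distrib_left
      by (subst sum.swap) (simp add: mult_ac)
    finally have "(\<Sum>j\<in>J. (\<Sum>a\<in>S. x $ a * V (a, j))\<^sup>2) = 0" by (simp add: power2_eq_square)
    then have "\<forall>j\<in>J. (\<Sum>a\<in>S. x $ a * V (a, j)) = 0"
      using J by (subst (asm) sum_nonneg_eq_0_iff) auto
    then have "\<forall>a\<in>S. x $ a = 0" using l unfolding lin_indep_rows_def by blast
    moreover have "x $ a = 0" if "a \<notin> S" for a using x'[of a] that unfolding Av by simp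
    ultimately show "x = 0" by (auto simp: vec_eq_iff)
  next
    assume inj: "\<forall>x. ?A *v x = 0 \<longrightarrow> x = 0"
    show "lin_indep_rows S J V" unfolding lin_indep_rows_def
    proof (intro allI impI)
      fix t assume t: "\<forall>j\<in>J. (\<Sum>a\<in>S. t a * V (a, j)) = 0"
      define x :: "real^'p" where "x = (\<chi> a. if a \<in> S then t a else 0)"
      have "(\<Sum>b\<in>S. x $ b * V (b, j)) = 0" if "j \<in> J" for j
        using t that by (auto simp: x_def)
      then have "?A *v x = 0"
        unfolding vec_eq_iff Av gs by (auto simp: x_def)
      then have "x = 0" using inj by blast
      have "t a = x $ a" if "a \<in> S" for a using that by (simp add: x_def)
      then show "\<forall>a\<in>S. t a = 0" using \<open>x = 0\<close> by simp
    qed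
  qed
  also have "\<dots> \<longleftrightarrow> det ?A \<noteq> 0"
    by (simp only: matrix_left_invertible_ker[symmetric] invertible_left_inverse[symmetric] invertible_det_nz)
  finally show ?thesis .
qed

lemma measurable_lin_indep_rows [measurable]:
  fixes S :: "'p::finite set"
  assumes J: "finite J"
  shows "Measurable.pred (\<Pi>\<^sub>M i\<in>UNIV \<times> J. borel) (lin_indep_rows S J)"
proof -
  have [measurable]: "(\<lambda>V. gram J V a b) \<in> borel_measurable (\<Pi>\<^sub>M i\<in>UNIV \<times> J. borel)" for a b
    unfolding gram_def
    by (intro borel_measurable_sum borel_measurable_times measurable_component_singleton) auto
  have "(\<lambda>V. det (\<chi> a b. if a \<in> S \<and> b \<in> S then gram J V a b else if a = b then 1 else 0 :: real^'p^'p))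
    \<in> borel_measurable (\<Pi>\<^sub>M i\<in>UNIV \<times> J. borel)"
    unfolding det_def by (intro borel_measurable_sum borel_measurable_times borel_measurable_prod) auto
  then show ?thesis
    unfolding lin_indep_rows_iff_det[OF J] by measurable
qed

lemma lin_indep_rows_solve:
  fixes V :: "'p::finite \<times> 'j \<Rightarrow> real"
  assumes J: "finite J" and l: "lin_indep_rows UNIV J V"
  obtains \<theta> where "\<And>a. (\<Sum>b\<in>UNIV. gram J V a b * \<theta> b) = y a"
proof -
  let ?A = "\<chi> a b. gram J V a b :: real^'p^'p"
  have "det ?A \<noteq> 0" using l unfolding lin_indep_rows_iff_det[OF J] by simp
  then have "\<exists>B. ?A ** B = mat 1"
    using invertible_det_nz invertible_right_inverse by blast
  then obtain x where "?A *v x = (\<chi> a. y a)"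
    unfolding matrix_right_invertible_surjective by (metis surjD)
  then have "(?A *v x) $ a = y a" for a by simp
  then show ?thesis using that[of "\<lambda>b. x $ b"] by (simp add: matrix_vector_mult_def)
qed

section \<open>Exposing the data one row at a time\<close>

definition replace_row :: "'p set \<Rightarrow> 'p \<Rightarrow> 'j set \<Rightarrow> ('p \<times> 'j \<Rightarrow> real) \<Rightarrow> ('j \<Rightarrow> real) \<Rightarrow> 'p \<times> 'j \<Rightarrow> real" where
  "replace_row S a J x r = (\<lambda>(b, j)\<in>S \<times> J. if b = a then r j else x (b, j))"

lemma measurable_replace_row [measurable]:
  fixes a :: 'p and J :: "'j set"
  shows "(\<lambda>(x, r). replace_row S a J x r) \<in> measurable ((\<Pi>\<^sub>M i\<in>(S - {a}) \<times> J. borel) \<Otimes>\<^sub>M (\<Pi>\<^sub>M j\<in>J. borel))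
     (\<Pi>\<^sub>M i\<in>S \<times> J. (borel :: real measure))"
  unfolding replace_row_def case_prod_unfold
proof (rule measurable_restrict)
  fix i :: "'p \<times> 'j" assume i: "i \<in> S \<times> J"
  show "(\<lambda>z. if fst i = a then snd z (snd i) else fst z (fst i, snd i))
    \<in> borel_measurable ((\<Pi>\<^sub>M i\<in>(S - {a}) \<times> J. borel) \<Otimes>\<^sub>M (\<Pi>\<^sub>M j\<in>J. (borel :: real measure)))"
  proof (cases "fst i = a")
    case True
    then show ?thesis using i
      by (simp add: measurable_compose[OF measurable_snd measurable_component_singleton] mem_Times_iff)
  next
    case False
    then show ?thesis using i
      by (simp add: measurable_compose[OF measurable_fst measurable_component_singleton] mem_Times_iff)
  qed
qed

lemma nn_integral_stdn_row:
  fixes f :: "('p \<times> 'j \<Rightarrow> real) \<Rightarrow> ennreal" and a :: 'p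
  assumes J: "finite J" and S: "finite S" "a \<in> S"
    and f [measurable]: "f \<in> borel_measurable (\<Pi>\<^sub>M i\<in>S \<times> J. borel)"
  shows "(\<integral>\<^sup>+V. f V \<partial>stdn (S \<times> J))
    = (\<integral>\<^sup>+x. \<integral>\<^sup>+r. f (replace_row S a J x r) \<partial>stdn J \<partial>stdn ((S - {a}) \<times> J))"
proof -
  have "(\<integral>\<^sup>+V. f V \<partial>stdn (S \<times> J))
    = (\<integral>\<^sup>+V. f (replace_row S a J (\<lambda>i\<in>(S - {a}) \<times> J. V (id i)) (\<lambda>j\<in>J. V (a, j))) \<partial>stdn (S \<times> J))"
  proof (intro nn_integral_cong arg_cong[where f = f])
    fix V :: "'p \<times> 'j \<Rightarrow> real" assume "V \<in> space (stdn (S \<times> J))"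
    then have "V \<in> extensional (S \<times> J)" by (simp add: space_PiM PiE_def)
    then show "V = replace_row S a J (\<lambda>i\<in>(S - {a}) \<times> J. V (id i)) (\<lambda>j\<in>J. V (a, j))"
      by (auto simp: fun_eq_iff replace_row_def extensional_def)
  qed
  also have "\<dots> = (\<integral>\<^sup>+x. \<integral>\<^sup>+r. f (replace_row S a J x r) \<partial>stdn J \<partial>stdn ((S - {a}) \<times> J))"
  proof (rule nn_integral_stdn_split)
    show "(\<lambda>(x, r). f (replace_row S a J x r)) \<in>
      borel_measurable ((\<Pi>\<^sub>M i\<in>(S - {a}) \<times> J. borel) \<Otimes>\<^sub>M (\<Pi>\<^sub>M j\<in>J. borel))"
      using measurable_compose[OF measurable_replace_row[of S a J] f] by (simp add: case_prod_unfold)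
  qed (use J S in \<open>auto simp: inj_on_def\<close>)
  finally show ?thesis .
qed

lemma measurable_nn_integral_replace_row:
  assumes f: "f \<in> borel_measurable (\<Pi>\<^sub>M i\<in>S \<times> J. borel)"
  shows "(\<lambda>x. \<integral>\<^sup>+r. f (replace_row S a J x r) \<partial>stdn J) \<in> borel_measurable (\<Pi>\<^sub>M i\<in>(S - {a}) \<times> J. borel)"
proof -
  interpret sigma_finite_measure "stdn J"
    using prob_space_stdn prob_space_imp_sigma_finite by blast
  have [measurable]: "(\<lambda>(x, r). f (replace_row S a J x r))
    \<in> borel_measurable ((\<Pi>\<^sub>M i\<in>(S - {a}) \<times> J. borel) \<Otimes>\<^sub>M (\<Pi>\<^sub>M j\<in>J. borel))"
    using measurable_compose[OF measurable_replace_row[of S a J] f] by (simp add: case_prod_unfold)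
  show ?thesis by measurable
qed

text \<open>\<open>nn_integral_stdn_row\<close> is applied to the indicator of the failure of
  \<open>P\<close>. The second part supplies the measurability with which the first part can be
  applied again to a further row.\<close>

lemma AE_stdn_row:
  fixes P :: "('p \<times> 'j \<Rightarrow> real) \<Rightarrow> bool" and a :: 'p
  assumes J: "finite J" and S: "finite S" "a \<in> S"
    and P: "Measurable.pred (\<Pi>\<^sub>M i\<in>S \<times> J. borel) P"
  shows "(AE V in stdn (S \<times> J). P V) \<longleftrightarrow>
      (AE x in stdn ((S - {a}) \<times> J). AE r in stdn J. P (replace_row S a J x r))" (is ?A)
    and "Measurable.pred (\<Pi>\<^sub>M i\<in>(S - {a}) \<times> J. borel) (\<lambda>x. AE r in stdn J. P (replace_row S a J x r))" (is ?B)
proof -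
  define bad where "bad = (\<lambda>V. if P V then 0 else 1 :: ennreal)"
  have bad_m: "bad \<in> borel_measurable (\<Pi>\<^sub>M i\<in>S \<times> J. borel)"
    unfolding bad_def using P by measurable
  have *: "(\<integral>\<^sup>+r. bad (replace_row S a J x r) \<partial>stdn J) = 0 \<longleftrightarrow> (AE r in stdn J. P (replace_row S a J x r))"
    if x: "x \<in> space (\<Pi>\<^sub>M i\<in>(S - {a}) \<times> J. borel)" for x
  proof -
    have "(\<lambda>r. replace_row S a J x r) \<in> measurable (\<Pi>\<^sub>M j\<in>J. borel) (\<Pi>\<^sub>M i\<in>S \<times> J. borel)"
      using measurable_compose[OF measurable_Pair1'[OF x] measurable_replace_row[of S a J]] by simp
    then have "(\<lambda>r. bad (replace_row S a J x r)) \<in> borel_measurable (\<Pi>\<^sub>M j\<in>J. borel)"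
      using bad_m by (rule measurable_compose)
    then have "(\<lambda>r. bad (replace_row S a J x r)) \<in> borel_measurable (stdn J)"
      by (simp cong: measurable_cong_sets)
    from nn_integral_0_iff_AE[OF this] show ?thesis by (simp add: bad_def)
  qed
  note m = measurable_nn_integral_replace_row[OF bad_m, of a]
  have m': "(\<lambda>x. \<integral>\<^sup>+r. bad (replace_row S a J x r) \<partial>stdn J) \<in> borel_measurable (stdn ((S - {a}) \<times> J))"
    using m by (simp cong: measurable_cong_sets)
  have "bad \<in> borel_measurable (stdn (S \<times> J))" using bad_m by (simp cong: measurable_cong_sets)
  from nn_integral_0_iff_AE[OF this] have "(AE V in stdn (S \<times> J). P V) \<longleftrightarrow> (\<integral>\<^sup>+V. bad V \<partial>stdn (S \<times> J)) = 0"
    by (simp add: bad_def)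
  also have "\<dots> \<longleftrightarrow> (AE x in stdn ((S - {a}) \<times> J). (\<integral>\<^sup>+r. bad (replace_row S a J x r) \<partial>stdn J) = 0)"
    unfolding nn_integral_stdn_row[OF J S bad_m] nn_integral_0_iff_AE[OF m'] ..
  also have "\<dots> \<longleftrightarrow> (AE x in stdn ((S - {a}) \<times> J). AE r in stdn J. P (replace_row S a J x r))"
    by (intro AE_cong) (simp add: *)
  finally show ?A .
  have "Measurable.pred (\<Pi>\<^sub>M i\<in>(S - {a}) \<times> J. borel) (\<lambda>x. (\<integral>\<^sup>+r. bad (replace_row S a J x r) \<partial>stdn J) = 0)"
    using m by measurable
  then show ?B by (subst (asm) measurable_cong[OF *]) auto
qed

text \<open>While there are fewer than \<open>card J\<close> rows, some unit vector \<open>u\<close>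
  is orthogonal to all of them. A new Gaussian row almost surely has a nonzero product with
  \<open>u\<close>, and pairing a linear relation with \<open>u\<close> isolates the coefficient of
  the new row.\<close>

lemma AE_lin_indep_rows:
  fixes S :: "'p::finite set" and J :: "'j set"
  assumes J: "finite J" and S: "card S \<le> card J"
  shows "AE V in stdn (UNIV \<times> J). lin_indep_rows S J V"
proof -
  have "finite S" by simp
  then show ?thesis using S
  proof (induction S rule: finite_induct)
    case empty
    show ?case by (simp add: lin_indep_rows_def)
  next
    case (insert a S)
    have fi: "finite_ip J (dot J)" by (rule finite_ip_dot[OF J])
    note row = AE_stdn_row(1)[OF J finite UNIV_I measurable_lin_indep_rows[OF J], where a = a]
    let ?V = "\<lambda>x r. replace_row UNIV a J x r"
    have aS: "?V x r (b, j) = x (b, j)" if "b \<in> S" "j \<in> J" for b j x r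
      using insert.hyps that by (auto simp: replace_row_def)
    have indS: "lin_indep_rows S J (?V x r) \<longleftrightarrow> lin_indep_rows S J x" for x r
      unfolding lin_indep_rows_def by (auto simp: aS)
    have "AE V in stdn (UNIV \<times> J). lin_indep_rows S J V" using insert by simp
    then have "AE x in stdn ((UNIV - {a}) \<times> J). lin_indep_rows S J x"
      unfolding row indS prob_space.AE_const[OF prob_space_stdn] .
    then have "AE x in stdn ((UNIV - {a}) \<times> J). AE r in stdn J. lin_indep_rows (insert a S) J (?V x r)"
    proof eventually_elim
      case (elim x)
      obtain u where u: "dot J u u = 1" "\<And>b. b \<in> S \<Longrightarrow> dot J (\<lambda>j. x (b, j)) u = 0"
        using finite_ip.unit_orthogonal[OF fi, of S "\<lambda>b j. x (b, j)"] insert by auto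
      show ?case
        using AE_stdn_dot_nonzero[OF J u(1)]
      proof eventually_elim
        case (elim r)
        show ?case unfolding lin_indep_rows_def
        proof (intro allI impI)
          fix t assume t: "\<forall>j\<in>J. (\<Sum>b\<in>insert a S. t b * ?V x r (b, j)) = 0"
          have t': "t a * r j + (\<Sum>b\<in>S. t b * x (b, j)) = 0" if "j \<in> J" for j
          proof -
            have "(\<Sum>b\<in>S. t b * ?V x r (b, j)) = (\<Sum>b\<in>S. t b * x (b, j))"
              using that by (intro sum.cong) (auto simp: aS)
            then show ?thesis using t that insert by (auto simp: replace_row_def)
          qed
          have "0 = (\<Sum>j\<in>J. u j * (t a * r j + (\<Sum>b\<in>S. t b * x (b, j))))"
            using t' by simp
          also have "\<dots> = t a * dot J u r + (\<Sum>b\<in>S. t b * dot J (\<lambda>j. x (b, j)) u)"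
            unfolding dot_def sum_distrib_left distrib_left sum.distrib
            by (subst (2) sum.swap) (simp add: mult_ac)
          also have "\<dots> = t a * dot J u r" using u by simp
          finally have "t a = 0" using elim by simp
          moreover from this t' \<open>lin_indep_rows S J x\<close> have "\<forall>b\<in>S. t b = 0"
            unfolding lin_indep_rows_def by auto
          ultimately show "\<forall>b\<in>insert a S. t b = 0" by auto
        qed
      qed
    qed
    then show ?case unfolding row .
  qed
qed

text \<open>With the rows ordered as the \<open>p - 2\<close> unnamed ones, then \<open>a1\<close>,
  then \<open>a0\<close>, the array of coordinates in the basis \<open>e\<close> is block lower
  triangular: only \<open>a0\<close> reaches the positions from \<open>p - 1\<close> on, and only
  \<open>a0\<close> and \<open>a1\<close> reach position \<open>p - 2\<close>. The combination
  \<open>t\<close> of the rows with coefficients \<open>\<theta>\<close> has zero coordinates below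
  \<open>p - 1\<close>. Pairing it with row \<open>a0\<close> gives
  \<open>\<theta> a0 * \<xi> = 1\<close>, and its coordinate at \<open>p - 2\<close> gives the
  equation for \<open>\<theta> a1\<close>.\<close>

lemma gram_solution:
  fixes V :: "'p::finite \<times> 'j \<Rightarrow> real"
  assumes J: "finite J" "card J = m" and p: "2 \<le> CARD('p)" "CARD('p) \<le> m" and ne: "a0 \<noteq> a1"
    and o: "finite_ip.orthonormal (dot J) e {..<m}" and l: "lin_indep_rows UNIV J V"
    and rows: "\<And>b j. b \<noteq> a0 \<Longrightarrow> b \<noteq> a1 \<Longrightarrow> CARD('p) - 2 \<le> j \<Longrightarrow> j < m \<Longrightarrow> dot J (\<lambda>j. V (b, j)) (e j) = 0"
    and row1: "\<And>j. CARD('p) - 1 \<le> j \<Longrightarrow> j < m \<Longrightarrow> dot J (\<lambda>j. V (a1, j)) (e j) = 0"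
    and sol: "\<And>a. (\<Sum>b\<in>UNIV. gram J V a b * \<theta> b) = (if a = a0 then 1 else 0)"
  defines "\<xi> \<equiv> (\<Sum>j\<in>{CARD('p) - 1..<m}. (dot J (\<lambda>j. V (a0, j)) (e j))\<^sup>2)"
    and "c \<equiv> dot J (\<lambda>j. V (a0, j)) (e (CARD('p) - 2))"
    and "\<rho> \<equiv> dot J (\<lambda>j. V (a1, j)) (e (CARD('p) - 2))"
  shows "\<theta> a0 = 1 / \<xi>" and "\<theta> a1 = - (c / \<rho>) / \<xi>"
proof -
  interpret ip: finite_ip J "dot J" by (rule finite_ip_dot[OF J(1)])
  define p where "p = CARD('p)"
  define R where "R = (\<lambda>b j. dot J (\<lambda>j. V (b, j)) (e j))"
  have m: "finite {..<m}" "card {..<m} = card J" using J by auto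
  \<comment> \<open>Independence of the rows as a counting principle: fewer than
    \<open>card S\<close> linear conditions on the coefficients cannot force every coordinate of the
    combination of the rows in \<open>S\<close> to vanish.\<close>
  have dep: False if cK: "card K < card S" and fK: "finite K" and e0: "\<And>s j. (\<And>k. k \<in> K \<Longrightarrow> (\<Sum>b\<in>S. f k b * s b) = 0) \<Longrightarrow>
     j < m \<Longrightarrow> (\<Sum>b\<in>S. s b * R b j) = 0" for K :: "nat set" and S f
  proof -
    obtain s where s: "\<exists>b\<in>S. s b \<noteq> 0" "\<And>k. k \<in> K \<Longrightarrow> (\<Sum>b\<in>S. f k b * s b) = 0"
      using homogeneous_system_nontrivial[OF fK _ cK, of f] by auto
    define x where "x = (\<lambda>j. \<Sum>b\<in>S. s b * V (b, j))"
    have xe: "dot J x (e j) = 0" if "j < m" for j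
      using e0[OF s(2) that] unfolding x_def R_def ip.sum by simp
    have x0: "x i = 0" if "i \<in> J" for i
      using ip.expand[OF m o that, of x] xe by simp
    define t where "t = (\<lambda>b. if b \<in> S then s b else 0)"
    have "(\<Sum>b\<in>UNIV. t b * V (b, j)) = x j" for j
    proof -
      have "(\<Sum>b\<in>UNIV. t b * V (b, j)) = (\<Sum>b\<in>S. t b * V (b, j))"
        by (rule sum.mono_neutral_right) (auto simp: t_def)
      then show ?thesis by (simp add: x_def t_def)
    qed
    then have t0: "\<forall>a\<in>UNIV. t a = 0" using l x0 unfolding lin_indep_rows_def by simp
    have "s b = 0" if "b \<in> S" for b
    proof -
      have "t b = 0" using t0 by blast
      then show ?thesis using that by (simp add: t_def)
    qed
    then show False using s(1) by blast
  qed
  have cardS: "card (UNIV - {a0}) = p - 1" by (simp add: p_def)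
  have R0: "R b j = 0" if "b \<noteq> a0" "p - 1 \<le> j" "j < m" for b j
    using rows[of b j] row1[of j] that by (cases "b = a1") (auto simp: R_def p_def)
  have R00: "R b j = 0" if "b \<noteq> a0" "b \<noteq> a1" "p - 2 \<le> j" "j < m" for b j
    using rows that by (auto simp: R_def p_def)
  \<comment> \<open>With \<open>\<rho> = 0\<close> the \<open>p - 1\<close> rows other than
    \<open>a0\<close> would have coordinates only at the first \<open>p - 2\<close>
    positions.\<close>
  have rho: "\<rho> \<noteq> 0"
  proof
    assume z: "\<rho> = 0"
    show False
    proof (rule dep[of "{..<p - 2}" "UNIV - {a0}" "\<lambda>k b. R b k"])
      fix s j assume s: "\<And>k. k \<in> {..<p - 2} \<Longrightarrow> (\<Sum>b\<in>UNIV - {a0}. R b k * s b) = 0" and j: "j < m"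
      show "(\<Sum>b\<in>UNIV - {a0}. s b * R b j) = 0"
      proof (cases "j < p - 2")
        case True then show ?thesis using s[of j] by (simp add: mult.commute)
      next
        case False
        have "R b j = 0" if "b \<noteq> a0" for b
        proof (cases "b = a1 \<and> j = p - 2")
          case True then show ?thesis using z by (simp add: R_def \<rho>_def p_def)
        next
          case F: False
          then show ?thesis using R0[OF that, of j] R00[OF that, of j] False j by (cases "b = a1") auto
        qed
        then show ?thesis by simp
      qed
    qed (use p in \<open>auto simp: cardS p_def\<close>)
  qed
  \<comment> \<open>\<open>t\<close> is orthogonal to all rows but \<open>a0\<close>, and these span the first \<open>p - 1\<close> vectors of \<open>e\<close>.\<close>
  define t where "t = (\<lambda>j. \<Sum>b\<in>UNIV. \<theta> b * V (b, j))"
  have tr: "dot J t (\<lambda>j. V (a, j)) = (if a = a0 then 1 else 0)" for a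
    unfolding t_def ip.sum sol[of a, symmetric]
    by (intro sum.cong) (auto simp: gram_def dot_def mult.commute)
  have te: "dot J t (e j) = (\<Sum>b\<in>UNIV. \<theta> b * R b j)" for j
    unfolding t_def ip.sum R_def ..
  have t_low: "dot J t (e l) = 0" if "l < p - 1" for l
  proof (rule ccontr)
    assume nz: "dot J t (e l) \<noteq> 0"
    show False
    \<comment> \<open>The \<open>p - 2\<close> conditions make a combination \<open>x\<close> of the
      rows other than \<open>a0\<close> vanish at all positions except \<open>l\<close>; being
      orthogonal to \<open>t\<close>, it then vanishes at \<open>l\<close> as well.\<close>
    proof (rule dep[of "{..<p - 1} - {l}" "UNIV - {a0}" "\<lambda>k b. R b k"])
      fix s j assume s: "\<And>k. k \<in> {..<p - 1} - {l} \<Longrightarrow> (\<Sum>b\<in>UNIV - {a0}. R b k * s b) = 0" and j: "j < m"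
      define x where "x = (\<lambda>j. \<Sum>b\<in>UNIV - {a0}. s b * V (b, j))"
      have xe: "dot J x (e k) = (\<Sum>b\<in>UNIV - {a0}. s b * R b k)" for k
        unfolding x_def ip.sum R_def ..
      have x0: "dot J x (e k) = 0" if "k < m" "k \<noteq> l" for k
      proof (cases "k < p - 1")
        case True then show ?thesis using s[of k] that by (simp add: xe mult.commute)
      next
        case False then show ?thesis unfolding xe using that by (intro sum.neutral) (auto simp: R0)
      qed
      have lm: "l < m" using that p by (simp add: p_def)
      have "0 = dot J x t"
        unfolding x_def ip.sum using tr by (intro sum.neutral[symmetric]) (auto simp: ip.sym)
      also have "\<dots> = (\<Sum>k<m. dot J x (e k) * dot J t (e k))" by (rule ip.parseval[OF m o])
      also have "\<dots> = (\<Sum>k<m. if k = l then dot J x (e k) * dot J t (e k) else 0)"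
        by (intro sum.cong) (auto simp: x0)
      also have "\<dots> = dot J x (e l) * dot J t (e l)" using lm by simp
      finally have "dot J x (e l) = 0" using nz by simp
      then show "(\<Sum>b\<in>UNIV - {a0}. s b * R b j) = 0" using x0[OF j] xe[of j] by (cases "j = l") auto
    qed (use that p in \<open>auto simp: cardS p_def card_Diff_subset\<close>)
  qed
  have t_high: "dot J t (e j) = \<theta> a0 * R a0 j" if "p - 1 \<le> j" "j < m" for j
  proof -
    have "(\<Sum>b\<in>UNIV. \<theta> b * R b j) = (\<Sum>b\<in>UNIV. if b = a0 then \<theta> b * R b j else 0)"
      using R0 that by (intro sum.cong) auto
    then show ?thesis by (simp add: te)
  qed
  have "1 = dot J t (\<lambda>j. V (a0, j))" using tr[of a0] by simp
  also have "\<dots> = (\<Sum>j<m. dot J t (e j) * R a0 j)"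
    unfolding R_def by (rule ip.parseval[OF m o])
  also have "\<dots> = (\<Sum>j\<in>{p - 1..<m}. dot J t (e j) * R a0 j)"
    using t_low by (intro sum.mono_neutral_right) (auto simp: not_le)
  also have "\<dots> = \<theta> a0 * \<xi>"
    unfolding \<xi>_def sum_distrib_left by (intro sum.cong) (auto simp: t_high p_def R_def power2_eq_square)
  finally have 1: "\<theta> a0 * \<xi> = 1" by simp
  then show th0: "\<theta> a0 = 1 / \<xi>" by (metis eq_divide_eq mult_zero_right zero_neq_one)
  have "0 = (\<Sum>b\<in>UNIV. \<theta> b * R b (p - 2))"
    using t_low[of "p - 2"] p by (simp add: te p_def)
  also have "\<dots> = (\<Sum>b\<in>{a0, a1}. \<theta> b * R b (p - 2))"
    using R00[of _ "p - 2"] p by (intro sum.mono_neutral_right) (auto simp: p_def)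
  also have "\<dots> = \<theta> a0 * c + \<theta> a1 * \<rho>" using ne by (simp add: R_def c_def \<rho>_def p_def)
  finally have "\<theta> a1 * \<rho> = - (c / \<xi>)" by (simp add: th0)
  then have "\<theta> a1 = - (c / \<xi>) / \<rho>" by (simp only: nonzero_eq_divide_eq[OF rho])
  then show "\<theta> a1 = - (c / \<rho>) / \<xi>" by (simp add: mult.commute)
qed

context finite_ip
begin

text \<open>This is \<open>qr\<close> for two vectors with the positions 0 and 1 named
  \<open>k0\<close> and \<open>k1\<close>, so that an index of the feature space can label a
  distinguished direction.\<close>

lemma qr_two:
  assumes K: "finite K" "card K = card I" "k0 \<in> K" "k1 \<in> K" "k0 \<noteq> k1"
  obtains e where "orthonormal e K" "\<And>k. k \<in> K \<Longrightarrow> k \<noteq> k0 \<Longrightarrow> B v0 (e k) = 0" "B v0 (e k0) \<ge> 0"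
    "\<And>k. k \<in> K \<Longrightarrow> k \<noteq> k0 \<Longrightarrow> k \<noteq> k1 \<Longrightarrow> B v1 (e k) = 0" "B v1 (e k1) \<ge> 0"
proof -
  define N where "N = card I"
  have N: "2 \<le> N" using card_mono[of K "{k0, k1}"] K by (simp add: N_def)
  have "card (K - {k0, k1}) = card {2..<N}" using K by (simp add: N_def card_Diff_subset)
  then obtain h where h: "bij_betw h (K - {k0, k1}) {2..<N}"
    using finite_same_card_bij[of "K - {k0, k1}" "{2..<N}"] K by auto
  define g where "g = (\<lambda>k. if k = k0 then 0 else if k = k1 then 1 else h k)"
  have h2: "2 \<le> h k \<and> h k < N" if "k \<in> K" "k \<noteq> k0" "k \<noteq> k1" for k
    using bij_betwE[OF h] that by auto
  have gN: "g k < N" if "k \<in> K" for k using h2[OF that] N by (auto simp: g_def)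
  have inj: "inj_on g K"
  proof (rule inj_onI)
    fix k l assume kl: "k \<in> K" "l \<in> K" "g k = g l"
    have "h k = h l \<Longrightarrow> k \<notin> {k0, k1} \<Longrightarrow> l \<notin> {k0, k1} \<Longrightarrow> k = l"
      using kl inj_onD[OF bij_betw_imp_inj_on[OF h], of k l] by simp
    then show "k = l"
      using kl(3) K(5) h2[OF kl(1)] h2[OF kl(2)] unfolding g_def
      by (cases "k = k0"; cases "k = k1"; cases "l = k0"; cases "l = k1") simp_all
  qed
  obtain e where e: "orthonormal e {..<N}"
    "\<And>i j. i < j \<Longrightarrow> j < N \<Longrightarrow> B ((\<lambda>n. if n = 0 then v0 else v1) i) (e j) = 0"
    "\<And>j. j < N \<Longrightarrow> B ((\<lambda>n. if n = 0 then v0 else v1) j) (e j) \<ge> 0"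
    unfolding N_def by (rule qr[of "\<lambda>n. if n = 0 then v0 else v1"]) blast
  show ?thesis
  proof (rule that[of "\<lambda>k. e (g k)"])
    show "orthonormal (\<lambda>k. e (g k)) K"
      unfolding orthonormal_def
    proof (intro ballI)
      fix j k assume "j \<in> K" "k \<in> K"
      then show "B (e (g j)) (e (g k)) = (if j = k then 1 else 0)"
        using e(1) gN inj by (auto simp: orthonormal_def inj_on_def)
    qed
    show "B v0 (e (g k)) = 0" if "k \<in> K" "k \<noteq> k0" for k
      using e(2)[of 0 "g k"] gN[OF that(1)] h2[OF that] that by (force simp: g_def)
    show "B v1 (e (g k)) = 0" if "k \<in> K" "k \<noteq> k0" "k \<noteq> k1" for k
      using e(2)[of 1 "g k"] gN[OF that(1)] h2[OF that] that by (force simp: g_def)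
    show "B v0 (e (g k0)) \<ge> 0" "B v1 (e (g k1)) \<ge> 0"
      using e(3)[of 0] e(3)[of 1] N K(5) by (auto simp: g_def)
  qed
qed

end

section \<open>The inverse scatter matrix in Gram-Schmidt coordinates\<close>

lemma sigma_finite_chi_squared: "sigma_finite_measure (chi_squared k)"
  using prob_space_chi_squared prob_space_imp_sigma_finite by blast

lemma sigma_finite_std_normal: "sigma_finite_measure std_normal_measure"
  using prob_space_std_normal prob_space_imp_sigma_finite by blast

text \<open>For fixed remaining rows, \<open>\<kappa>\<close> is the squared length of row
  \<open>a1\<close> off their span, \<open>c\<close> the coordinate of row \<open>a0\<close> along
  the residual of row \<open>a1\<close>, and \<open>\<xi>\<close> the squared length of row
  \<open>a0\<close> off all other rows. The basis may be adapted to the rows held fixed, as the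
  coordinates of the next row are standard normal in every orthonormal basis; hence the result does
  not depend on the fixed rows, and the three variables are independent.\<close>

lemma wishart_canonical:
  fixes F :: "('p::finite \<times> 'j \<Rightarrow> real) \<Rightarrow> ennreal" and G :: "real \<Rightarrow> real \<Rightarrow> ennreal"
  assumes J: "finite J" and p: "2 \<le> CARD('p)" "CARD('p) \<le> card J" and ne: "a0 \<noteq> a1"
    and F [measurable]: "F \<in> borel_measurable (\<Pi>\<^sub>M i\<in>UNIV \<times> J. borel)"
    and G [measurable]: "(\<lambda>(s, t). G s t) \<in> borel_measurable (borel \<Otimes>\<^sub>M borel)"
    and spec: "\<And>V \<theta>. lin_indep_rows UNIV J V \<Longrightarrow>
      (\<And>a. (\<Sum>b\<in>UNIV. gram J V a b * \<theta> b) = (if a = a0 then 1 else 0)) \<Longrightarrow> F V = G (\<theta> a0) (\<theta> a1)"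
  shows "(\<integral>\<^sup>+V. F V \<partial>stdn (UNIV \<times> J)) =
    (\<integral>\<^sup>+\<kappa>. \<integral>\<^sup>+c. \<integral>\<^sup>+\<xi>. G (1 / \<xi>) (- (c / sqrt \<kappa>) / \<xi>)
      \<partial>chi_squared (card J - (CARD('p) - 1)) \<partial>std_normal_measure \<partial>chi_squared (card J - (CARD('p) - 2)))"
proof -
  interpret ip: finite_ip J "dot J" by (rule finite_ip_dot[OF J])
  define p m where "p = CARD('p)" and "m = card J"
  have pm: "2 \<le> p" "p \<le> m" using p by (auto simp: p_def m_def)
  have m: "finite {..<m}" "card {..<m} = card J" by (auto simp: m_def)
  interpret chi: sigma_finite_measure "chi_squared (m - (p - 1))" by (rule sigma_finite_chi_squared)
  define \<Psi> where "\<Psi> = (\<lambda>\<kappa>. \<integral>\<^sup>+c. \<integral>\<^sup>+\<xi>. G (1 / \<xi>) (- (c / sqrt \<kappa>) / \<xi>)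
      \<partial>chi_squared (m - (p - 1)) \<partial>std_normal_measure)"
  have [measurable]: "\<Psi> \<in> borel_measurable borel" unfolding \<Psi>_def by measurable
  let ?U = "UNIV - {a0} :: 'p set" and ?R = "UNIV - {a0} - {a1} :: 'p set"
  define V where "V = (\<lambda>y r1 r0. replace_row UNIV a0 J (replace_row ?U a1 J y r1) r0)"
  have dV: "dot J (\<lambda>j. V y r1 r0 (b, j)) u
    = (if b = a0 then dot J r0 u else if b = a1 then dot J r1 u else dot J (\<lambda>j. y (b, j)) u)" for y r1 r0 b u
    by (auto simp: dot_def V_def replace_row_def)
  have "AE y in stdn (?R \<times> J). AE r1 in stdn J. AE r0 in stdn J. lin_indep_rows UNIV J (V y r1 r0)"
  proof -
    note row1 = AE_stdn_row[OF J finite UNIV_I measurable_lin_indep_rows[OF J, of UNIV], where a = a0]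
    have a1: "a1 \<in> ?U" using ne by simp
    note row2 = AE_stdn_row(1)[OF J _ a1 row1(2)]
    have "AE V in stdn (UNIV \<times> J). lin_indep_rows (UNIV :: 'p set) J V"
      using p(2) by (rule AE_lin_indep_rows[OF J])
    then show ?thesis unfolding row1(1) unfolding V_def by (subst (asm) row2) auto
  qed
  moreover have "(\<integral>\<^sup>+r1. \<integral>\<^sup>+r0. F (V y r1 r0) \<partial>stdn J \<partial>stdn J) = (\<integral>\<^sup>+\<kappa>. \<Psi> \<kappa> \<partial>chi_squared (m - (p - 2)))"
    if y: "AE r1 in stdn J. AE r0 in stdn J. lin_indep_rows UNIV J (V y r1 r0)" for y
  proof -
    have "card {..<p - 2} = card ?R" using ne by (simp add: p_def card_Diff_subset)
    then obtain h where h: "bij_betw h {..<p - 2} ?R"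
      using finite_same_card_bij[of "{..<p - 2}" ?R] by auto
    obtain e' where o': "ip.orthonormal e' {..<m}"
      and e': "\<And>i j. i < j \<Longrightarrow> j < m \<Longrightarrow> dot J (\<lambda>k. y (h i, k)) (e' j) = 0"
      unfolding m_def by (rule ip.qr[of "\<lambda>i k. y (h i, k)"]) blast
    have rows': "dot J (\<lambda>k. y (b, k)) (e' j) = 0" if "b \<in> ?R" "p - 2 \<le> j" "j < m" for b j
    proof -
      obtain i where "i < p - 2" "b = h i" using h \<open>b \<in> ?R\<close> unfolding bij_betw_def by blast
      then show ?thesis using e'[of i j] that by simp
    qed
    \<comment> \<open>The length is measured in \<open>e'\<close>, which does not depend on
      \<open>r1\<close>, so that its law is chi-squared. The basis \<open>e\<close> below, which is
      adapted to \<open>r1\<close>, yields the same value because both bases share the first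
      \<open>p - 2\<close> vectors.\<close>
    define \<kappa> where "\<kappa> = (\<lambda>r. \<Sum>j\<in>{p - 2..<m}. (dot J (e' j) r)\<^sup>2)"
    have norm2: "dot J v v = (\<Sum>j<m. (dot J v (e j))\<^sup>2)" if "ip.orthonormal e {..<m}" for v e
      by (subst ip.parseval[OF m that]) (simp add: power2_eq_square)
    have split: "(\<Sum>j<m. g j) = (\<Sum>j<p - 2. g j) + (\<Sum>j\<in>{p - 2..<m}. g j)" for g :: "nat \<Rightarrow> real"
      using sum.atLeastLessThan_concat[of 0 "p - 2" m g] pm by (simp add: atLeast0LessThan)
    have "AE r1 in stdn J. (\<integral>\<^sup>+r0. F (V y r1 r0) \<partial>stdn J) = \<Psi> (\<kappa> r1)"
      using y
    proof eventually_elim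
      case (elim r1)
      obtain e where o: "ip.orthonormal e {..<m}"
        and e_eq: "\<And>i j. j < p - 2 \<Longrightarrow> i \<in> J \<Longrightarrow> e j i = e' j i"
        and e_r1: "\<And>j. p - 2 < j \<Longrightarrow> j < m \<Longrightarrow> dot J r1 (e j) = 0"
        and e_pos: "dot J r1 (e (p - 2)) \<ge> 0"
        unfolding m_def
        by (rule ip.qr_extend[of "p - 2" e' r1])
          (use pm o' in \<open>auto simp: m_def ip.orthonormal_def\<close>)
      have de: "dot J v (e j) = dot J v (e' j)" if "j < p - 2" for v j
        using that by (intro ip.cong_right e_eq)
      have "(\<Sum>j<m. (dot J r1 (e j))\<^sup>2) = (\<Sum>j<m. (dot J r1 (e' j))\<^sup>2)"
        using norm2[OF o] norm2[OF o'] by metis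
      then have "(\<Sum>j\<in>{p - 2..<m}. (dot J r1 (e j))\<^sup>2) = (\<Sum>j\<in>{p - 2..<m}. (dot J r1 (e' j))\<^sup>2)"
        by (simp add: split de)
      also have "\<dots> = \<kappa> r1" by (simp add: \<kappa>_def ip.sym)
      also have "(\<Sum>j\<in>{p - 2..<m}. (dot J r1 (e j))\<^sup>2) = (\<Sum>j\<in>{p - 2..<m}. if j = p - 2 then (dot J r1 (e j))\<^sup>2 else 0)"
        by (intro sum.cong) (auto simp: e_r1)
      also have "\<dots> = (dot J r1 (e (p - 2)))\<^sup>2" using pm by simp
      finally have "(dot J r1 (e (p - 2)))\<^sup>2 = \<kappa> r1" .
      then have rho: "dot J r1 (e (p - 2)) = sqrt (\<kappa> r1)"
        using e_pos real_sqrt_unique by metis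
      \<comment> \<open>The vectors \<open>e j\<close> from position \<open>p - 2\<close> on are
        orthogonal to the first \<open>p - 2\<close> vectors of \<open>e'\<close>, and these carry
        all the rows in \<open>?R\<close>.\<close>
      have rows: "dot J (\<lambda>k. y (b, k)) (e j) = 0" if b: "b \<in> ?R" and j: "p - 2 \<le> j" "j < m" for b j
      proof -
        have "dot J (\<lambda>k. y (b, k)) (e j) = (\<Sum>l<m. dot J (\<lambda>k. y (b, k)) (e' l) * dot J (e j) (e' l))"
          by (rule ip.parseval[OF m o'])
        also have "\<dots> = 0"
        proof (intro sum.neutral ballI)
          fix l assume l: "l \<in> {..<m}"
          show "dot J (\<lambda>k. y (b, k)) (e' l) * dot J (e j) (e' l) = 0"
          proof (cases "l < p - 2")
            case True
            then have "dot J (e j) (e' l) = 0"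
              unfolding de[OF True, symmetric] using o j l by (auto simp: ip.orthonormal_def)
            then show ?thesis by simp
          next
            case False then show ?thesis using rows'[OF b, of l] l by auto
          qed
        qed
        finally show ?thesis .
      qed
      define Q where "Q = (\<lambda>z. G (1 / (\<Sum>j\<in>{p - 1..<m}. (z j)\<^sup>2))
        (- (z (p - 2) / sqrt (\<kappa> r1)) / (\<Sum>j\<in>{p - 1..<m}. (z j)\<^sup>2)))"
      have Qm: "Q \<in> borel_measurable (\<Pi>\<^sub>M j\<in>{..<m}. borel)"
      proof -
        have [measurable]: "(\<lambda>z. z (p - 2)) \<in> borel_measurable (\<Pi>\<^sub>M j\<in>{..<m}. (borel :: real measure))"
          using pm by (intro measurable_component_singleton) auto
        have [measurable]: "(\<lambda>z. \<Sum>j\<in>{p - 1..<m}. (z j)\<^sup>2) \<in> borel_measurable (\<Pi>\<^sub>M j\<in>{..<m}. (borel :: real measure))"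
          by (intro borel_measurable_sum borel_measurable_power measurable_component_singleton) auto
        show ?thesis unfolding Q_def by measurable
      qed
      have "(\<integral>\<^sup>+r0. F (V y r1 r0) \<partial>stdn J) = (\<integral>\<^sup>+r0. Q (\<lambda>j\<in>{..<m}. dot J (e j) r0) \<partial>stdn J)"
      proof (rule nn_integral_cong_AE)
        show "AE r0 in stdn J. F (V y r1 r0) = Q (\<lambda>j\<in>{..<m}. dot J (e j) r0)"
          using elim
        proof eventually_elim
          case (elim r0)
          obtain \<theta> where sol: "\<And>a. (\<Sum>b\<in>UNIV. gram J (V y r1 r0) a b * \<theta> b) = (if a = a0 then 1 else 0)"
            using lin_indep_rows_solve[OF J elim, of "\<lambda>a. if a = a0 then 1 else 0"] by blast
          have th: "\<theta> a0 = 1 / (\<Sum>j\<in>{p - 1..<m}. (dot J (\<lambda>j. V y r1 r0 (a0, j)) (e j))\<^sup>2)"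
            "\<theta> a1 = - (dot J (\<lambda>j. V y r1 r0 (a0, j)) (e (p - 2)) / dot J (\<lambda>j. V y r1 r0 (a1, j)) (e (p - 2)))
              / (\<Sum>j\<in>{p - 1..<m}. (dot J (\<lambda>j. V y r1 r0 (a0, j)) (e j))\<^sup>2)"
            unfolding p_def
            by (rule gram_solution[OF J m_def[symmetric] p(1) p(2)[folded m_def] ne o elim _ _ sol];
                use rows e_r1 ne pm in \<open>simp add: dV p_def\<close>)+
          have F: "F (V y r1 r0) = G (\<theta> a0) (\<theta> a1)" by (rule spec[OF elim sol])
          have "p - 2 < m" using pm by simp
          then show ?case unfolding F th Q_def using ne by (simp add: dV rho ip.sym[of r0])
        qed
      qed
      also have "\<dots> = (\<integral>\<^sup>+z. Q z \<partial>stdn {..<m})"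
        by (rule nn_integral_stdn_orthonormal[OF J m o Qm])
      also have "\<dots> = (\<integral>\<^sup>+z. (\<lambda>x w. G (1 / (\<Sum>j\<in>{p - 1..<m}. (w j)\<^sup>2))
        (- (x (p - 2) / sqrt (\<kappa> r1)) / (\<Sum>j\<in>{p - 1..<m}. (w j)\<^sup>2)))
          (\<lambda>j\<in>{p - 2}. z j) (\<lambda>j\<in>{p - 1..<m}. z j) \<partial>stdn {..<m})"
        by (simp add: Q_def)
      also have "\<dots> = (\<integral>\<^sup>+x. \<integral>\<^sup>+w. G (1 / (\<Sum>j\<in>{p - 1..<m}. (w j)\<^sup>2))
        (- (x (p - 2) / sqrt (\<kappa> r1)) / (\<Sum>j\<in>{p - 1..<m}. (w j)\<^sup>2)) \<partial>stdn {p - 1..<m} \<partial>stdn {p - 2})"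
        using pm by (intro nn_integral_stdn_split) auto
      also have "\<dots> = (\<integral>\<^sup>+x. \<integral>\<^sup>+\<xi>. G (1 / \<xi>) (- (x (p - 2) / sqrt (\<kappa> r1)) / \<xi>) \<partial>chi_squared (m - (p - 1)) \<partial>stdn {p - 2})"
        by (intro nn_integral_cong, subst nn_integral_stdn_chi_squared) auto
      also have "\<dots> = \<Psi> (\<kappa> r1)"
        unfolding \<Psi>_def
        by (rule nn_integral_stdn_component[where f = "\<lambda>c. \<integral>\<^sup>+\<xi>. G (1 / \<xi>) (- (c / sqrt (\<kappa> r1)) / \<xi>) \<partial>chi_squared (m - (p - 1))"]) (simp, measurable)
      finally show ?case .
    qed
    then have "(\<integral>\<^sup>+r1. \<integral>\<^sup>+r0. F (V y r1 r0) \<partial>stdn J \<partial>stdn J) = (\<integral>\<^sup>+r1. \<Psi> (\<kappa> r1) \<partial>stdn J)"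
      by (rule nn_integral_cong_AE)
    also have "\<dots> = (\<integral>\<^sup>+r1. (\<lambda>z. \<Psi> (\<Sum>j\<in>{p - 2..<m}. (z j)\<^sup>2)) (\<lambda>j\<in>{..<m}. dot J (e' j) r1) \<partial>stdn J)"
      by (simp add: \<kappa>_def)
    also have "\<dots> = (\<integral>\<^sup>+z. \<Psi> (\<Sum>j\<in>{p - 2..<m}. (z j)\<^sup>2) \<partial>stdn {..<m})"
    proof (rule nn_integral_stdn_orthonormal[OF J m o'])
      have [measurable]: "(\<lambda>z. \<Sum>j\<in>{p - 2..<m}. (z j)\<^sup>2) \<in> borel_measurable (\<Pi>\<^sub>M j\<in>{..<m}. (borel :: real measure))"
        by (intro borel_measurable_sum borel_measurable_power measurable_component_singleton) auto
      show "(\<lambda>z. \<Psi> (\<Sum>j\<in>{p - 2..<m}. (z j)\<^sup>2)) \<in> borel_measurable (\<Pi>\<^sub>M j\<in>{..<m}. borel)" by measurable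
    qed
    also have "\<dots> = (\<integral>\<^sup>+z. (\<lambda>z. \<Psi> (\<Sum>j\<in>{p - 2..<m}. (z j)\<^sup>2)) (\<lambda>j\<in>{p - 2..<m}. z (id j)) \<partial>stdn {..<m})"
      by simp
    also have "\<dots> = (\<integral>\<^sup>+z. \<Psi> (\<Sum>j\<in>{p - 2..<m}. (z j)\<^sup>2) \<partial>stdn {p - 2..<m})"
      by (rule nn_integral_stdn_reindex) auto
    also have "\<dots> = (\<integral>\<^sup>+\<kappa>. \<Psi> \<kappa> \<partial>chi_squared (m - (p - 2)))"
      by (subst nn_integral_stdn_chi_squared) auto
    finally show ?thesis .
  qed
  ultimately have "AE y in stdn (?R \<times> J).
    (\<integral>\<^sup>+r1. \<integral>\<^sup>+r0. F (V y r1 r0) \<partial>stdn J \<partial>stdn J) = (\<integral>\<^sup>+\<kappa>. \<Psi> \<kappa> \<partial>chi_squared (m - (p - 2)))"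
    by (auto elim: eventually_mono)
  then have "(\<integral>\<^sup>+y. \<integral>\<^sup>+r1. \<integral>\<^sup>+r0. F (V y r1 r0) \<partial>stdn J \<partial>stdn J \<partial>stdn (?R \<times> J))
    = (\<integral>\<^sup>+y. (\<integral>\<^sup>+\<kappa>. \<Psi> \<kappa> \<partial>chi_squared (m - (p - 2))) \<partial>stdn (?R \<times> J))"
    by (rule nn_integral_cong_AE)
  \<comment> \<open>The inner integral is the same for almost every \<open>y\<close>, so only the
    total mass of the law of \<open>y\<close> remains.\<close>
  also have "\<dots> = (\<integral>\<^sup>+\<kappa>. \<Psi> \<kappa> \<partial>chi_squared (m - (p - 2)))"
    using prob_space.emeasure_space_1[OF prob_space_stdn[of "?R \<times> J"]] by simp
  also have "(\<integral>\<^sup>+y. \<integral>\<^sup>+r1. \<integral>\<^sup>+r0. F (V y r1 r0) \<partial>stdn J \<partial>stdn J \<partial>stdn (?R \<times> J))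
    = (\<integral>\<^sup>+x. \<integral>\<^sup>+r0. F (replace_row UNIV a0 J x r0) \<partial>stdn J \<partial>stdn (?U \<times> J))"
    unfolding V_def using ne
    by (intro nn_integral_stdn_row[OF J, symmetric] measurable_nn_integral_replace_row F) auto
  also have "\<dots> = (\<integral>\<^sup>+V. F V \<partial>stdn (UNIV \<times> J))"
    by (intro nn_integral_stdn_row[OF J, symmetric] F) auto
  finally show ?thesis unfolding \<Psi>_def p_def m_def .
qed

text \<open>Rotating every column alike preserves the law of \<open>V\<close>. The rotation is
  chosen so that \<open>y\<close> becomes a multiple \<open>s\<close> of the vector
  \<open>a0\<close> and \<open>h\<close> lies in the plane of \<open>a0\<close> and
  \<open>a1\<close>. The numerator under the root, the Gram determinant of \<open>y\<close> and
  \<open>h\<close>, is the square of \<open>s\<close> times the \<open>a1\<close> coordinate of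
  \<open>h\<close>.\<close>

lemma wishart:
  fixes F :: "('p::finite \<times> 'j \<Rightarrow> real) \<Rightarrow> ennreal" and G :: "real \<Rightarrow> real \<Rightarrow> ennreal"
  assumes J: "finite J" and p: "2 \<le> CARD('p)" "CARD('p) \<le> card J"
    and F [measurable]: "F \<in> borel_measurable (\<Pi>\<^sub>M i\<in>UNIV \<times> J. borel)"
    and G [measurable]: "(\<lambda>(s, t). G s t) \<in> borel_measurable (borel \<Otimes>\<^sub>M borel)"
    and spec: "\<And>V \<theta>. lin_indep_rows UNIV J V \<Longrightarrow>
      (\<And>a. (\<Sum>b\<in>UNIV. gram J V a b * \<theta> b) = y a) \<Longrightarrow> F V = G (dot UNIV y \<theta>) (dot UNIV h \<theta>)"
  shows "(\<integral>\<^sup>+V. F V \<partial>stdn (UNIV \<times> J)) =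
    (\<integral>\<^sup>+\<kappa>. \<integral>\<^sup>+c. \<integral>\<^sup>+\<xi>. G (dot UNIV y y / \<xi>)
        ((dot UNIV y h - c * sqrt ((dot UNIV y y * dot UNIV h h - (dot UNIV y h)\<^sup>2) / \<kappa>)) / \<xi>)
      \<partial>chi_squared (card J - (CARD('p) - 1)) \<partial>std_normal_measure \<partial>chi_squared (card J - (CARD('p) - 2)))"
proof -
  interpret ip: finite_ip "UNIV :: 'p set" "dot UNIV" by (rule finite_ip_dot) simp
  have "\<not> card (UNIV :: 'p set) \<le> Suc 0" using p by simp
  then obtain a0 a1 :: 'p where ne: "a0 \<noteq> a1" using card_le_Suc0_iff_eq[of "UNIV :: 'p set"] by auto
  obtain f where o: "ip.orthonormal f UNIV" and fy: "\<And>k. k \<noteq> a0 \<Longrightarrow> dot UNIV y (f k) = 0" "dot UNIV y (f a0) \<ge> 0"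
    and fh: "\<And>k. k \<noteq> a0 \<Longrightarrow> k \<noteq> a1 \<Longrightarrow> dot UNIV h (f k) = 0" "dot UNIV h (f a1) \<ge> 0"
    by (rule ip.qr_two[OF finite refl UNIV_I UNIV_I ne, of y h]) (rule that; simp)
  have U: "finite (UNIV :: 'p set)" "card (UNIV :: 'p set) = card (UNIV :: 'p set)" by auto
  define s where "s = dot UNIV y (f a0)"
  have two: "(\<Sum>a\<in>UNIV. g a) = g a0 + g a1" if "\<And>k. k \<noteq> a0 \<Longrightarrow> k \<noteq> a1 \<Longrightarrow> g k = 0" for g :: "'p \<Rightarrow> real"
  proof -
    have "(\<Sum>a\<in>UNIV. g a) = (\<Sum>a\<in>{a0, a1}. g a)"
      using that by (intro sum.mono_neutral_right) auto
    then show ?thesis using ne by simp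
  qed
  have y_eq: "y b = s * f a0 b" for b
    using ip.expand[OF U o UNIV_I, of y b] two[of "\<lambda>a. dot UNIV y (f a) * f a b"] fy ne by (simp add: s_def)
  have yy: "dot UNIV y y = s\<^sup>2"
    using ip.parseval[OF U o, of y y] two[of "\<lambda>a. dot UNIV y (f a) * dot UNIV y (f a)"] fy(1) ne
    by (simp add: s_def power2_eq_square)
  have yh: "dot UNIV y h = s * dot UNIV h (f a0)"
    using ip.parseval[OF U o, of y h] two[of "\<lambda>a. dot UNIV y (f a) * dot UNIV h (f a)"] fy(1) ne
    by (simp add: s_def)
  have hh: "dot UNIV h h = (dot UNIV h (f a0))\<^sup>2 + (dot UNIV h (f a1))\<^sup>2"
    using ip.parseval[OF U o, of h h] two[of "\<lambda>a. dot UNIV h (f a) * dot UNIV h (f a)"] fh(1) ne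
    by (simp add: power2_eq_square)
  have "dot UNIV y y * dot UNIV h h - (dot UNIV y h)\<^sup>2 = (s * dot UNIV h (f a1))\<^sup>2"
    unfolding yy yh hh by (simp add: power_mult_distrib distrib_left)
  then have sq: "sqrt (dot UNIV y y * dot UNIV h h - (dot UNIV y h)\<^sup>2) = s * dot UNIV h (f a1)"
    using fy(2) fh(2) by (simp add: s_def)
  \<comment> \<open>\<open>S\<close> below carries data from the rotated position back to the
    original one, hence the sum over the first index of \<open>f\<close>; orthonormality of
    \<open>E\<close> is then the dual relation \<open>dot_dual\<close>.\<close>
  define E :: "'p \<times> 'j \<Rightarrow> 'p \<times> 'j \<Rightarrow> real" where "E = (\<lambda>(b, j) (a, k). if j = k then f a b else 0)"
  have fUJ: "finite ((UNIV :: 'p set) \<times> J)" using J by simp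
  interpret ipE: finite_ip "(UNIV :: 'p set) \<times> J" "dot (UNIV \<times> J)" by (rule finite_ip_dot[OF fUJ])
  have dE: "dot (UNIV \<times> J) (E (b, j)) V = (\<Sum>a\<in>UNIV. f a b * V (a, j))" if "j \<in> J" for b j V
  proof -
    have "dot (UNIV \<times> J) (E (b, j)) V = (\<Sum>a\<in>UNIV. \<Sum>k\<in>J. if j = k then f a b * V (a, k) else 0)"
      unfolding dot_def E_def by (subst sum.cartesian_product) (auto intro!: sum.cong)
    then show ?thesis using that J by simp
  qed
  have oE: "ipE.orthonormal E (UNIV \<times> J)"
    unfolding ipE.orthonormal_def
  proof (intro ballI)
    fix i i' assume "i \<in> (UNIV :: 'p set) \<times> J" "i' \<in> (UNIV :: 'p set) \<times> J"
    then obtain b j b' j' where i: "i = (b, j)" "i' = (b', j')" "j \<in> J" "j' \<in> J" by auto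
    have "(\<Sum>a\<in>UNIV. f a b * E (b', j') (a, j)) = (if j' = j then \<Sum>a\<in>UNIV. f a b * f a b' else 0)"
      by (simp add: E_def)
    also have "(\<Sum>a\<in>UNIV. f a b * f a b') = (if b = b' then 1 else 0)"
      by (rule dot_dual[OF finite U o]) auto
    finally show "dot (UNIV \<times> J) (E i) (E i') = (if i = i' then 1 else 0)"
      using i by (auto simp: dE)
  qed
  define S where "S = (\<lambda>V. \<lambda>i\<in>UNIV \<times> J. dot (UNIV \<times> J) (E i) V)"
  have S: "S V (b, j) = (\<Sum>a\<in>UNIV. f a b * V (a, j))" if "j \<in> J" for V b j
    using that by (simp add: S_def dE)
  have [measurable]: "S \<in> measurable (\<Pi>\<^sub>M i\<in>UNIV \<times> J. borel) (\<Pi>\<^sub>M i\<in>UNIV \<times> J. borel)"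
    unfolding S_def by measurable
  define t where "t = dot UNIV h (f a1)"
  define G' where "G' = (\<lambda>x z. G (s\<^sup>2 * x) (dot UNIV y h * x + s * t * z))"
  have [measurable]: "(\<lambda>(x, z). G' x z) \<in> borel_measurable (borel \<Otimes>\<^sub>M borel)"
    unfolding G'_def by measurable
  have spec': "F (S V) = G' (\<theta> a0) (\<theta> a1)"
    if l: "lin_indep_rows UNIV J V" and sol: "\<And>a. (\<Sum>b\<in>UNIV. gram J V a b * \<theta> b) = (if a = a0 then 1 else 0)" for V \<theta>
  proof -
    \<comment> \<open>The Gram matrix is conjugated by the rotation and \<open>y\<close> is
      \<open>s\<close> times the image of the vector \<open>a0\<close>, so the solution is rotated
      and multiplied by \<open>s\<close>.\<close>
    define \<theta>' where "\<theta>' = (\<lambda>b. \<Sum>a\<in>UNIV. (s * \<theta> a) * f a b)"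
    have d\<theta>: "dot UNIV v \<theta>' = (\<Sum>a\<in>UNIV. (s * \<theta> a) * dot UNIV v (f a))" for v
      unfolding \<theta>'_def by (rule ip.sum_right)
    have l': "lin_indep_rows UNIV J (S V)"
      unfolding lin_indep_rows_def
    proof (intro allI impI)
      fix t assume t: "\<forall>j\<in>J. (\<Sum>b\<in>UNIV. t b * S V (b, j)) = 0"
      have "(\<Sum>a\<in>UNIV. dot UNIV t (f a) * V (a, j)) = (\<Sum>b\<in>UNIV. t b * S V (b, j))" if "j \<in> J" for j
        unfolding dot_def S[OF that] sum_distrib_left sum_distrib_right
        by (subst sum.swap) (simp add: mult_ac)
      then have "\<forall>j\<in>J. (\<Sum>a\<in>UNIV. dot UNIV t (f a) * V (a, j)) = 0" using t by simp
      then have "\<forall>a\<in>UNIV. dot UNIV t (f a) = 0"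
        by (rule l[unfolded lin_indep_rows_def, THEN HOL.spec[of _ "\<lambda>a. dot UNIV t (f a)"], THEN mp])
      then show "\<forall>b\<in>UNIV. t b = 0" using ip.expand[OF U o UNIV_I, of t] by simp
    qed
    have "(\<Sum>b'\<in>UNIV. gram J (S V) b b' * \<theta>' b') = y b" for b
    proof -
      have 1: "(\<Sum>b'\<in>UNIV. \<theta>' b' * S V (b', j)) = s * (\<Sum>a\<in>UNIV. \<theta> a * V (a, j))" if "j \<in> J" for j
      proof -
        have "(\<Sum>b'\<in>UNIV. \<theta>' b' * S V (b', j)) = dot UNIV \<theta>' (\<lambda>b. \<Sum>a\<in>UNIV. V (a, j) * f a b)"
          unfolding dot_def S[OF that] by (simp add: mult.commute)
        also have "\<dots> = (\<Sum>a\<in>UNIV. V (a, j) * dot UNIV \<theta>' (f a))" by (rule ip.sum_right)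
        also have "\<dots> = (\<Sum>a\<in>UNIV. V (a, j) * (s * \<theta> a))"
        proof (intro sum.cong refl)
          fix a
          have "dot UNIV \<theta>' (f a) = (\<Sum>k\<in>UNIV. (s * \<theta> k) * (if a = k then 1 else 0))"
            unfolding ip.sym[of \<theta>'] d\<theta> using o by (intro sum.cong) (auto simp: ip.orthonormal_def)
          then show "V (a, j) * dot UNIV \<theta>' (f a) = V (a, j) * (s * \<theta> a)"
            by (simp add: if_distrib[of "(*) _"] cong: if_cong)
        qed
        finally show ?thesis by (simp add: sum_distrib_left mult_ac)
      qed
      have "(\<Sum>b'\<in>UNIV. gram J (S V) b b' * \<theta>' b') = (\<Sum>j\<in>J. (\<Sum>a\<in>UNIV. f a b * V (a, j)) * (s * (\<Sum>a\<in>UNIV. \<theta> a * V (a, j))))"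
        unfolding gram_apply by (intro sum.cong refl) (simp only: 1, simp only: S)
      also have "\<dots> = s * (\<Sum>a\<in>UNIV. f a b * (\<Sum>j\<in>J. V (a, j) * (\<Sum>a\<in>UNIV. \<theta> a * V (a, j))))"
      proof -
        have "(\<Sum>j\<in>J. (\<Sum>a\<in>UNIV. f a b * V (a, j)) * (s * w j)) = s * (\<Sum>a\<in>UNIV. f a b * (\<Sum>j\<in>J. V (a, j) * w j))" for w
          unfolding sum_distrib_left sum_distrib_right by (subst sum.swap) (simp add: mult_ac)
        then show ?thesis .
      qed
      also have "\<dots> = s * (\<Sum>a\<in>UNIV. f a b * (if a = a0 then 1 else 0))"
        unfolding gram_apply[symmetric] sol ..
      also have "\<dots> = y b" by (simp add: y_eq if_distrib[of "(*) _"] cong: if_cong)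
      finally show ?thesis .
    qed
    then have "F (S V) = G (dot UNIV y \<theta>') (dot UNIV h \<theta>')" by (rule spec[OF l'])
    also have "dot UNIV y \<theta>' = s\<^sup>2 * \<theta> a0"
      unfolding d\<theta> using two[of "\<lambda>a. s * \<theta> a * dot UNIV y (f a)"] fy(1) ne
      by (simp add: s_def power2_eq_square)
    also have "dot UNIV h \<theta>' = dot UNIV y h * \<theta> a0 + s * t * \<theta> a1"
      unfolding d\<theta> using two[of "\<lambda>a. s * \<theta> a * dot UNIV h (f a)"] fh(1)
      by (simp add: yh t_def)
    finally show ?thesis by (simp add: G'_def)
  qed
  have "(\<integral>\<^sup>+V. F V \<partial>stdn (UNIV \<times> J)) = (\<integral>\<^sup>+V. F (S V) \<partial>stdn (UNIV \<times> J))"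
    unfolding S_def by (rule nn_integral_stdn_orthonormal[OF fUJ fUJ refl oE F, symmetric])
  also have "\<dots> = (\<integral>\<^sup>+\<kappa>. \<integral>\<^sup>+c. \<integral>\<^sup>+\<xi>. G' (1 / \<xi>) (- (c / sqrt \<kappa>) / \<xi>)
      \<partial>chi_squared (card J - (CARD('p) - 1)) \<partial>std_normal_measure \<partial>chi_squared (card J - (CARD('p) - 2)))"
    by (rule wishart_canonical[OF J p ne]) (measurable, rule spec')
  also have "\<dots> = (\<integral>\<^sup>+\<kappa>. \<integral>\<^sup>+c. \<integral>\<^sup>+\<xi>. G (dot UNIV y y / \<xi>)
        ((dot UNIV y h - c * sqrt ((dot UNIV y y * dot UNIV h h - (dot UNIV y h)\<^sup>2) / \<kappa>)) / \<xi>)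
      \<partial>chi_squared (card J - (CARD('p) - 1)) \<partial>std_normal_measure \<partial>chi_squared (card J - (CARD('p) - 2)))"
    by (intro nn_integral_cong)
      (simp only: G'_def real_sqrt_divide sq, simp add: yy t_def diff_divide_distrib mult_ac)
  finally show ?thesis .
qed

section \<open>The law of the discriminant for a fixed mean difference\<close>

lemma sigma_finite_stdn: "sigma_finite_measure (stdn I)"
  using prob_space_stdn prob_space_imp_sigma_finite by blast

lemma AE_chi_squared_nonneg: "AE x in chi_squared k. 0 \<le> x"
  unfolding chi_squared_def noncentral_chi_squared_altdef
  by (subst AE_distr_iff) (auto intro!: sum_nonneg)

lemma nn_integral_swap:
  assumes "sigma_finite_measure M" "sigma_finite_measure N"
    and "(\<lambda>(x, y). f x y) \<in> borel_measurable (M \<Otimes>\<^sub>M N)"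
  shows "(\<integral>\<^sup>+x. \<integral>\<^sup>+y. f x y \<partial>N \<partial>M) = (\<integral>\<^sup>+y. \<integral>\<^sup>+x. f x y \<partial>M \<partial>N)"
proof -
  interpret pair_sigma_finite M N by (intro pair_sigma_finite.intro assms)
  show ?thesis using Fubini'[OF assms(3)] by simp
qed

lemma nn_integral_stdn_split_one:
  assumes I: "finite I" "i \<in> I"
    and \<phi> [measurable]: "(\<lambda>(x, y). \<phi> x y) \<in> borel_measurable (borel \<Otimes>\<^sub>M (\<Pi>\<^sub>M i\<in>I - {i}. borel))"
  shows "(\<integral>\<^sup>+z. \<phi> (z i) (\<lambda>j\<in>I - {i}. z j) \<partial>stdn I)
    = (\<integral>\<^sup>+y. \<integral>\<^sup>+x. \<phi> x y \<partial>std_normal_measure \<partial>stdn (I - {i}))"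
proof -
  have "(\<integral>\<^sup>+z. \<phi> (z i) (\<lambda>j\<in>I - {i}. z j) \<partial>stdn I)
    = (\<integral>\<^sup>+z. (\<lambda>y x. \<phi> (x i) y) (\<lambda>j\<in>I - {i}. z j) (\<lambda>j\<in>{i}. z j) \<partial>stdn I)" by simp
  also have "\<dots> = (\<integral>\<^sup>+y. \<integral>\<^sup>+x. \<phi> (x i) y \<partial>stdn {i} \<partial>stdn (I - {i}))"
  proof (rule nn_integral_stdn_split)
    have 1: "(\<lambda>z. (snd z i, fst z)) \<in> measurable ((\<Pi>\<^sub>M i\<in>I - {i}. borel) \<Otimes>\<^sub>M (\<Pi>\<^sub>M j\<in>{i}. borel))
      ((borel :: real measure) \<Otimes>\<^sub>M (\<Pi>\<^sub>M i\<in>I - {i}. (borel :: real measure)))"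
      by measurable
    show "(\<lambda>(y, x). \<phi> (x i) y) \<in> borel_measurable ((\<Pi>\<^sub>M i\<in>I - {i}. borel) \<Otimes>\<^sub>M (\<Pi>\<^sub>M j\<in>{i}. borel))"
      using measurable_compose[OF 1 \<phi>] by (simp add: case_prod_unfold)
  qed (use I in auto)
  also have "\<dots> = (\<integral>\<^sup>+y. \<integral>\<^sup>+x. \<phi> x y \<partial>std_normal_measure \<partial>stdn (I - {i}))"
  proof (rule nn_integral_cong)
    fix y assume "y \<in> space (stdn (I - {i}))"
    then have y: "y \<in> space (\<Pi>\<^sub>M i\<in>I - {i}. borel)" by simp
    have "(\<lambda>x. \<phi> x y) \<in> borel_measurable borel"
      using measurable_compose[OF measurable_Pair2'[OF y] \<phi>] by simp
    then show "(\<integral>\<^sup>+x. \<phi> (x i) y \<partial>stdn {i}) = (\<integral>\<^sup>+x. \<phi> x y \<partial>std_normal_measure)"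
      by (intro nn_integral_stdn_component) auto
  qed
  finally show ?thesis .
qed

lemma nn_integral_noncentral_F:
  assumes [measurable]: "g \<in> borel_measurable borel"
  shows "(\<integral>\<^sup>+u. g u \<partial>noncentral_F m1 m2 d)
    = (\<integral>\<^sup>+\<zeta>. \<integral>\<^sup>+w. g ((\<zeta> / real m1) / (w / real m2)) \<partial>chi_squared m2 \<partial>noncentral_chi_squared m1 d)"
proof -
  interpret sigma_finite_measure "chi_squared m2" by (rule sigma_finite_chi_squared)
  let ?P = "noncentral_chi_squared m1 d \<Otimes>\<^sub>M chi_squared m2"
  have "(\<integral>\<^sup>+u. g u \<partial>noncentral_F m1 m2 d) = (\<integral>\<^sup>+x. g ((fst x / real m1) / (snd x / real m2)) \<partial>?P)"
    unfolding noncentral_F_def by (subst nn_integral_distr) (auto simp: case_prod_unfold)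
  also have "\<dots> = (\<integral>\<^sup>+\<zeta>. \<integral>\<^sup>+w. g ((\<zeta> / real m1) / (w / real m2)) \<partial>chi_squared m2 \<partial>noncentral_chi_squared m1 d)"
    by (subst nn_integral_fst[symmetric]) auto
  finally show ?thesis .
qed

text \<open>In its application \<open>g\<close>, \<open>x\<close> and \<open>c\<close> are the
  component along \<open>y\<close> of the normalized grand mean, that of the new observation, and
  the Gram-Schmidt coordinate from \<open>wishart\<close>. The variances \<open>b\<^sup>2\<close>, 1
  and \<open>q\<close> of the three summands add.\<close>

lemma nn_integral_three_normals:
  assumes [measurable]: "\<psi> \<in> borel_measurable borel" and q: "0 \<le> q"
  shows "(\<integral>\<^sup>+g. \<integral>\<^sup>+x. \<integral>\<^sup>+c. \<psi> (x - g * b - c * sqrt q) \<partial>std_normal_measure \<partial>std_normal_measure \<partial>std_normal_measure)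
    = (\<integral>\<^sup>+z. \<psi> (sqrt (1 + b\<^sup>2 + q) * z) \<partial>std_normal_measure)"
proof -
  interpret sigma_finite_measure std_normal_measure by (rule sigma_finite_std_normal)
  have "(\<integral>\<^sup>+g. \<integral>\<^sup>+x. \<integral>\<^sup>+c. \<psi> (x - g * b - c * sqrt q) \<partial>std_normal_measure \<partial>std_normal_measure \<partial>std_normal_measure)
    = (\<integral>\<^sup>+g. \<integral>\<^sup>+x. \<integral>\<^sup>+c. (\<lambda>u. \<psi> (u - g * b)) (1 * x + - sqrt q * c) \<partial>std_normal_measure \<partial>std_normal_measure \<partial>std_normal_measure)"
    by (intro nn_integral_cong arg_cong[where f = \<psi>]) simp
  also have "\<dots> = (\<integral>\<^sup>+g. \<integral>\<^sup>+x. \<psi> (sqrt (1 + q) * x - g * b) \<partial>std_normal_measure \<partial>std_normal_measure)"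
  proof (rule nn_integral_cong)
    fix g
    show "(\<integral>\<^sup>+x. \<integral>\<^sup>+c. \<psi> (1 * x + - sqrt q * c - g * b) \<partial>std_normal_measure \<partial>std_normal_measure)
      = (\<integral>\<^sup>+x. \<psi> (sqrt (1 + q) * x - g * b) \<partial>std_normal_measure)"
      using nn_integral_normal_add[of "\<lambda>u. \<psi> (u - g * b)" 1 "- sqrt q"] q by simp
  qed
  also have "\<dots> = (\<integral>\<^sup>+g. \<integral>\<^sup>+x. \<psi> (- b * g + sqrt (1 + q) * x) \<partial>std_normal_measure \<partial>std_normal_measure)"
    by (intro nn_integral_cong arg_cong[where f = \<psi>]) simp
  also have "\<dots> = (\<integral>\<^sup>+z. \<psi> (sqrt (1 + b\<^sup>2 + q) * z) \<partial>std_normal_measure)"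
    using nn_integral_normal_add[of \<psi> "- b" "sqrt (1 + q)"] q by (simp add: add_ac)
  finally show ?thesis .
qed

text \<open>Here \<open>y\<close> is the difference of the sample means, \<open>g\<close> the normalized grand mean and \<open>x\<close> the new observation, in
  coordinates in which the difference of the means is a multiple of the unit vector \<open>a0\<close>; \<open>N\<close> is the total
  sample size.\<close>

lemma discriminant_law_fixed_difference:
  fixes F :: "('p::finite \<Rightarrow> real) \<Rightarrow> ('p \<Rightarrow> real) \<Rightarrow> ('p \<times> 'j \<Rightarrow> real) \<Rightarrow> ennreal" and f :: "real \<Rightarrow> ennreal"
    and a0 :: 'p and N \<nu> :: real
  assumes J: "finite J" and p: "2 \<le> CARD('p)" "CARD('p) \<le> card J"
    and y0: "dot UNIV y y \<noteq> 0" and N: "N > 0" and f [measurable]: "f \<in> borel_measurable borel"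
    and F: "\<And>g x. F g x \<in> borel_measurable (\<Pi>\<^sub>M i\<in>UNIV \<times> J. borel)"
    and spec: "\<And>g x V \<theta>. lin_indep_rows UNIV J V \<Longrightarrow>
      (\<And>a. (\<Sum>b\<in>UNIV. gram J V a b * \<theta> b) = y a) \<Longrightarrow>
      F g x V = f (k * (c * dot UNIV y \<theta> + dot UNIV (\<lambda>a. (if a = a0 then \<nu> else 0) + x a - g a * (1 / sqrt N)) \<theta>))"
  defines "Y \<equiv> dot UNIV y y"
  shows "(\<integral>\<^sup>+g. \<integral>\<^sup>+x. \<integral>\<^sup>+V. F g x V \<partial>stdn (UNIV \<times> J) \<partial>stdn UNIV \<partial>stdn UNIV) =
    (\<integral>\<^sup>+r. \<integral>\<^sup>+\<zeta>. \<integral>\<^sup>+\<kappa>. \<integral>\<^sup>+z. \<integral>\<^sup>+\<xi>. f (k / \<xi> * (c * Y + \<nu> * y a0 + sqrt (1 + 1 / N + \<zeta> / \<kappa>) * sqrt Y * z))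
      \<partial>chi_squared (card J - (CARD('p) - 1)) \<partial>std_normal_measure \<partial>chi_squared (card J - (CARD('p) - 2))
      \<partial>noncentral_chi_squared (CARD('p) - 1) (r / N)
      \<partial>noncentral_chi_squared (CARD('p) - 1) (N * \<nu>\<^sup>2 * (Y - (y a0)\<^sup>2) / Y))"
proof -
  interpret ip: finite_ip "UNIV :: 'p set" "dot UNIV" by (rule finite_ip_dot) simp
  let ?N = std_normal_measure
  let ?K = "chi_squared (card J - (CARD('p) - 2))"
  let ?X = "chi_squared (card J - (CARD('p) - 1))"
  define R where "R = UNIV - {a0}"
  have cR: "card R = CARD('p) - 1" by (simp add: R_def card_Diff_subset)
  interpret K: sigma_finite_measure ?K by (rule sigma_finite_chi_squared)
  interpret X: sigma_finite_measure ?X by (rule sigma_finite_chi_squared)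
  interpret SR: sigma_finite_measure "stdn R" by (rule sigma_finite_stdn)
  interpret SU: sigma_finite_measure "stdn (UNIV :: 'p set)" by (rule sigma_finite_stdn)
  have "\<not> card (UNIV :: 'p set) \<le> Suc 0" using p by simp
  then obtain a1 :: 'p where ne: "a0 \<noteq> a1"
    using card_le_Suc0_iff_eq[of "UNIV :: 'p set"] by (metis finite)
  have Ypos: "Y > 0" using y0 by (auto simp: Y_def dot_def sum_nonneg less_le)
  define d :: "'p \<Rightarrow> real" where "d = (\<lambda>a. if a = a0 then 1 else 0)"
  have dd: "dot UNIV d v = v a0" for v
    by (simp add: d_def dot_def if_distrib[of "\<lambda>x. x * _"] cong: if_cong)
  \<comment> \<open>In the basis \<open>e\<close> the index \<open>a0\<close> stands for the
    direction of \<open>y\<close>, whereas in the given coordinates it stands for the direction of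
    the mean difference; \<open>d\<close> is the latter direction, and the numbers
    \<open>dot UNIV d (e a)\<close> are its components in \<open>e\<close>.\<close>
  obtain e where o: "ip.orthonormal e UNIV" and ey: "\<And>k. k \<noteq> a0 \<Longrightarrow> dot UNIV y (e k) = 0" "dot UNIV y (e a0) \<ge> 0"
    by (rule ip.qr_two[OF finite refl UNIV_I UNIV_I ne, of y d]) (rule that; simp)
  have U: "finite (UNIV :: 'p set)" "card (UNIV :: 'p set) = card (UNIV :: 'p set)" by auto
  have split: "(\<Sum>a\<in>UNIV. g a) = g a0 + (\<Sum>a\<in>R. g a)" for g :: "'p \<Rightarrow> real"
    unfolding R_def by (rule sum.remove) auto
  have yv: "dot UNIV y v = dot UNIV y (e a0) * dot UNIV v (e a0)" for v
  proof -
    have "(\<Sum>a\<in>R. dot UNIV y (e a) * dot UNIV v (e a)) = 0"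
      using ey(1) by (intro sum.neutral) (auto simp: R_def)
    then show ?thesis using ip.parseval[OF U o, of y v] by (simp add: split)
  qed
  have "Y = (dot UNIV y (e a0))\<^sup>2" using yv[of y] by (simp add: Y_def power2_eq_square)
  then have sY: "dot UNIV y (e a0) = sqrt Y" using ey(2) by simp
  have ya0: "y a0 = sqrt Y * dot UNIV d (e a0)"
    using yv[of d] dd[of y] by (simp add: sY ip.sym)
  have vv: "dot UNIV v v = (dot UNIV v (e a0))\<^sup>2 + (\<Sum>a\<in>R. (dot UNIV v (e a))\<^sup>2)" for v
    using ip.parseval[OF U o, of v v] by (simp add: split power2_eq_square)
  have dR: "(\<Sum>a\<in>R. (dot UNIV d (e a))\<^sup>2) = (Y - (y a0)\<^sup>2) / Y"
  proof -
    have "(\<Sum>a\<in>R. (dot UNIV d (e a))\<^sup>2) = 1 - (dot UNIV d (e a0))\<^sup>2"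
      using vv[of d] dd[of d] by (simp add: d_def)
    moreover have "(y a0)\<^sup>2 = Y * (dot UNIV d (e a0))\<^sup>2" using Ypos by (simp add: ya0 power_mult_distrib)
    ultimately show ?thesis using Ypos by (simp add: diff_divide_distrib)
  qed
  \<comment> \<open>The scatter matrix is integrated out; \<open>a\<close> stands for
    \<open>y \<bullet> h\<close> and \<open>b\<close> for the Gram determinant of \<open>y\<close>
    and \<open>h\<close>. In rotated coordinates these are \<open>A\<close>, which sees only the
    components along \<open>y\<close>, and \<open>Y * Q\<close>, where \<open>Q\<close> sees only
    those orthogonal to \<open>y\<close>.\<close>
  define \<Phi> where "\<Phi> = (\<lambda>a b. \<integral>\<^sup>+\<kappa>. \<integral>\<^sup>+c'. \<integral>\<^sup>+\<xi>. f (k * (c * (Y / \<xi>) + (a - c' * sqrt (b / \<kappa>)) / \<xi>)) \<partial>?X \<partial>?N \<partial>?K)"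
  have [measurable]: "(\<lambda>(a, b). \<Phi> a b) \<in> borel_measurable (borel \<Otimes>\<^sub>M borel)" unfolding \<Phi>_def by measurable
  define A where "A = (\<lambda>g0 x0. sqrt Y * (\<nu> * dot UNIV d (e a0) + x0 - g0 * (1 / sqrt N)))"
  define Q where "Q = (\<lambda>g x. \<Sum>a\<in>R. (x a + (\<nu> * dot UNIV d (e a) - g a * (1 / sqrt N)))\<^sup>2)"
  have [measurable]: "(\<lambda>(g, x). A g x) \<in> borel_measurable (borel \<Otimes>\<^sub>M borel)" unfolding A_def by measurable
  have Qm: "(\<lambda>(g, x). Q g x) \<in> borel_measurable ((\<Pi>\<^sub>M i\<in>L. borel) \<Otimes>\<^sub>M (\<Pi>\<^sub>M i\<in>L'. borel))"
    if "R \<subseteq> L" "R \<subseteq> L'" for L L'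
  proof -
    have [measurable]: "(\<lambda>z. fst z a) \<in> borel_measurable ((\<Pi>\<^sub>M i\<in>L. borel) \<Otimes>\<^sub>M (\<Pi>\<^sub>M i\<in>L'. (borel :: real measure)))"
      "(\<lambda>z. snd z a) \<in> borel_measurable ((\<Pi>\<^sub>M i\<in>L. (borel :: real measure)) \<Otimes>\<^sub>M (\<Pi>\<^sub>M i\<in>L'. borel))" if "a \<in> R" for a
      using that \<open>R \<subseteq> L\<close> \<open>R \<subseteq> L'\<close>
      by (auto intro!: measurable_compose[OF measurable_fst measurable_component_singleton]
        measurable_compose[OF measurable_snd measurable_component_singleton])
    show ?thesis unfolding Q_def case_prod_unfold
      by (intro borel_measurable_sum borel_measurable_power borel_measurable_add borel_measurable_diff
        borel_measurable_times borel_measurable_const) measurable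
  qed
  define T where "T = (\<lambda>v. \<lambda>a\<in>UNIV. dot UNIV (e a) v)"
  have V_int: "(\<integral>\<^sup>+V. F g x V \<partial>stdn (UNIV \<times> J)) = \<Phi> (A (T g a0) (T x a0)) (Y * Q (T g) (T x))" for g x
  proof -
    define h where "h = (\<lambda>a. (if a = a0 then \<nu> else 0) + x a - g a * (1 / sqrt N))"
    have he: "dot UNIV h (e a) = \<nu> * dot UNIV d (e a) + T x a - T g a * (1 / sqrt N)" for a
    proof -
      have "h = (\<lambda>a. (\<nu> * d a + x a) - (1 / sqrt N) * g a)" by (auto simp: h_def d_def)
      then have "dot UNIV h (e a) = \<nu> * dot UNIV d (e a) + dot UNIV x (e a) - (1 / sqrt N) * dot UNIV g (e a)"
        by (simp only: ip.diff ip.lin ip.scale)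
      then show ?thesis by (simp add: T_def ip.sym)
    qed
    have yh: "dot UNIV y h = A (T g a0) (T x a0)" unfolding yv[of h] sY he A_def by simp
    have hh: "dot UNIV y y * dot UNIV h h - (dot UNIV y h)\<^sup>2 = Y * Q (T g) (T x)"
    proof -
      have "(\<Sum>a\<in>R. (dot UNIV h (e a))\<^sup>2) = Q (T g) (T x)"
        unfolding Q_def he by (intro sum.cong) (auto simp: algebra_simps)
      then show ?thesis
        unfolding yv[of h] vv[of h] sY Y_def[symmetric] using Ypos
        by (simp add: power_mult_distrib algebra_simps)
    qed
    have "(\<integral>\<^sup>+V. F g x V \<partial>stdn (UNIV \<times> J)) = (\<integral>\<^sup>+\<kappa>. \<integral>\<^sup>+c'. \<integral>\<^sup>+\<xi>. f (k * (c * (dot UNIV y y / \<xi>) +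
        ((dot UNIV y h - c' * sqrt ((dot UNIV y y * dot UNIV h h - (dot UNIV y h)\<^sup>2) / \<kappa>)) / \<xi>))) \<partial>?X \<partial>?N \<partial>?K)"
    proof (rule wishart[OF J p F])
      show "(\<lambda>(s, t). f (k * (c * s + t))) \<in> borel_measurable (borel \<Otimes>\<^sub>M borel)" by measurable
    next
      fix V \<theta>
      assume "lin_indep_rows UNIV J V" "\<And>a. (\<Sum>b\<in>UNIV. gram J V a b * \<theta> b) = y a"
      then show "F g x V = f (k * (c * dot UNIV y \<theta> + dot UNIV h \<theta>))"
        unfolding h_def by (rule spec)
    qed
    then show ?thesis unfolding hh unfolding yh \<Phi>_def Y_def[symmetric] .
  qed
  define \<Theta> where "\<Theta> = (\<lambda>q. \<integral>\<^sup>+\<kappa>. \<integral>\<^sup>+z. \<integral>\<^sup>+\<xi>. f (k / \<xi> * (c * Y + \<nu> * y a0 + sqrt (1 + 1 / N + q / \<kappa>) * sqrt Y * z)) \<partial>?X \<partial>?N \<partial>?K)"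
  have [measurable]: "\<Theta> \<in> borel_measurable borel" unfolding \<Theta>_def by measurable
  \<comment> \<open>For fixed \<open>q\<close> the three normal variables along \<open>y\<close>
    merge into one. The factor \<open>sqrt Y\<close> is common to all three, since the Gram
    determinant is \<open>Y * q\<close>.\<close>
  have normals: "(\<integral>\<^sup>+g. \<integral>\<^sup>+x. \<Phi> (A g x) (Y * q) \<partial>?N \<partial>?N) = \<Theta> q" if q: "0 \<le> q" for q
  proof -
    have "(\<integral>\<^sup>+g. \<integral>\<^sup>+x. \<Phi> (A g x) (Y * q) \<partial>?N \<partial>?N) = (\<integral>\<^sup>+g. \<integral>\<^sup>+\<kappa>. \<integral>\<^sup>+x. \<integral>\<^sup>+c'. \<integral>\<^sup>+\<xi>.
       f (k * (c * (Y / \<xi>) + (A g x - c' * sqrt (Y * q / \<kappa>)) / \<xi>)) \<partial>?X \<partial>?N \<partial>?N \<partial>?K \<partial>?N)"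
      unfolding \<Phi>_def
      by (intro nn_integral_cong nn_integral_swap sigma_finite_std_normal sigma_finite_chi_squared) measurable
    also have "\<dots> = (\<integral>\<^sup>+\<kappa>. \<integral>\<^sup>+g. \<integral>\<^sup>+x. \<integral>\<^sup>+c'. \<integral>\<^sup>+\<xi>.
       f (k * (c * (Y / \<xi>) + (A g x - c' * sqrt (Y * q / \<kappa>)) / \<xi>)) \<partial>?X \<partial>?N \<partial>?N \<partial>?N \<partial>?K)"
      by (intro nn_integral_swap sigma_finite_std_normal sigma_finite_chi_squared) measurable
    also have "\<dots> = \<Theta> q"
      unfolding \<Theta>_def
    proof (rule nn_integral_cong_AE)
      show "AE \<kappa> in ?K. (\<integral>\<^sup>+g. \<integral>\<^sup>+x. \<integral>\<^sup>+c'. \<integral>\<^sup>+\<xi>. f (k * (c * (Y / \<xi>) + (A g x - c' * sqrt (Y * q / \<kappa>)) / \<xi>)) \<partial>?X \<partial>?N \<partial>?N \<partial>?N)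
        = (\<integral>\<^sup>+z. \<integral>\<^sup>+\<xi>. f (k / \<xi> * (c * Y + \<nu> * y a0 + sqrt (1 + 1 / N + q / \<kappa>) * sqrt Y * z)) \<partial>?X \<partial>?N)"
        using AE_chi_squared_nonneg
      proof eventually_elim
        case (elim \<kappa>)
        define \<psi> where "\<psi> = (\<lambda>u. \<integral>\<^sup>+\<xi>. f (k / \<xi> * (c * Y + \<nu> * y a0 + sqrt Y * u)) \<partial>?X)"
        have [measurable]: "\<psi> \<in> borel_measurable borel" unfolding \<psi>_def by measurable
        have q': "0 \<le> q / \<kappa>" using q elim by simp
        have "(\<integral>\<^sup>+g. \<integral>\<^sup>+x. \<integral>\<^sup>+c'. \<integral>\<^sup>+\<xi>. f (k * (c * (Y / \<xi>) + (A g x - c' * sqrt (Y * q / \<kappa>)) / \<xi>)) \<partial>?X \<partial>?N \<partial>?N \<partial>?N)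
          = (\<integral>\<^sup>+g. \<integral>\<^sup>+x. \<integral>\<^sup>+c'. \<psi> (x - g * (1 / sqrt N) - c' * sqrt (q / \<kappa>)) \<partial>?N \<partial>?N \<partial>?N)"
          unfolding \<psi>_def
        proof (intro nn_integral_cong arg_cong[where f = f])
          fix g x c' \<xi> :: real
          have "sqrt (Y * q / \<kappa>) = sqrt Y * sqrt (q / \<kappa>)"
            by (simp add: real_sqrt_mult real_sqrt_divide)
          then have eq: "A g x - c' * sqrt (Y * q / \<kappa>) = \<nu> * y a0 + sqrt Y * (x - g * (1 / sqrt N) - c' * sqrt (q / \<kappa>))"
            by (simp add: A_def ya0 algebra_simps)
          show "k * (c * (Y / \<xi>) + (A g x - c' * sqrt (Y * q / \<kappa>)) / \<xi>)
            = k / \<xi> * (c * Y + \<nu> * y a0 + sqrt Y * (x - g * (1 / sqrt N) - c' * sqrt (q / \<kappa>)))"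
            unfolding eq by (simp add: divide_inverse distrib_left distrib_right mult_ac add_ac del: inverse_mult_distrib real_sqrt_mult real_sqrt_divide)
        qed
        also have "\<dots> = (\<integral>\<^sup>+z. \<psi> (sqrt (1 + (1 / sqrt N)\<^sup>2 + q / \<kappa>) * z) \<partial>?N)"
          by (rule nn_integral_three_normals[OF _ q']) measurable
        also have "(1 / sqrt N)\<^sup>2 = 1 / N" using N by (simp add: power_divide)
        finally show ?case unfolding \<psi>_def by (simp add: mult_ac)
      qed
    qed
    finally show ?thesis .
  qed
  have [measurable]: "T \<in> measurable (\<Pi>\<^sub>M i\<in>UNIV. borel) (\<Pi>\<^sub>M i\<in>UNIV. borel)" unfolding T_def by measurable
  have [measurable]: "(\<lambda>z. z a0) \<in> borel_measurable (\<Pi>\<^sub>M i\<in>UNIV. (borel :: real measure))"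
    by (rule measurable_component_singleton) simp
  note QUU = Qm[of UNIV UNIV, simplified]
  define H where "H = (\<lambda>g x. \<Phi> (A (g a0) (x a0)) (Y * Q g x))"
  have [measurable]: "(\<lambda>(g, x). H g x) \<in> borel_measurable ((\<Pi>\<^sub>M i\<in>UNIV. borel) \<Otimes>\<^sub>M (\<Pi>\<^sub>M i\<in>UNIV. borel))"
  proof -
    note [measurable] = QUU
    show ?thesis unfolding H_def by measurable
  qed
  have "(\<integral>\<^sup>+g. \<integral>\<^sup>+x. \<integral>\<^sup>+V. F g x V \<partial>stdn (UNIV \<times> J) \<partial>stdn UNIV \<partial>stdn UNIV)
    = (\<integral>\<^sup>+g. \<integral>\<^sup>+x. H (T g) (T x) \<partial>stdn UNIV \<partial>stdn UNIV)"
    unfolding V_int H_def ..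
  also have "\<dots> = (\<integral>\<^sup>+g. \<integral>\<^sup>+x. H (T g) x \<partial>stdn UNIV \<partial>stdn UNIV)"
    unfolding T_def by (intro nn_integral_cong nn_integral_stdn_orthonormal U o) measurable
  also have "\<dots> = (\<integral>\<^sup>+g. \<integral>\<^sup>+x. H g x \<partial>stdn UNIV \<partial>stdn UNIV)"
    unfolding T_def
    by (rule nn_integral_stdn_orthonormal[where f = "\<lambda>g. \<integral>\<^sup>+x. H g x \<partial>stdn UNIV", OF U(1) U o]) measurable
  also have "\<dots> = (\<integral>\<^sup>+gR. \<integral>\<^sup>+xR. \<Theta> (Q gR xR) \<partial>stdn R \<partial>stdn R)"
  proof -
    have QR: "Q (\<lambda>j\<in>R. g j) x = Q g x" "Q g (\<lambda>j\<in>R. x j) = Q g x" for g x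
      by (simp_all add: Q_def)
    note [measurable] = Qm[of R R, simplified]
    have "(\<integral>\<^sup>+x. H g x \<partial>stdn UNIV) = (\<integral>\<^sup>+xR. \<integral>\<^sup>+x0. \<Phi> (A (g a0) x0) (Y * Q g xR) \<partial>?N \<partial>stdn R)" for g
    proof -
      have [measurable]: "(\<lambda>x. Q g x) \<in> borel_measurable (\<Pi>\<^sub>M i\<in>R. borel)"
        using measurable_compose[OF measurable_Pair1'[of g "\<Pi>\<^sub>M i\<in>UNIV. borel"] Qm[of UNIV R]] by (simp add: space_PiM)
      have "(\<integral>\<^sup>+x. H g x \<partial>stdn UNIV)
        = (\<integral>\<^sup>+x. (\<lambda>x0 xR. \<Phi> (A (g a0) x0) (Y * Q g xR)) (x a0) (\<lambda>j\<in>UNIV - {a0}. x j) \<partial>stdn UNIV)"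
        by (simp add: H_def QR R_def[symmetric])
      also have "\<dots> = (\<integral>\<^sup>+xR. \<integral>\<^sup>+x0. \<Phi> (A (g a0) x0) (Y * Q g xR) \<partial>?N \<partial>stdn (UNIV - {a0}))"
        by (rule nn_integral_stdn_split_one) (auto simp: R_def[symmetric])
      finally show ?thesis by (simp add: R_def)
    qed
    then have "(\<integral>\<^sup>+g. \<integral>\<^sup>+x. H g x \<partial>stdn UNIV \<partial>stdn UNIV)
      = (\<integral>\<^sup>+g. (\<lambda>g0 gR. \<integral>\<^sup>+xR. \<integral>\<^sup>+x0. \<Phi> (A g0 x0) (Y * Q gR xR) \<partial>?N \<partial>stdn R) (g a0) (\<lambda>j\<in>UNIV - {a0}. g j) \<partial>stdn UNIV)"
      by (simp add: QR R_def[symmetric])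
    also have "\<dots> = (\<integral>\<^sup>+gR. \<integral>\<^sup>+g0. \<integral>\<^sup>+xR. \<integral>\<^sup>+x0. \<Phi> (A g0 x0) (Y * Q gR xR) \<partial>?N \<partial>stdn R \<partial>?N \<partial>stdn (UNIV - {a0}))"
      by (rule nn_integral_stdn_split_one) (simp_all add: R_def[symmetric])
    also have "\<dots> = (\<integral>\<^sup>+gR. \<integral>\<^sup>+xR. \<integral>\<^sup>+g0. \<integral>\<^sup>+x0. \<Phi> (A g0 x0) (Y * Q gR xR) \<partial>?N \<partial>?N \<partial>stdn R \<partial>stdn R)"
      unfolding R_def[symmetric]
    proof (intro nn_integral_cong nn_integral_swap sigma_finite_std_normal sigma_finite_stdn)
      fix gR assume "gR \<in> space (stdn R)"
      then have [measurable]: "(\<lambda>x. Q gR x) \<in> borel_measurable (\<Pi>\<^sub>M i\<in>R. borel)"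
        using measurable_compose[OF measurable_Pair1'[of gR "\<Pi>\<^sub>M i\<in>R. borel"] Qm[of R R]] by simp
      show "(\<lambda>(g0, xR). \<integral>\<^sup>+x0. \<Phi> (A g0 x0) (Y * Q gR xR) \<partial>?N) \<in> borel_measurable (?N \<Otimes>\<^sub>M stdn R)"
        by measurable
    qed
    also have "\<dots> = (\<integral>\<^sup>+gR. \<integral>\<^sup>+xR. \<Theta> (Q gR xR) \<partial>stdn R \<partial>stdn R)"
      by (intro nn_integral_cong normals) (simp add: Q_def sum_nonneg)
    finally show ?thesis .
  qed
  \<comment> \<open>Given \<open>gR\<close>, the vector in \<open>Q\<close> is normal with a shifted
    mean. The squared length of the shift is \<open>1 / N\<close> times the squared norm of another
    shifted normal vector, whose law is taken in the next step.\<close>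
  also have "\<dots> = (\<integral>\<^sup>+gR. \<integral>\<^sup>+\<zeta>. \<Theta> \<zeta> \<partial>noncentral_chi_squared (CARD('p) - 1)
      ((\<Sum>a\<in>R. (gR a + - (sqrt N * \<nu> * dot UNIV d (e a)))\<^sup>2) / N) \<partial>stdn R)"
  proof (rule nn_integral_cong)
    fix gR :: "'p \<Rightarrow> real"
    have "(\<Sum>a\<in>R. (\<nu> * dot UNIV d (e a) - gR a * (1 / sqrt N))\<^sup>2)
      = (\<Sum>a\<in>R. (gR a + - (sqrt N * \<nu> * dot UNIV d (e a)))\<^sup>2) / N"
      unfolding sum_divide_distrib
    proof (intro sum.cong refl)
      fix a
      have "\<nu> * dot UNIV d (e a) - gR a * (1 / sqrt N) = - (gR a + - (sqrt N * \<nu> * dot UNIV d (e a))) / sqrt N"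
        using N by (simp add: field_simps)
      then show "(\<nu> * dot UNIV d (e a) - gR a * (1 / sqrt N))\<^sup>2 = (gR a + - (sqrt N * \<nu> * dot UNIV d (e a)))\<^sup>2 / N"
        using N by (simp only: power_divide power2_minus) simp
    qed
    then show "(\<integral>\<^sup>+xR. \<Theta> (Q gR xR) \<partial>stdn R) = (\<integral>\<^sup>+\<zeta>. \<Theta> \<zeta> \<partial>noncentral_chi_squared (CARD('p) - 1)
      ((\<Sum>a\<in>R. (gR a + - (sqrt N * \<nu> * dot UNIV d (e a)))\<^sup>2) / N))"
      unfolding Q_def by (subst nn_integral_stdn_noncentral_chi_squared) (auto simp: cR)
  qed
  also have "\<dots> = (\<integral>\<^sup>+r. \<integral>\<^sup>+\<zeta>. \<Theta> \<zeta> \<partial>noncentral_chi_squared (CARD('p) - 1) (r / N)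
      \<partial>noncentral_chi_squared (card R) (\<Sum>a\<in>R. (- (sqrt N * \<nu> * dot UNIV d (e a)))\<^sup>2))"
  proof (rule nn_integral_stdn_noncentral_chi_squared)
    have [measurable]: "(\<lambda>r. noncentral_chi_squared (CARD('p) - 1) (r / N)) \<in> measurable borel (subprob_algebra borel)"
      by (rule measurable_prob_algebraD) measurable
    show "(\<lambda>r. \<integral>\<^sup>+\<zeta>. \<Theta> \<zeta> \<partial>noncentral_chi_squared (CARD('p) - 1) (r / N)) \<in> borel_measurable borel"
      by (rule nn_integral_measurable_subprob_algebra2[where N = borel]) measurable
  qed simp
  also have "(\<Sum>a\<in>R. (- (sqrt N * \<nu> * dot UNIV d (e a)))\<^sup>2) = N * \<nu>\<^sup>2 * (Y - (y a0)\<^sup>2) / Y"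
  proof -
    have "(\<Sum>a\<in>R. (- (sqrt N * \<nu> * dot UNIV d (e a)))\<^sup>2) = N * \<nu>\<^sup>2 * (\<Sum>a\<in>R. (dot UNIV d (e a))\<^sup>2)"
      using N by (simp add: power_mult_distrib sum_distrib_left)
    then show ?thesis by (simp add: dR)
  qed
  finally show ?thesis unfolding \<Theta>_def cR .
qed

section \<open>Integrals along conditional distributions\<close>

text \<open>The conditional distribution prescribes the joint law on rectangles. These generate the
  product sigma-algebra, so the joint law is the law of \<open>Y\<close> composed with the
  kernel.\<close>

lemma cond_distributed_nn_integral:
  assumes M: "prob_space M" and c: "cond_distributed M T Y S X K"
    and f: "(\<lambda>(y, x). f y x) \<in> borel_measurable (T \<Otimes>\<^sub>M S)"
  shows "(\<integral>\<^sup>+\<omega>. f (Y \<omega>) (X \<omega>) \<partial>M) = (\<integral>\<^sup>+\<omega>. \<integral>\<^sup>+x. f (Y \<omega>) x \<partial>K (Y \<omega>) \<partial>M)"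
proof -
  interpret prob_space M by fact
  note [measurable] = f
  have [measurable]: "Y \<in> measurable M T" "X \<in> measurable M S" and K': "K \<in> measurable T (prob_algebra S)"
    and eq: "\<And>A B. A \<in> sets S \<Longrightarrow> B \<in> sets T \<Longrightarrow> emeasure M {\<omega> \<in> space M. X \<omega> \<in> A \<and> Y \<omega> \<in> B} =
        (\<integral>\<^sup>+\<omega>. emeasure (K (Y \<omega>)) A * indicator B (Y \<omega>) \<partial>M)"
    using c unfolding cond_distributed_def by blast+
  have K [measurable]: "K \<in> measurable T (subprob_algebra S)"
    using K' by (rule measurable_prob_algebraD)
  have sK: "sets (K y) = sets S" if "y \<in> space T" for y
    using measurable_space[OF K that] by (simp add: space_subprob_algebra)
  have Ysp: "Y \<omega> \<in> space T" if "\<omega> \<in> space M" for \<omega>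
    using measurable_space[of Y M T \<omega>] that by simp
  define \<kappa> where "\<kappa> = (\<lambda>y. distr (K y) (T \<Otimes>\<^sub>M S) (Pair y))"
  have \<kappa> [measurable]: "\<kappa> \<in> measurable T (subprob_algebra (T \<Otimes>\<^sub>M S))"
    unfolding \<kappa>_def by (rule measurable_distr2[where M = S]) (use K in auto)
  define \<mu> where "\<mu> = distr M (T \<Otimes>\<^sub>M S) (\<lambda>\<omega>. (Y \<omega>, X \<omega>))"
  define \<mu>' where "\<mu>' = distr M T Y \<bind> \<kappa>"
  have ne: "space (distr M T Y) \<noteq> {}" using not_empty Ysp by auto
  have s': "sets \<mu>' = sets (T \<Otimes>\<^sub>M S)"
    unfolding \<mu>'_def using ne by (intro sets_bind) (use measurable_space[OF \<kappa>] in \<open>auto simp: space_subprob_algebra\<close>)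
  have int': "(\<integral>\<^sup>+z. g z \<partial>\<mu>') = (\<integral>\<^sup>+\<omega>. \<integral>\<^sup>+x. g (Y \<omega>, x) \<partial>K (Y \<omega>) \<partial>M)"
    if [measurable]: "g \<in> borel_measurable (T \<Otimes>\<^sub>M S)" for g
  proof -
    have [measurable]: "(\<lambda>y. \<integral>\<^sup>+z. g z \<partial>\<kappa> y) \<in> borel_measurable T"
      by (rule nn_integral_measurable_subprob_algebra2[where N = "T \<Otimes>\<^sub>M S"]) measurable
    have "(\<integral>\<^sup>+z. g z \<partial>\<mu>') = (\<integral>\<^sup>+y. \<integral>\<^sup>+z. g z \<partial>\<kappa> y \<partial>distr M T Y)"
      unfolding \<mu>'_def by (rule nn_integral_bind[where B = "T \<Otimes>\<^sub>M S"]) auto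
    also have "\<dots> = (\<integral>\<^sup>+\<omega>. \<integral>\<^sup>+z. g z \<partial>\<kappa> (Y \<omega>) \<partial>M)" by (rule nn_integral_distr) auto
    also have "\<dots> = (\<integral>\<^sup>+\<omega>. \<integral>\<^sup>+x. g (Y \<omega>, x) \<partial>K (Y \<omega>) \<partial>M)"
    proof (rule nn_integral_cong)
      fix \<omega> assume "\<omega> \<in> space M"
      then have y: "Y \<omega> \<in> space T" by (rule Ysp)
      have "Pair (Y \<omega>) \<in> measurable (K (Y \<omega>)) (T \<Otimes>\<^sub>M S)"
        using measurable_Pair1'[OF y, of S] by (simp cong: measurable_cong_sets add: sK[OF y])
      then show "(\<integral>\<^sup>+z. g z \<partial>\<kappa> (Y \<omega>)) = (\<integral>\<^sup>+x. g (Y \<omega>, x) \<partial>K (Y \<omega>))"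
        unfolding \<kappa>_def by (rule nn_integral_distr) simp
    qed
    finally show ?thesis .
  qed
  have "\<mu> = \<mu>'"
  proof (rule measure_eqI_generator_eq)
    let ?E = "{B \<times> A | B A. B \<in> sets T \<and> A \<in> sets S}"
    show "Int_stable ?E" by (rule Int_stable_pair_measure_generator)
    show "?E \<subseteq> Pow (space T \<times> space S)" by (auto dest: sets.sets_into_space)
    show "sets \<mu> = sigma_sets (space T \<times> space S) ?E" "sets \<mu>' = sigma_sets (space T \<times> space S) ?E"
      unfolding s' by (simp_all add: \<mu>_def sets_pair_measure)
    show "range (\<lambda>i::nat. space T \<times> space S) \<subseteq> ?E" by auto
    show "(\<Union>i::nat. space T \<times> space S) = space T \<times> space S" by simp
    show "emeasure \<mu> (space T \<times> space S) \<noteq> \<infinity>"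
    proof -
      interpret m: prob_space \<mu> unfolding \<mu>_def by (rule prob_space_distr) measurable
      show ?thesis by simp
    qed
    fix C assume "C \<in> ?E"
    then obtain B A where C: "C = B \<times> A" and [measurable]: "B \<in> sets T" "A \<in> sets S" by auto
    have "emeasure \<mu> C = emeasure M {\<omega> \<in> space M. X \<omega> \<in> A \<and> Y \<omega> \<in> B}"
      unfolding \<mu>_def C by (subst emeasure_distr) (auto intro!: arg_cong[where f = "emeasure M"])
    also have "\<dots> = (\<integral>\<^sup>+\<omega>. emeasure (K (Y \<omega>)) A * indicator B (Y \<omega>) \<partial>M)" by (rule eq) auto
    also have "\<dots> = (\<integral>\<^sup>+\<omega>. \<integral>\<^sup>+x. indicator C (Y \<omega>, x) \<partial>K (Y \<omega>) \<partial>M)"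
    proof (rule nn_integral_cong)
      fix \<omega> assume "\<omega> \<in> space M"
      then have [simp]: "A \<in> sets (K (Y \<omega>))" using sK[OF Ysp] by simp
      have "(\<integral>\<^sup>+x. indicator C (Y \<omega>, x) \<partial>K (Y \<omega>)) = (\<integral>\<^sup>+x. indicator B (Y \<omega>) * indicator A x \<partial>K (Y \<omega>))"
        by (intro nn_integral_cong) (auto simp: C split: split_indicator)
      then show "emeasure (K (Y \<omega>)) A * indicator B (Y \<omega>) = (\<integral>\<^sup>+x. indicator C (Y \<omega>, x) \<partial>K (Y \<omega>))"
        by (subst mult.commute) (simp add: nn_integral_cmult_indicator)
    qed
    also have "\<dots> = (\<integral>\<^sup>+z. indicator C z \<partial>\<mu>')"
      unfolding C by (rule int'[symmetric]) measurable
    also have "\<dots> = emeasure \<mu>' C"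
      by (rule nn_integral_indicator) (simp add: s' C)
    finally show "emeasure \<mu> C = emeasure \<mu>' C" .
  qed
  have "(\<integral>\<^sup>+\<omega>. f (Y \<omega>) (X \<omega>) \<partial>M) = (\<integral>\<^sup>+z. (\<lambda>(y, x). f y x) z \<partial>\<mu>)"
    unfolding \<mu>_def by (subst nn_integral_distr) auto
  also have "\<dots> = (\<integral>\<^sup>+\<omega>. \<integral>\<^sup>+x. f (Y \<omega>) x \<partial>K (Y \<omega>) \<partial>M)"
    unfolding \<open>\<mu> = \<mu>'\<close> by (subst int') auto
  finally show ?thesis .
qed

text \<open>Independence is recast as conditioning with a constant kernel, so that
  \<open>cond_distributed_nn_integral\<close> serves for all variables.\<close>

lemma (in prob_space) cond_distributed_const:
  assumes [measurable]: "Y \<in> measurable M T" "X \<in> measurable M S"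
    and ind: "\<And>A B. A \<in> sets S \<Longrightarrow> B \<in> sets T \<Longrightarrow>
      prob (X -` A \<inter> space M \<inter> (Y -` B \<inter> space M)) = prob (X -` A \<inter> space M) * prob (Y -` B \<inter> space M)"
  shows "cond_distributed M T Y S X (\<lambda>_. distr M S X)"
  unfolding cond_distributed_def
proof (intro conjI ballI)
  show "(\<lambda>_. distr M S X) \<in> measurable T (prob_algebra S)"
    by (rule measurable_const) (simp add: space_prob_algebra prob_space_distr)
  fix A B assume [measurable]: "A \<in> sets S" "B \<in> sets T"
  have "emeasure M {\<omega> \<in> space M. X \<omega> \<in> A \<and> Y \<omega> \<in> B} = emeasure M (X -` A \<inter> space M \<inter> (Y -` B \<inter> space M))"
    by (intro arg_cong[where f = "emeasure M"]) auto
  also have "\<dots> = emeasure M (X -` A \<inter> space M) * emeasure M (Y -` B \<inter> space M)"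
    by (simp add: emeasure_eq_measure ind ennreal_mult)
  also have "\<dots> = emeasure (distr M S X) A * (\<integral>\<^sup>+\<omega>. indicator (Y -` B \<inter> space M) \<omega> \<partial>M)"
    by (simp add: emeasure_distr)
  also have "\<dots> = (\<integral>\<^sup>+\<omega>. emeasure (distr M S X) A * indicator (Y -` B \<inter> space M) \<omega> \<partial>M)"
    by (rule nn_integral_cmult[symmetric]) measurable
  also have "\<dots> = (\<integral>\<^sup>+\<omega>. emeasure (distr M S X) A * indicator B (Y \<omega>) \<partial>M)"
    by (intro nn_integral_cong) (auto split: split_indicator)
  finally show "emeasure M {\<omega> \<in> space M. X \<omega> \<in> A \<and> Y \<omega> \<in> B} =
    (\<integral>\<^sup>+\<omega>. emeasure (distr M S X) A * indicator B (Y \<omega>) \<partial>M)" .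
qed measurable

text \<open>The second part regroups three independent sigma-algebras into the first and the one
  generated by the other two, for which the pair \<open>(X2, X3)\<close> is measurable.\<close>

lemma (in prob_space) indep_vars3_cond_distributed:
  assumes "indep_vars3 M1 X1 M2 X2 M3 X3"
  shows "cond_distributed M M3 X3 M2 X2 (\<lambda>_. distr M M2 X2)"
    and "cond_distributed M (M2 \<Otimes>\<^sub>M M3) (\<lambda>\<omega>. (X2 \<omega>, X3 \<omega>)) M1 X1 (\<lambda>_. distr M M1 X1)"
proof -
  define E where "E = (\<lambda>k. [sets (vimage_algebra (space M) X1 M1), sets (vimage_algebra (space M) X2 M2),
     sets (vimage_algebra (space M) X3 M3)] ! k)"
  have [measurable]: "X1 \<in> measurable M M1" "X2 \<in> measurable M M2" "X3 \<in> measurable M M3"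
    and ind: "indep_sets E {..<3}"
    using assms unfolding indep_vars3_def E_def by auto
  have E: "E 0 = sets (vimage_algebra (space M) X1 M1)" "E 1 = sets (vimage_algebra (space M) X2 M2)"
    "E 2 = sets (vimage_algebra (space M) X3 M3)" by (simp_all add: E_def)
  have in_E: "X1 -` A \<inter> space M \<in> E 0" if "A \<in> sets M1" for A
    using in_vimage_algebra[OF that, of X1 "space M"] unfolding E .
  have in_E1: "X2 -` A \<inter> space M \<in> E 1" if "A \<in> sets M2" for A
    using in_vimage_algebra[OF that, of X2 "space M"] unfolding E .
  have in_E2: "X3 -` A \<inter> space M \<in> E 2" if "A \<in> sets M3" for A
    using in_vimage_algebra[OF that, of X3 "space M"] unfolding E .
  show "cond_distributed M M3 X3 M2 X2 (\<lambda>_. distr M M2 X2)"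
  proof (rule cond_distributed_const)
    fix A B assume AB: "A \<in> sets M2" "B \<in> sets M3"
    have "prob (\<Inter>k\<in>{1, 2 :: nat}. (if k = 1 then X2 -` A \<inter> space M else X3 -` B \<inter> space M))
      = (\<Prod>k\<in>{1, 2 :: nat}. prob (if k = 1 then X2 -` A \<inter> space M else X3 -` B \<inter> space M))"
      by (rule indep_setsD[OF ind]) (use in_E1[OF AB(1)] in_E2[OF AB(2)] in auto)
    then show "prob (X2 -` A \<inter> space M \<inter> (X3 -` B \<inter> space M)) = prob (X2 -` A \<inter> space M) * prob (X3 -` B \<inter> space M)"
      by (simp add: Int_commute)
  qed measurable
  \<comment> \<open>\<open>True\<close> labels the group of the first variable, \<open>False\<close>
    that of the other two.\<close>
  define I where "I = (\<lambda>b. if b then {0::nat} else {1, 2})"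
  define G where "G = (\<lambda>b. sigma_sets (space M) (\<Union>i\<in>I b. E i))"
  have "indep_sets G UNIV"
    unfolding G_def
  proof (rule indep_sets_collect_sigma)
    have "(\<Union>b\<in>UNIV. I b) = {..<3}" by (auto simp: I_def UNIV_bool)
    then show "indep_sets E (\<Union>b\<in>UNIV. I b)" using ind by simp
    show "disjoint_family_on I UNIV" by (auto simp: disjoint_family_on_def I_def)
    fix i b assume "i \<in> I b"
    then consider "i = 0" | "i = 1" | "i = 2" by (auto simp: I_def split: if_splits)
    then show "Int_stable (E i)" by cases (auto simp: E(1,3) E(2)[simplified] Int_stable_def)
  qed
  have EM: "(\<Union>i\<in>I b. E i) \<subseteq> Pow (space M)" for b
    using sets.sets_into_space[of _ "vimage_algebra (space M) X1 M1"]
      sets.sets_into_space[of _ "vimage_algebra (space M) X2 M2"]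
      sets.sets_into_space[of _ "vimage_algebra (space M) X3 M3"]
    by (auto simp: I_def E(1,3) E(2)[simplified] split: if_splits)
  have m2: "X2 \<in> measurable (sigma (space M) (\<Union>i\<in>I False. E i)) M2"
    by (rule measurableI) (use EM[of False] in_E1 measurable_space[of X2 M M2] in \<open>auto simp: I_def space_measure_of_conv sets_measure_of\<close>)
  have m3: "X3 \<in> measurable (sigma (space M) (\<Union>i\<in>I False. E i)) M3"
    by (rule measurableI) (use EM[of False] in_E2 measurable_space[of X3 M M3] in \<open>auto simp: I_def space_measure_of_conv sets_measure_of\<close>)
  show "cond_distributed M (M2 \<Otimes>\<^sub>M M3) (\<lambda>\<omega>. (X2 \<omega>, X3 \<omega>)) M1 X1 (\<lambda>_. distr M M1 X1)"
  proof (rule cond_distributed_const)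
    fix A B assume AB: "A \<in> sets M1" "B \<in> sets (M2 \<Otimes>\<^sub>M M3)"
    let ?Y = "\<lambda>\<omega>. (X2 \<omega>, X3 \<omega>)"
    have 1: "X1 -` A \<inter> space M \<in> G True"
      using in_E[OF AB(1)] by (auto simp: G_def I_def)
    have 2: "?Y -` B \<inter> space M \<in> G False"
      using measurable_sets[OF measurable_Pair[OF m2 m3] AB(2)] EM[of False]
      by (simp add: G_def sets_measure_of space_measure_of_conv)
    have "prob (\<Inter>b\<in>UNIV. (if b then X1 -` A \<inter> space M else ?Y -` B \<inter> space M))
      = (\<Prod>b\<in>UNIV. prob (if b then X1 -` A \<inter> space M else ?Y -` B \<inter> space M))"
      by (rule indep_setsD[OF \<open>indep_sets G UNIV\<close>]) (use 1 2 in auto)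
    then show "prob (X1 -` A \<inter> space M \<inter> (?Y -` B \<inter> space M)) = prob (X1 -` A \<inter> space M) * prob (?Y -` B \<inter> space M)"
      by (simp add: UNIV_bool Int_commute mult.commute)
  qed measurable
qed

text \<open>The variables are removed one by one: the independent \<open>\<xi>\<close> and
  \<open>z0\<close>, then \<open>u\<close> given \<open>\<xi>1\<close>, \<open>\<xi>2\<close> and
  \<open>w0\<close>, then \<open>\<xi>1\<close> given \<open>\<xi>2\<close> and \<open>w0\<close>,
  and at last the independent pair. The nesting is the one reached from the side of the
  samples.\<close>

lemma nn_integral_representation:
  fixes N :: "'b measure" and \<xi> z0 u \<xi>1 \<xi>2 w0 :: "'b \<Rightarrow> real" and f :: "real \<Rightarrow> real \<Rightarrow> real \<Rightarrow> real \<Rightarrow> real \<Rightarrow> ennreal"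
    and \<nu> :: real
  assumes N: "prob_space N"
    and \<xi>: "distr N borel \<xi> = chi_squared d1"
    and \<xi>2: "\<xi>2 \<in> borel_measurable N" "distr N borel \<xi>2 = chi_squared d2"
    and z0: "distributed N lborel z0 std_normal_density"
    and w0: "distributed N lborel w0 std_normal_density"
    and ind2: "prob_space.indep_var N borel \<xi>2 borel w0"
    and c1: "cond_distributed N borel (\<lambda>\<omega>. (\<xi>2 \<omega>, w0 \<omega>)) borel \<xi>1 (\<lambda>(s, w). noncentral_chi_squared d2 (\<delta> s w))"
    and c2: "cond_distributed N borel (\<lambda>\<omega>. (\<xi>1 \<omega>, \<xi>2 \<omega>, w0 \<omega>)) borel u (\<lambda>(r, s, w). noncentral_F d2 d3 (r / \<nu>))"
    and ind3: "prob_space.indep_vars3 N borel \<xi> borel z0 borel (\<lambda>\<omega>. (u \<omega>, \<xi>1 \<omega>, \<xi>2 \<omega>, w0 \<omega>))"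
    and f: "(\<lambda>(x, z, u, s, w). f x z u s w) \<in> borel_measurable (borel \<Otimes>\<^sub>M borel \<Otimes>\<^sub>M borel \<Otimes>\<^sub>M borel \<Otimes>\<^sub>M borel)"
  shows "(\<integral>\<^sup>+\<omega>. f (\<xi> \<omega>) (z0 \<omega>) (u \<omega>) (\<xi>2 \<omega>) (w0 \<omega>) \<partial>N) =
    (\<integral>\<^sup>+s. \<integral>\<^sup>+w. \<integral>\<^sup>+r. \<integral>\<^sup>+u. \<integral>\<^sup>+z. \<integral>\<^sup>+x. f x z u s w
      \<partial>chi_squared d1 \<partial>std_normal_measure \<partial>noncentral_F d2 d3 (r / \<nu>)
      \<partial>noncentral_chi_squared d2 (\<delta> s w) \<partial>std_normal_measure \<partial>chi_squared d2)"
proof -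
  interpret prob_space N by fact
  interpret chi: sigma_finite_measure "chi_squared d1" by (rule sigma_finite_chi_squared)
  define fp where "fp = (\<lambda>(x, z, u, s, w). f x z u s w)"
  have [measurable]: "fp \<in> borel_measurable (borel \<Otimes>\<^sub>M borel \<Otimes>\<^sub>M borel \<Otimes>\<^sub>M borel \<Otimes>\<^sub>M borel)"
    unfolding fp_def by (rule f)
  have fp: "f x z u s w = fp (x, z, u, s, w)" for x z u s w by (simp add: fp_def)
  have dz: "distr N borel z0 = std_normal_measure"
    using distributed_distr_eq_density[OF z0] unfolding std_normal_measure_def
    by (metis distr_cong sets_lborel)
  have dw: "distr N borel w0 = std_normal_measure"
    using distributed_distr_eq_density[OF w0] unfolding std_normal_measure_def
    by (metis distr_cong sets_lborel)
  have [measurable]: "w0 \<in> borel_measurable N" using distributed_measurable[OF w0] by simp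
  define f3 where "f3 = (\<lambda>(u, s, w). \<integral>\<^sup>+z. \<integral>\<^sup>+x. fp (x, z, u, s, w) \<partial>chi_squared d1 \<partial>std_normal_measure)"
  have f3 [measurable]: "f3 \<in> borel_measurable (borel \<Otimes>\<^sub>M borel \<Otimes>\<^sub>M borel)"
    unfolding f3_def by measurable
  have K1: "(\<lambda>(s, w). noncentral_chi_squared d2 (\<delta> s w)) \<in> measurable (borel \<Otimes>\<^sub>M borel) (subprob_algebra borel)"
    using c1 unfolding cond_distributed_def borel_prod[symmetric] by (auto dest: measurable_prob_algebraD)
  have K2: "(\<lambda>r. noncentral_F d2 d3 (r / \<nu>)) \<in> measurable borel (subprob_algebra borel)"
    by (rule measurable_prob_algebraD) measurable
  define f2 where "f2 = (\<lambda>(r, s, w). \<integral>\<^sup>+u. f3 (u, s, w) \<partial>noncentral_F d2 d3 (r / \<nu>))"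
  have f2 [measurable]: "f2 \<in> borel_measurable (borel \<Otimes>\<^sub>M borel \<Otimes>\<^sub>M borel)"
    unfolding f2_def case_prod_unfold
    by (rule nn_integral_measurable_subprob_algebra2[where N = borel])
       (measurable, rule measurable_compose[OF measurable_fst K2])
  define f1 where "f1 = (\<lambda>s w. \<integral>\<^sup>+r. f2 (r, s, w) \<partial>noncentral_chi_squared d2 (\<delta> s w))"
  have f1 [measurable]: "(\<lambda>(s, w). f1 s w) \<in> borel_measurable (borel \<Otimes>\<^sub>M borel)"
    unfolding f1_def case_prod_unfold
    by (rule nn_integral_measurable_subprob_algebra2[where N = borel])
       (measurable, use K1 in \<open>simp add: case_prod_unfold\<close>)
  have "(\<integral>\<^sup>+\<omega>. fp (\<xi> \<omega>, z0 \<omega>, u \<omega>, \<xi>2 \<omega>, w0 \<omega>) \<partial>N)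
    = (\<integral>\<^sup>+\<omega>. (\<lambda>(z, u, r, s, w) x. fp (x, z, u, s, w)) (z0 \<omega>, u \<omega>, \<xi>1 \<omega>, \<xi>2 \<omega>, w0 \<omega>) (\<xi> \<omega>) \<partial>N)" by simp
  also have "\<dots> = (\<integral>\<^sup>+\<omega>. \<integral>\<^sup>+x. fp (x, z0 \<omega>, u \<omega>, \<xi>2 \<omega>, w0 \<omega>) \<partial>chi_squared d1 \<partial>N)"
    by (subst cond_distributed_nn_integral[OF N indep_vars3_cond_distributed(2)[OF ind3]])
       (simp_all add: \<xi> borel_prod[symmetric] case_prod_unfold)
  also have "\<dots> = (\<integral>\<^sup>+\<omega>. (\<lambda>(u, r, s, w) z. \<integral>\<^sup>+x. fp (x, z, u, s, w) \<partial>chi_squared d1) (u \<omega>, \<xi>1 \<omega>, \<xi>2 \<omega>, w0 \<omega>) (z0 \<omega>) \<partial>N)" by simp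
  also have "\<dots> = (\<integral>\<^sup>+\<omega>. f3 (u \<omega>, \<xi>2 \<omega>, w0 \<omega>) \<partial>N)"
    by (subst cond_distributed_nn_integral[OF N indep_vars3_cond_distributed(1)[OF ind3]])
       (simp_all add: dz f3_def borel_prod[symmetric] case_prod_unfold)
  also have "\<dots> = (\<integral>\<^sup>+\<omega>. (\<lambda>(r, s, w) u. f3 (u, s, w)) (\<xi>1 \<omega>, \<xi>2 \<omega>, w0 \<omega>) (u \<omega>) \<partial>N)" by simp
  also have "\<dots> = (\<integral>\<^sup>+\<omega>. f2 (\<xi>1 \<omega>, \<xi>2 \<omega>, w0 \<omega>) \<partial>N)"
    by (subst cond_distributed_nn_integral[OF N c2])
       (simp_all add: f2_def borel_prod[symmetric] case_prod_unfold)
  also have "\<dots> = (\<integral>\<^sup>+\<omega>. (\<lambda>(s, w) r. f2 (r, s, w)) (\<xi>2 \<omega>, w0 \<omega>) (\<xi>1 \<omega>) \<partial>N)" by simp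
  also have "\<dots> = (\<integral>\<^sup>+\<omega>. f1 (\<xi>2 \<omega>) (w0 \<omega>) \<partial>N)"
    by (subst cond_distributed_nn_integral[OF N c1])
       (simp_all add: f1_def borel_prod[symmetric] case_prod_unfold)
  also have "\<dots> = (\<integral>\<^sup>+x. (\<lambda>(s, w). f1 s w) x \<partial>distr N (borel \<Otimes>\<^sub>M borel) (\<lambda>\<omega>. (\<xi>2 \<omega>, w0 \<omega>)))"
    using \<xi>2 by (subst nn_integral_distr) auto
  also have "distr N (borel \<Otimes>\<^sub>M borel) (\<lambda>\<omega>. (\<xi>2 \<omega>, w0 \<omega>)) = chi_squared d2 \<Otimes>\<^sub>M std_normal_measure"
    using ind2 \<xi>2(2) dw by (simp add: indep_var_distribution_eq)
  also have "(\<integral>\<^sup>+x. (\<lambda>(s, w). f1 s w) x \<partial>(chi_squared d2 \<Otimes>\<^sub>M std_normal_measure))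
    = (\<integral>\<^sup>+s. \<integral>\<^sup>+w. f1 s w \<partial>std_normal_measure \<partial>chi_squared d2)"
    by (subst sigma_finite_measure.nn_integral_fst[OF sigma_finite_std_normal, symmetric]) auto
  finally show ?thesis unfolding fp f1_def f2_def f3_def by simp
qed

section \<open>Gaussian samples in coordinates\<close>

lemma matrix_inv_inverse:
  fixes A :: "real^'n^'n"
  assumes "invertible A"
  shows "A ** matrix_inv A = mat 1" "matrix_inv A ** A = mat 1"
  using someI_ex[OF assms[unfolded invertible_def]] unfolding matrix_inv_def by auto

lemma symmetric_matrix_inner:
  fixes A :: "real^'n^'n"
  assumes "transpose A = A"
  shows "(A *v x) \<bullet> y = x \<bullet> (A *v y)"
  by (metis assms dot_lmul_matrix transpose_matrix_vector)

text \<open>By Cramer's rule each entry is a quotient of determinants, hence of polynomials in the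
  entries, where the matrix is invertible.\<close>

lemma measurable_matrix_inv:
  fixes A :: "'a \<Rightarrow> real^'n^'n"
  assumes A [measurable]: "\<And>i j. (\<lambda>\<omega>. A \<omega> $ i $ j) \<in> borel_measurable M"
  shows "(\<lambda>\<omega>. matrix_inv (A \<omega>) $ i $ k) \<in> borel_measurable M"
proof -
  have m: "(\<lambda>\<omega>. det (\<chi> i j. B \<omega> i j)) \<in> borel_measurable M"
    if "\<And>i j. (\<lambda>\<omega>. B \<omega> i j) \<in> borel_measurable M" for B :: "'a \<Rightarrow> 'n \<Rightarrow> 'n \<Rightarrow> real"
    unfolding det_def using that
    by (intro borel_measurable_sum borel_measurable_times borel_measurable_prod borel_measurable_const) simp
  have [measurable]: "(\<lambda>\<omega>. det (A \<omega>)) \<in> borel_measurable M"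
    using m[of "\<lambda>\<omega> i j. A \<omega> $ i $ j"] by simp
  have [measurable]: "(\<lambda>\<omega>. det (\<chi> l j. if j = i then axis k 1 $ l else A \<omega> $ l $ j)) \<in> borel_measurable M"
    by (rule m) measurable
  \<comment> \<open>\<open>matrix_inv\<close> maps all singular matrices to the same matrix.\<close>
  have inv: "matrix_inv (A \<omega>) $ i $ k = (if det (A \<omega>) \<noteq> 0
     then det (\<chi> l j. if j = i then axis k 1 $ l else A \<omega> $ l $ j) / det (A \<omega>)
     else (SOME B :: real^'n^'n. False) $ i $ k)" for \<omega>
  proof (cases "det (A \<omega>) = 0")
    case True
    then have "(\<lambda>B. A \<omega> ** B = mat 1 \<and> B ** A \<omega> = mat 1) = (\<lambda>B. False)"
      using invertible_det_nz[of "A \<omega>"] unfolding invertible_def by blast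
    then have "matrix_inv (A \<omega>) = (SOME B. False)" unfolding matrix_inv_def by (rule arg_cong)
    then show ?thesis using True by simp
  next
    case False
    then have "invertible (A \<omega>)" by (simp add: invertible_det_nz)
    then have "A \<omega> *v (matrix_inv (A \<omega>) *v axis k 1) = axis k 1"
      by (simp add: matrix_vector_mul_assoc matrix_inv_inverse)
    then have "matrix_inv (A \<omega>) *v axis k 1
      = (\<chi> i. det (\<chi> l j. if j = i then axis k 1 $ l else A \<omega> $ l $ j) / det (A \<omega>))"
      using cramer[OF False] by blast
    then have "(matrix_inv (A \<omega>) *v axis k 1) $ i
      = det (\<chi> l j. if j = i then axis k 1 $ l else A \<omega> $ l $ j) / det (A \<omega>)" by simp
    then show ?thesis using False by (simp add: matrix_vector_mult_basis column_def)
  qed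
  show ?thesis unfolding inv by measurable
qed

section \<open>Gaussian vectors in standard normal coordinates\<close>

lemma pos_def_matrix_inv:
  fixes \<Sigma> :: "real^'p^'p"
  assumes "pos_def_matrix \<Sigma>"
  shows "invertible \<Sigma>" and "pos_def_matrix (matrix_inv \<Sigma>)"
proof -
  have sym: "transpose \<Sigma> = \<Sigma>" and pos: "\<And>v. v \<noteq> 0 \<Longrightarrow> v \<bullet> (\<Sigma> *v v) > 0"
    using assms unfolding pos_def_matrix_def by auto
  have "\<forall>v. \<Sigma> *v v = 0 \<longrightarrow> v = 0" using pos by (metis inner_zero_right less_irrefl)
  then show inv: "invertible \<Sigma>"
    unfolding invertible_left_inverse matrix_left_invertible_ker .
  note I = matrix_inv_inverse[OF inv]
  have S: "\<Sigma> *v (matrix_inv \<Sigma> *v v) = v" for v by (simp add: matrix_vector_mul_assoc I)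
  show "pos_def_matrix (matrix_inv \<Sigma>)"
    unfolding pos_def_matrix_def
  proof (intro conjI allI impI)
    have "transpose (matrix_inv \<Sigma>) ** \<Sigma> = mat 1"
      using arg_cong[OF I(1), of transpose] by (simp add: matrix_transpose_mul sym transpose_mat)
    then have "transpose (matrix_inv \<Sigma>) ** (\<Sigma> ** matrix_inv \<Sigma>) = matrix_inv \<Sigma>"
      by (simp add: matrix_mul_assoc)
    then show "transpose (matrix_inv \<Sigma>) = matrix_inv \<Sigma>" by (simp add: I)
    fix v :: "real^'p" assume v: "v \<noteq> 0"
    then have "matrix_inv \<Sigma> *v v \<noteq> 0" using S[of v] by auto
    from pos[OF this] show "v \<bullet> (matrix_inv \<Sigma> *v v) > 0" by (simp add: S inner_commute)
  qed
qed

text \<open>For \<open>A\<close> the inverse covariance these are the coordinates in which a centred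
  Gaussian vector becomes standard normal, turned so that the mean difference
  \<open>\<delta>\<close> lives in the single coordinate \<open>a0\<close>.\<close>

lemma pos_def_orthonormal_basis:
  fixes A :: "real^'p^'p" and \<delta> :: "real^'p" and a0 :: 'p
  assumes A: "pos_def_matrix A" and p: "2 \<le> CARD('p)"
  obtains b :: "'p \<Rightarrow> real^'p" where
    "\<And>a a'. b a \<bullet> (A *v b a') = (if a = a' then 1 else 0)"
    "\<And>v. v = (\<Sum>a\<in>UNIV. (v \<bullet> (A *v b a)) *\<^sub>R b a)"
    "\<And>v. v \<bullet> (A *v v) = (\<Sum>a\<in>UNIV. (v \<bullet> (A *v b a))\<^sup>2)"
    "\<And>a. a \<noteq> a0 \<Longrightarrow> \<delta> \<bullet> (A *v b a) = 0"
    "\<delta> \<bullet> (A *v b a0) = sqrt (\<delta> \<bullet> (A *v \<delta>))"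
proof -
  have sym: "transpose A = A" and pos: "\<And>v. v \<noteq> 0 \<Longrightarrow> v \<bullet> (A *v v) > 0"
    using A unfolding pos_def_matrix_def by auto
  define B where "B = (\<lambda>u v. (\<chi> i. u i) \<bullet> (A *v (\<chi> i. v i)))"
  have fip: "finite_ip (UNIV :: 'p set) B"
  proof
    fix u u' w :: "'p \<Rightarrow> real" assume "\<And>i. i \<in> UNIV \<Longrightarrow> u i = u' i"
    then have "u = u'" by auto
    then show "B u w = B u' w" by simp
  next
    fix u v w :: "'p \<Rightarrow> real" and c
    have "(\<chi> i. c * u i + v i) = c *\<^sub>R (\<chi> i. u i) + (\<chi> i. v i)" by (simp add: vec_eq_iff)
    then show "B (\<lambda>i. c * u i + v i) w = c * B u w + B v w" by (simp add: B_def inner_add_left)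
  next
    fix u v show "B u v = B v u"
      unfolding B_def by (metis inner_commute symmetric_matrix_inner[OF sym])
  next
    fix i and v :: "'p \<Rightarrow> real" assume "v i \<noteq> 0"
    then have "(\<chi> i. v i) \<noteq> 0" by (metis vec_lambda_beta zero_index)
    then show "B v v > 0" unfolding B_def by (rule pos)
  qed simp
  interpret finite_ip UNIV B by (rule fip)
  have "\<not> card (UNIV :: 'p set) \<le> Suc 0" using p by simp
  then obtain a1 :: 'p where ne: "a0 \<noteq> a1"
    using card_le_Suc0_iff_eq[of "UNIV :: 'p set"] by (metis finite)
  obtain e where o: "orthonormal e UNIV" and
    ed: "\<And>k. k \<noteq> a0 \<Longrightarrow> B (\<lambda>i. \<delta> $ i) (e k) = 0" "B (\<lambda>i. \<delta> $ i) (e a0) \<ge> 0"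
    by (rule qr_two[OF finite refl UNIV_I UNIV_I ne, of "\<lambda>i. \<delta> $ i" "\<lambda>i. \<delta> $ i"]) (rule that; simp)
  have U: "finite (UNIV :: 'p set)" "card (UNIV :: 'p set) = card (UNIV :: 'p set)" by auto
  define b where "b = (\<lambda>a. \<chi> i. e a i)"
  have Bv: "B (\<lambda>i. v $ i) (e a) = v \<bullet> (A *v b a)" for v a by (simp add: B_def b_def)
  have Bvw: "B (\<lambda>i. v $ i) (\<lambda>i. w $ i) = v \<bullet> (A *v w)" for v w by (simp add: B_def)
  have par: "v \<bullet> (A *v v) = (\<Sum>a\<in>UNIV. (v \<bullet> (A *v b a))\<^sup>2)" for v
    using parseval[OF U o, of "\<lambda>i. v $ i" "\<lambda>i. v $ i"] by (simp add: Bv Bvw power2_eq_square)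
  show ?thesis
  proof (rule that)
    show "b a \<bullet> (A *v b a') = (if a = a' then 1 else 0)" for a a'
      using o unfolding orthonormal_def by (simp add: B_def b_def)
    show "v = (\<Sum>a\<in>UNIV. (v \<bullet> (A *v b a)) *\<^sub>R b a)" for v
      unfolding vec_eq_iff using expand[OF U o UNIV_I, of "\<lambda>i. v $ i"] by (auto simp: Bv b_def)
    show "v \<bullet> (A *v v) = (\<Sum>a\<in>UNIV. (v \<bullet> (A *v b a))\<^sup>2)" for v by (rule par)
    show *: "\<delta> \<bullet> (A *v b a) = 0" if "a \<noteq> a0" for a using ed(1)[OF that] by (simp add: Bv)
    have "\<delta> \<bullet> (A *v \<delta>) = (\<Sum>a\<in>UNIV. if a = a0 then (\<delta> \<bullet> (A *v b a))\<^sup>2 else 0)"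
      unfolding par by (intro sum.cong) (auto simp: *)
    then show "\<delta> \<bullet> (A *v b a0) = sqrt (\<delta> \<bullet> (A *v \<delta>))"
      using ed(2) by (simp add: Bv)
  qed
qed

text \<open>The exponent of the density is a sum of squares of the coordinates, and every shift of
  the coordinates is a translation of the vector, so \<open>distr_density_std_normal\<close>
  applies. The normalizing constant, and with it the determinant of \<open>\<Sigma>\<close>, is
  never evaluated.\<close>

lemma distr_mvn_coordinates:
  fixes \<Sigma> :: "real^'p^'p" and b :: "'p \<Rightarrow> real^'p"
  assumes M: "prob_space M" and X: "distributed M lborel X (mvn_density \<mu> \<Sigma>)"
    and b1: "\<And>a a'. b a \<bullet> (matrix_inv \<Sigma> *v b a') = (if a = a' then 1 else 0)"
    and b2: "\<And>v. v \<bullet> (matrix_inv \<Sigma> *v v) = (\<Sum>a\<in>UNIV. (v \<bullet> (matrix_inv \<Sigma> *v b a))\<^sup>2)"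
  shows "distr M (\<Pi>\<^sub>M a\<in>UNIV. borel) (\<lambda>\<omega>. \<lambda>a\<in>UNIV. (X \<omega> - \<mu>) \<bullet> (matrix_inv \<Sigma> *v b a)) = stdn UNIV"
proof -
  interpret prob_space M by fact
  define T where "T = (\<lambda>x. \<lambda>a\<in>UNIV. (x - \<mu>) \<bullet> (matrix_inv \<Sigma> *v b a))"
  define C where "C = 1 / sqrt ((2 * pi) ^ CARD('p) * det \<Sigma>)"
  have D: "mvn_density \<mu> \<Sigma> x = C * exp (- (\<Sum>a\<in>UNIV. (T x a)\<^sup>2) / 2)" for x
    by (simp add: mvn_density_def C_def b2[of "x - \<mu>"] T_def)
  have Xm: "X \<in> measurable M lborel" by (rule distributed_measurable[OF X])
  then have [measurable]: "X \<in> borel_measurable M" by simp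
  have dX: "distr M lborel X = density lborel (\<lambda>x. ennreal (mvn_density \<mu> \<Sigma> x))"
    by (rule distributed_distr_eq_density[OF X])
  have [measurable]: "T \<in> measurable borel (\<Pi>\<^sub>M a\<in>UNIV. borel)"
    unfolding T_def by measurable
  have P: "prob_space (density lborel (\<lambda>x. ennreal (mvn_density \<mu> \<Sigma> x)))"
    unfolding dX[symmetric] by (rule prob_space_distr) measurable
  \<comment> \<open>\<open>sqrt\<close> is negative on negative numbers, but then the density would vanish.\<close>
  have "C \<ge> 0"
  proof (rule ccontr)
    assume "\<not> C \<ge> 0"
    then have "ennreal (mvn_density \<mu> \<Sigma> x) = 0" for x
      unfolding D by (intro ennreal_neg mult_nonpos_nonneg) auto
    then have "emeasure (density lborel (\<lambda>x. ennreal (mvn_density \<mu> \<Sigma> x))) UNIV = 0"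
      by (subst emeasure_density) auto
    then show False using prob_space.emeasure_space_1[OF P] by simp
  qed
  have "stdn UNIV = distr (density lborel (\<lambda>x. ennreal (mvn_density \<mu> \<Sigma> x))) (\<Pi>\<^sub>M a\<in>UNIV. borel) T"
  proof (rule distr_density_std_normal[symmetric])
    show "sigma_finite_measure (lborel :: (real^'p) measure)" ..
    show "mvn_density \<mu> \<Sigma> x = C * exp (- (\<Sum>a\<in>UNIV. (T x a)\<^sup>2) / 2)" for x by (rule D)
    show "mvn_density \<mu> \<Sigma> \<in> borel_measurable lborel"
      unfolding D by (simp add: T_def)
  next
    fix y :: "'p \<Rightarrow> real"
    define v where "v = (\<Sum>a\<in>UNIV. y a *\<^sub>R b a)"
    have "v \<bullet> (matrix_inv \<Sigma> *v b a) = (\<Sum>k\<in>UNIV. y k * (if k = a then 1 else 0))" for a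
      by (simp add: v_def inner_sum_left b1)
    then have v: "v \<bullet> (matrix_inv \<Sigma> *v b a) = y a" for a by (simp add: if_distrib[of "(*) _"] cong: if_cong)
    have "distr lborel lborel ((+) v) = lborel"
      using lborel_distr_plus[of v] by (metis distr_cong sets_lborel)
    moreover have "T (v + x) a = T x a + y a" for x a
      by (simp add: T_def v[symmetric] inner_simps)
    ultimately show "\<exists>s\<in>measurable lborel lborel. distr lborel lborel s = lborel \<and>
      (\<forall>x\<in>space lborel. \<forall>a\<in>UNIV. T (s x) a = T x a + y a)"
      by (intro bexI[of _ "(+) v"]) auto
  qed (use P \<open>C \<ge> 0\<close> in auto)
  also have "\<dots> = distr M (\<Pi>\<^sub>M a\<in>UNIV. borel) (\<lambda>\<omega>. T (X \<omega>))"
    unfolding dX[symmetric] using Xm by (subst distr_distr) (auto simp: comp_def)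
  finally show ?thesis by (simp add: T_def)
qed

lemma (in prob_space) distr_iid_coordinates:
  fixes \<zeta> :: "'k \<Rightarrow> 'a \<Rightarrow> 'p::finite \<Rightarrow> real"
  assumes K: "finite K" "K \<noteq> {}" and ind: "indep_vars (\<lambda>_. \<Pi>\<^sub>M a\<in>UNIV. borel) \<zeta> K"
    and std: "\<And>k. k \<in> K \<Longrightarrow> distr M (\<Pi>\<^sub>M a\<in>UNIV. borel) (\<zeta> k) = stdn UNIV"
  shows "distr M (\<Pi>\<^sub>M i\<in>K \<times> UNIV. borel) (\<lambda>\<omega>. \<lambda>i\<in>K \<times> UNIV. \<zeta> (fst i) \<omega> (snd i)) = stdn (K \<times> UNIV)"
proof -
  let ?P = "(\<Pi>\<^sub>M a\<in>UNIV. borel) :: ('p \<Rightarrow> real) measure"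
  have rv [measurable]: "\<zeta> k \<in> measurable M ?P" if "k \<in> K" for k
    using ind that unfolding indep_vars_def by auto
  have fK: "finite (K \<times> (UNIV :: 'p set))" using K by simp
  have "distr M (\<Pi>\<^sub>M i\<in>K \<times> UNIV. borel) (\<lambda>\<omega>. \<lambda>i\<in>K \<times> UNIV. \<zeta> (fst i) \<omega> (snd i))
    = (\<Pi>\<^sub>M i\<in>K \<times> UNIV. std_normal_measure)"
  proof (rule sn.PiM_eqI[OF fK])
    show "sets (distr M (\<Pi>\<^sub>M i\<in>K \<times> UNIV. borel) (\<lambda>\<omega>. \<lambda>i\<in>K \<times> UNIV. \<zeta> (fst i) \<omega> (snd i)))
      = sets (\<Pi>\<^sub>M i\<in>K \<times> (UNIV :: 'p set). std_normal_measure)"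
      by (simp, intro sets_PiM_cong) auto
  next
    fix A :: "'k \<times> 'p \<Rightarrow> real set" assume "\<And>i. i \<in> K \<times> UNIV \<Longrightarrow> A i \<in> sets std_normal_measure"
    then have A: "A (k, a) \<in> sets borel" if "k \<in> K" for k a using that by auto
    define A' where "A' = (\<lambda>k. \<Pi>\<^sub>E a\<in>UNIV. A (k, a))"
    have A' : "A' k \<in> sets ?P" if "k \<in> K" for k
      unfolding A'_def using A[OF that] by (intro sets_PiM_I_finite) auto
    have m: "(\<lambda>\<omega>. \<lambda>i\<in>K \<times> UNIV. \<zeta> (fst i) \<omega> (snd i)) \<in> measurable M (\<Pi>\<^sub>M i\<in>K \<times> UNIV. borel)"
      by (intro measurable_restrict measurable_compose[OF rv measurable_component_singleton]) auto
    have "emeasure (distr M (\<Pi>\<^sub>M i\<in>K \<times> UNIV. borel) (\<lambda>\<omega>. \<lambda>i\<in>K \<times> UNIV. \<zeta> (fst i) \<omega> (snd i))) (Pi\<^sub>E (K \<times> UNIV) A)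
      = emeasure M ((\<lambda>\<omega>. \<lambda>i\<in>K \<times> UNIV. \<zeta> (fst i) \<omega> (snd i)) -` (Pi\<^sub>E (K \<times> UNIV) A) \<inter> space M)"
      using A fK by (intro emeasure_distr m sets_PiM_I_finite) auto
    also have "(\<lambda>\<omega>. \<lambda>i\<in>K \<times> UNIV. \<zeta> (fst i) \<omega> (snd i)) -` (Pi\<^sub>E (K \<times> UNIV) A) \<inter> space M
      = (\<Inter>k\<in>K. \<zeta> k -` A' k \<inter> space M)"
      using K(2) by (auto simp: A'_def PiE_iff)
    also have "emeasure M \<dots> = (\<Prod>k\<in>K. emeasure M (\<zeta> k -` A' k \<inter> space M))"
      using indep_varsD[OF ind K(2) K(1) subset_refl A'] by (simp add: emeasure_eq_measure prod_ennreal)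
    also have "\<dots> = (\<Prod>k\<in>K. \<Prod>a\<in>UNIV. emeasure std_normal_measure (A (k, a)))"
    proof (intro prod.cong refl)
      fix k assume k: "k \<in> K"
      have "emeasure M (\<zeta> k -` A' k \<inter> space M) = emeasure (stdn UNIV) (A' k)"
        unfolding std[OF k, symmetric] using rv[OF k] A'[OF k] by (simp add: emeasure_distr)
      also have "\<dots> = (\<Prod>a\<in>UNIV. emeasure std_normal_measure (A (k, a)))"
        unfolding stdn_def A'_def using A[OF k] by (intro sn.emeasure_PiM) auto
      finally show "emeasure M (\<zeta> k -` A' k \<inter> space M) = (\<Prod>a\<in>UNIV. emeasure std_normal_measure (A (k, a)))" .
    qed
    also have "\<dots> = (\<Prod>i\<in>K \<times> UNIV. emeasure std_normal_measure (A i))"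
      by (subst prod.cartesian_product) (simp add: case_prod_unfold)
    finally show "emeasure (distr M (\<Pi>\<^sub>M i\<in>K \<times> UNIV. borel) (\<lambda>\<omega>. \<lambda>i\<in>K \<times> UNIV. \<zeta> (fst i) \<omega> (snd i))) (Pi\<^sub>E (K \<times> UNIV) A)
      = (\<Prod>i\<in>K \<times> UNIV. emeasure std_normal_measure (A i))" .
  qed
  then show ?thesis by (simp add: stdn_def)
qed

text \<open>The orthogonal matrix \<open>u\<close> mixes observations and acts alike on every
  feature; on all coordinates together it is block diagonal, with \<open>u\<close> repeated for each
  feature.\<close>

lemma distr_stdn_combine_samples:
  fixes u :: "'j \<Rightarrow> 'k \<Rightarrow> real"
  assumes K: "finite K" and J: "finite J" "card J = card K" and o: "finite_ip.orthonormal (dot K) u J"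
  shows "distr (stdn (K \<times> UNIV)) (\<Pi>\<^sub>M i\<in>UNIV \<times> J. borel)
     (\<lambda>z. \<lambda>i\<in>UNIV \<times> J. \<Sum>k\<in>K. u (snd i) k * z (k, fst i)) = stdn ((UNIV :: 'p::finite set) \<times> J)"
proof -
  define E :: "'p \<times> 'j \<Rightarrow> 'k \<times> 'p \<Rightarrow> real" where "E = (\<lambda>(a, j) (k, a'). if a = a' then u j k else 0)"
  have fK: "finite (K \<times> (UNIV :: 'p set))" "finite ((UNIV :: 'p set) \<times> J)" using K J by auto
  interpret ip: finite_ip K "dot K" by (rule finite_ip_dot[OF K])
  interpret ipE: finite_ip "K \<times> (UNIV :: 'p set)" "dot (K \<times> UNIV)" by (rule finite_ip_dot[OF fK(1)])
  have dE: "dot (K \<times> UNIV) (E i) z = (\<Sum>k\<in>K. u (snd i) k * z (k, fst i))" for i z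
  proof -
    have "dot (K \<times> UNIV) (E i) z = (\<Sum>k\<in>K. \<Sum>a\<in>UNIV. if fst i = a then u (snd i) k * z (k, a) else 0)"
      unfolding dot_def E_def case_prod_unfold by (subst sum.cartesian_product) (auto intro!: sum.cong)
    then show ?thesis by simp
  qed
  have oE: "ipE.orthonormal E (UNIV \<times> J)"
    unfolding ipE.orthonormal_def dE
  proof (intro ballI)
    fix i i' assume "i \<in> (UNIV :: 'p set) \<times> J" "i' \<in> (UNIV :: 'p set) \<times> J"
    then obtain a j a' j' where i: "i = (a, j)" "i' = (a', j')" "j \<in> J" "j' \<in> J" by auto
    have "(\<Sum>k\<in>K. u (snd i) k * E i' (k, fst i)) = (if a' = a then dot K (u j) (u j') else 0)"
      by (simp add: i E_def dot_def)
    then show "(\<Sum>k\<in>K. u (snd i) k * E i' (k, fst i)) = (if i = i' then 1 else 0)"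
      using o i unfolding ip.orthonormal_def by auto
  qed
  have "card ((UNIV :: 'p set) \<times> J) = card (K \<times> (UNIV :: 'p set))" using J by (simp add: card_cartesian_product)
  from distr_stdn_orthonormal[OF fK this oE] show ?thesis unfolding dE .
qed

text \<open>The new column 0 shifts the others by one. Three applications separate the columns of
  the difference of the sample means, the grand mean and the new observation from those of the
  scatter matrix.\<close>

definition join :: "nat \<Rightarrow> ('p \<Rightarrow> real) \<Rightarrow> ('p \<times> nat \<Rightarrow> real) \<Rightarrow> 'p \<times> nat \<Rightarrow> real" where
  "join k y z = (\<lambda>i\<in>UNIV \<times> {..<Suc k}. if snd i = 0 then y (fst i) else z (fst i, snd i - 1))"

lemma measurable_join:
  "(\<lambda>(y, z). join k y z) \<in> measurable ((\<Pi>\<^sub>M a\<in>UNIV. borel) \<Otimes>\<^sub>M (\<Pi>\<^sub>M i\<in>UNIV \<times> {..<k}. borel))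
    (\<Pi>\<^sub>M i\<in>(UNIV :: 'p set) \<times> {..<Suc k}. (borel :: real measure))"
  unfolding join_def case_prod_unfold
proof (rule measurable_restrict)
  fix i :: "'p \<times> nat" assume i: "i \<in> UNIV \<times> {..<Suc k}"
  show "(\<lambda>p. if snd i = 0 then fst p (fst i) else snd p (fst i, snd i - 1)) \<in> borel_measurable
    ((\<Pi>\<^sub>M a\<in>UNIV. (borel :: real measure)) \<Otimes>\<^sub>M (\<Pi>\<^sub>M i\<in>UNIV \<times> {..<k}. borel))"
  proof (cases "snd i = 0")
    case True
    then show ?thesis
      by (simp add: measurable_compose[OF measurable_fst measurable_component_singleton])
  next
    case False
    then show ?thesis using i
      by (auto simp: mem_Times_iff intro!: measurable_compose[OF measurable_snd measurable_component_singleton])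
  qed
qed

lemma measurable_join_right:
  "(\<lambda>z. join k y z) \<in> measurable (\<Pi>\<^sub>M i\<in>UNIV \<times> {..<k}. borel) (\<Pi>\<^sub>M i\<in>(UNIV :: 'p set) \<times> {..<Suc k}. (borel :: real measure))"
  using measurable_compose[OF measurable_Pair1'[of y "\<Pi>\<^sub>M a\<in>UNIV. borel"] measurable_join[of k]]
  by (simp add: space_PiM)

lemma nn_integral_stdn_join:
  fixes f :: "('p::finite \<times> nat \<Rightarrow> real) \<Rightarrow> ennreal"
  assumes f: "f \<in> borel_measurable (\<Pi>\<^sub>M i\<in>UNIV \<times> {..<Suc k}. borel)"
  shows "(\<integral>\<^sup>+z. f z \<partial>stdn (UNIV \<times> {..<Suc k})) =
    (\<integral>\<^sup>+y. \<integral>\<^sup>+z. f (join k y z) \<partial>stdn (UNIV \<times> {..<k}) \<partial>stdn UNIV)"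
proof -
  have "(\<integral>\<^sup>+z. f z \<partial>stdn (UNIV \<times> {..<Suc k})) = (\<integral>\<^sup>+z. (\<lambda>y z. f (join k y z))
      (\<lambda>a\<in>UNIV. z (a, 0)) (\<lambda>i\<in>UNIV \<times> {..<k}. z (fst i, Suc (snd i))) \<partial>stdn (UNIV \<times> {..<Suc k}))"
  proof (intro nn_integral_cong arg_cong[where f = f])
    fix z :: "'p \<times> nat \<Rightarrow> real" assume "z \<in> space (stdn (UNIV \<times> {..<Suc k}))"
    then have "z \<in> extensional (UNIV \<times> {..<Suc k})" by (simp add: space_PiM PiE_def)
    then show "z = join k (\<lambda>a\<in>UNIV. z (a, 0)) (\<lambda>i\<in>UNIV \<times> {..<k}. z (fst i, Suc (snd i)))"
      by (auto simp: fun_eq_iff join_def extensional_def less_Suc_eq_0_disj)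
  qed
  also have "\<dots> = (\<integral>\<^sup>+y. \<integral>\<^sup>+z. f (join k y z) \<partial>stdn (UNIV \<times> {..<k}) \<partial>stdn UNIV)"
  proof (rule nn_integral_stdn_split)
    show "(\<lambda>(y, z). f (join k y z)) \<in> borel_measurable ((\<Pi>\<^sub>M a\<in>UNIV. borel) \<Otimes>\<^sub>M (\<Pi>\<^sub>M i\<in>UNIV \<times> {..<k}. borel))"
      using measurable_compose[OF measurable_join f] by (simp add: case_prod_unfold)
  qed (auto simp: inj_on_def)
  finally show ?thesis .
qed

section \<open>The discriminant in coordinates\<close>

text \<open>Let \<open>S\<close> be the scaled scatter matrix in the original feature space. The
  vector \<open>t\<close> determined by \<open>b a \<bullet> t = \<theta> a\<close> is such that
  \<open>S\<close> maps \<open>m\<close> times \<open>t\<close> to the first vector of the form. By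
  symmetry \<open>S\<close> moves to the other side and cancels its inverse, and only a pairing with
  \<open>t\<close> remains.\<close>

lemma discriminant_form_solution:
  fixes A :: "real^'p^'p" and b :: "'p \<Rightarrow> real^'p" and V :: "'p \<times> 'j \<Rightarrow> real" and m :: real
  assumes b1: "\<And>a a'. b a \<bullet> (A *v b a') = (if a = a' then 1 else 0)"
    and b2: "\<And>v. v = (\<Sum>a\<in>UNIV. (v \<bullet> (A *v b a)) *\<^sub>R b a)"
    and J: "finite J" and m: "m > 0"
    and l: "lin_indep_rows UNIV J V" and sol: "\<And>a. (\<Sum>b\<in>UNIV. gram J V a b * \<theta> b) = y a"
  defines "vj \<equiv> \<lambda>j. \<Sum>a\<in>UNIV. V (a, j) *\<^sub>R b a"
  shows "(\<Sum>a\<in>UNIV. y a *\<^sub>R b a) \<bullet>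
      (matrix_inv (\<chi> i k. (1 / m) * (\<Sum>j\<in>J. vj j $ i * vj j $ k)) *v (\<Sum>a\<in>UNIV. v a *\<^sub>R b a))
    = m * (\<Sum>a\<in>UNIV. v a * \<theta> a)"
proof -
  define S :: "real^'p^'p" where "S = (\<chi> i k. (1 / m) * (\<Sum>j\<in>J. vj j $ i * vj j $ k))"
  have Sv: "S *v t = (1 / m) *\<^sub>R (\<Sum>j\<in>J. (vj j \<bullet> t) *\<^sub>R vj j)" for t
  proof -
    have "(S *v t) $ i = ((1 / m) *\<^sub>R (\<Sum>j\<in>J. (vj j \<bullet> t) *\<^sub>R vj j)) $ i" for i
    proof -
      have "(S *v t) $ i = (1 / m) * (\<Sum>k\<in>UNIV. \<Sum>j\<in>J. vj j $ i * vj j $ k * t $ k)"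
        by (simp add: S_def matrix_vector_mult_def sum_distrib_right sum_distrib_left mult.assoc)
      also have "(\<Sum>k\<in>UNIV. \<Sum>j\<in>J. vj j $ i * vj j $ k * t $ k) = (\<Sum>j\<in>J. (vj j \<bullet> t) * vj j $ i)"
        by (subst sum.swap) (simp add: inner_vec_def sum_distrib_left sum_distrib_right mult_ac)
      finally show ?thesis by simp
    qed
    then show ?thesis by (simp add: vec_eq_iff)
  qed
  have sym: "transpose S = S" by (simp add: S_def transpose_def mult.commute)
  have vt: "vj j \<bullet> t = (\<Sum>a\<in>UNIV. (b a \<bullet> t) * V (a, j))" for j t
    by (simp add: vj_def inner_sum_left mult.commute)
  have inv: "invertible S"
    unfolding invertible_left_inverse matrix_left_invertible_ker
  proof (intro allI impI)
    fix z assume "S *v z = 0"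
    then have "0 = z \<bullet> (m *\<^sub>R (S *v z))" by simp
    also have "\<dots> = (\<Sum>j\<in>J. (vj j \<bullet> z)\<^sup>2)"
      using m by (simp add: Sv inner_sum_right power2_eq_square inner_commute)
    finally have "\<forall>j\<in>J. vj j \<bullet> z = 0"
      using J by (simp add: sum_nonneg_eq_0_iff)
    then have "\<forall>j\<in>J. (\<Sum>a\<in>UNIV. (b a \<bullet> z) * V (a, j)) = 0" by (simp add: vt)
    then have bz: "\<forall>a\<in>UNIV. b a \<bullet> z = 0"
      by (rule l[unfolded lin_indep_rows_def, THEN spec[of _ "\<lambda>a. b a \<bullet> z"], THEN mp])
    have "z \<bullet> z = (\<Sum>a\<in>UNIV. (z \<bullet> (A *v b a)) *\<^sub>R b a) \<bullet> z" using b2[of z] by simp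
    also have "\<dots> = 0" using bz by (simp add: inner_sum_left)
    finally show "z = 0" by simp
  qed
  \<comment> \<open>The vectors \<open>A *v b a\<close> form the basis dual to
    \<open>b\<close>.\<close>
  define t where "t = (\<Sum>a\<in>UNIV. \<theta> a *\<^sub>R (A *v b a))"
  have bt: "b a \<bullet> t = \<theta> a" for a
  proof -
    have "b a \<bullet> t = (\<Sum>k\<in>UNIV. \<theta> k * (if a = k then 1 else 0))"
      by (simp add: t_def inner_sum_right b1)
    then show ?thesis by (simp add: if_distrib[of "(*) _"] cong: if_cong)
  qed
  have "S *v (m *\<^sub>R t) = (\<Sum>j\<in>J. (\<Sum>a\<in>UNIV. \<theta> a * V (a, j)) *\<^sub>R vj j)"
    using m by (simp add: matrix_vector_mult_scaleR Sv vt bt)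
  also have "\<dots> = (\<Sum>a\<in>UNIV. (\<Sum>j\<in>J. V (a, j) * (\<Sum>k\<in>UNIV. \<theta> k * V (k, j))) *\<^sub>R b a)"
  proof -
    have "(\<Sum>j\<in>J. w j *\<^sub>R vj j) = (\<Sum>a\<in>UNIV. (\<Sum>j\<in>J. V (a, j) * w j) *\<^sub>R b a)" for w
      unfolding vj_def scaleR_sum_right scaleR_sum_left
      by (subst sum.swap) (simp add: mult.commute)
    then show ?thesis .
  qed
  also have "\<dots> = (\<Sum>a\<in>UNIV. y a *\<^sub>R b a)" unfolding gram_apply[symmetric] sol ..
  finally have y: "(\<Sum>a\<in>UNIV. y a *\<^sub>R b a) = S *v (m *\<^sub>R t)" by simp
  have "(\<Sum>a\<in>UNIV. y a *\<^sub>R b a) \<bullet> (matrix_inv S *v (\<Sum>a\<in>UNIV. v a *\<^sub>R b a))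
    = (m *\<^sub>R t) \<bullet> (S *v (matrix_inv S *v (\<Sum>a\<in>UNIV. v a *\<^sub>R b a)))"
    unfolding y by (rule symmetric_matrix_inner[OF sym])
  also have "\<dots> = m * (\<Sum>a\<in>UNIV. v a * \<theta> a)"
    by (simp add: matrix_vector_mul_assoc matrix_inv_inverse[OF inv] inner_sum_right inner_commute[of t] bt sum_distrib_left mult_ac)
  finally show ?thesis unfolding S_def .
qed

text \<open>The index \<open>None\<close> stands for the new observation.\<close>

definition obs_index :: "(nat \<Rightarrow> nat) \<Rightarrow> (nat \<times> nat) option set" where
  "obs_index n = insert None (Some ` (SIGMA j:{1, 2}. {1..n j}))"

lemma finite_obs_index: "finite (obs_index n)"
  by (simp add: obs_index_def)

lemma sum_obs_index:
  "(\<Sum>k\<in>obs_index n. g k) = g None + (\<Sum>l=1..n 1. g (Some (1, l))) + (\<Sum>l=1..n 2. g (Some (2, l)))"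
  for g :: "(nat \<times> nat) option \<Rightarrow> 'a::comm_monoid_add"
proof -
  have "(\<Sum>k\<in>Some ` (SIGMA j:{1, 2}. {1..n j}). g k) = (\<Sum>j\<in>{1, 2}. \<Sum>l=1..n j. g (Some (j, l)))"
    by (subst sum.reindex) (simp_all add: sum.Sigma case_prod_unfold)
  then show ?thesis by (simp add: obs_index_def add.assoc)
qed

lemma card_obs_index: "card (obs_index n) = n 1 + n 2 + 1"
proof -
  have "card (obs_index n) = (\<Sum>k\<in>obs_index n. 1)" by simp
  also have "\<dots> = 1 + n 1 + n 2" unfolding sum_obs_index by simp
  finally show ?thesis by simp
qed

text \<open>The contrasts 0, 1 and 2 extract the difference of the sample means, the grand mean and the new
  observation; the pooled scatter matrix lives on their orthogonal complement.\<close>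

definition contrast :: "(nat \<Rightarrow> nat) \<Rightarrow> nat \<Rightarrow> (nat \<times> nat) option \<Rightarrow> real" where
  "contrast n j k = (case k of
     None \<Rightarrow> if j = 2 then 1 else 0
   | Some (i, l) \<Rightarrow>
      if j = 0 then (if i = 1 then 1 / real (n 1) else - 1 / real (n 2)) / sqrt (1 / real (n 1) + 1 / real (n 2))
      else if j = 1 then 1 / sqrt (real (n 1) + real (n 2)) else 0)"

text \<open>The contrast of the means has squared norm \<open>1 / n 1 + 1 / n 2\<close> before
  division by the square root of this number, and it is orthogonal to contrast 1 because the two
  samples contribute 1 and -1 to its total.\<close>

lemma orthonormal_contrast:
  assumes n: "n 1 \<ge> 1" "n 2 \<ge> 1"
  shows "finite_ip.orthonormal (dot (obs_index n)) (contrast n) {..<3}"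
proof -
  interpret finite_ip "obs_index n" "dot (obs_index n)" by (rule finite_ip_dot[OF finite_obs_index])
  have n': "real (n 1) > 0" "real (n 2) > 0" using n by auto
  have lam: "1 / real (n 1) + 1 / real (n 2) > 0" using n' by (simp add: add_pos_pos)
  have d0: "dot (obs_index n) (contrast n 0) (contrast n 0) = 1"
  proof -
    define L where "L = 1 / real (n 1) + 1 / real (n 2)"
    have "L > 0" using lam by (simp add: L_def)
    then have sq: "r * (c / sqrt L * (c / sqrt L)) = r * c\<^sup>2 / L" for r c
      by (simp add: power2_eq_square)
    have "dot (obs_index n) (contrast n 0) (contrast n 0)
      = real (n 1) * (1 / real (n 1))\<^sup>2 / L + real (n 2) * (- 1 / real (n 2))\<^sup>2 / L"
      unfolding sq[symmetric] by (simp add: dot_def sum_obs_index contrast_def L_def)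
    also have "\<dots> = (1 / real (n 1) + 1 / real (n 2)) / L"
      using n' by (simp add: power2_eq_square add_divide_distrib)
    also have "\<dots> = 1" using lam by (simp add: L_def)
    finally show ?thesis .
  qed
  have d1: "dot (obs_index n) (contrast n 1) (contrast n 1) = 1"
    using n' by (simp add: dot_def sum_obs_index contrast_def add_divide_distrib[symmetric])
  have "dot (obs_index n) (contrast n i) (contrast n j) = (if i = j then 1 else 0)"
    if "i \<in> {0, 1, 2}" "j \<in> {0, 1, 2}" for i j
  proof (cases "i = j \<and> i \<noteq> 2")
    case True
    then show ?thesis using that d0 d1 by auto
  next
    case False
    then show ?thesis using that n'
      by (elim insertE emptyE) (simp_all add: dot_def sum_obs_index contrast_def)
  qed
  moreover have "{..<3} = {0, 1, 2 :: nat}" by auto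
  ultimately show ?thesis unfolding orthonormal_def by simp
qed

lemma sample_mean_deviation:
  fixes x :: "nat \<Rightarrow> real^'n"
  assumes "k \<ge> 1"
  shows "(\<Sum>l=1..k. x l - \<mu>) = real k *\<^sub>R (sample_mean k x - \<mu>)"
  using assms by (simp add: sample_mean_def sum_subtractf scaleR_diff_right sum_constant_scaleR del: sum_constant)

text \<open>The weights \<open>m - 1\<close> cancel the denominators of the sample covariances. For
  a sample of size 1 the division by zero is harmless: the weight is 0, and so is the single
  deviation from the mean.\<close>

lemma pooled_cov_component:
  fixes x1 x2 :: "nat \<Rightarrow> real^'n"
  assumes n: "m1 \<ge> 1" "m2 \<ge> 1"
  shows "pooled_cov m1 x1 m2 x2 $ i $ k = (1 / (real m1 + real m2 - 2)) *
    ((\<Sum>l=1..m1. (x1 l - sample_mean m1 x1) $ i * (x1 l - sample_mean m1 x1) $ k)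
      + (\<Sum>l=1..m2. (x2 l - sample_mean m2 x2) $ i * (x2 l - sample_mean m2 x2) $ k))"
proof -
  have cr: "((columnvector v :: real^1^'n) ** (rowvector v :: real^'n^1)) $ i $ k = v $ i * v $ k" for v :: "real^'n" and i k
    by (simp add: matrix_matrix_mult_def columnvector_def rowvector_def)
  have "((real m - 1) *\<^sub>R sample_cov m x) $ i $ k = (\<Sum>l=1..m. (x l - sample_mean m x) $ i * (x l - sample_mean m x) $ k)"
    if "m \<ge> 1" for m and x :: "nat \<Rightarrow> real^'n" and i k
  proof (cases "m = 1")
    case True
    then show ?thesis by (simp add: sample_mean_def)
  next
    case False
    then have "real m - 1 \<noteq> 0" using that by simp
    then show ?thesis by (simp add: sample_cov_def cr del: vector_minus_component)
  qed
  from this[OF n(1)] this[OF n(2)] show ?thesis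
    unfolding pooled_cov_def by (simp del: vector_minus_component)
qed

text \<open>Two computations are combined: the midpoint of the sample means is expressed by the
  grand mean and a multiple of \<open>Y\<close>, and the pooled scatter matrix is rewritten by
  Parseval in the orthonormal family \<open>u\<close>.\<close>

lemma discriminant_eq:
  fixes X :: "nat \<Rightarrow> nat \<Rightarrow> real^'p" and x :: "real^'p" and \<mu> :: "nat \<Rightarrow> real^'p" and n :: "nat \<Rightarrow> nat"
  assumes n: "n 1 \<ge> 1" "n 2 \<ge> 1" and i: "i \<in> {1, 2}" and m: "n 1 + n 2 + 1 = 3 + m"
    and o: "finite_ip.orthonormal (dot (obs_index n)) u {..<3 + m}"
    and u: "\<And>j k. j < 3 \<Longrightarrow> k \<in> obs_index n \<Longrightarrow> u j k = contrast n j k"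
  defines "\<eta> \<equiv> \<lambda>k. case k of None \<Rightarrow> x - \<mu> i | Some (j, l) \<Rightarrow> X j l - \<mu> j"
  defines "C \<equiv> \<lambda>j. \<Sum>k\<in>obs_index n. u j k *\<^sub>R \<eta> k"
    and "lam \<equiv> 1 / real (n 1) + 1 / real (n 2)"
  defines "Y \<equiv> (\<mu> 1 - \<mu> 2) + sqrt lam *\<^sub>R C 0"
  shows "discriminant (n 1) (X 1) (n 2) (X 2) x = Y \<bullet>
     (matrix_inv (\<chi> i k. (1 / real m) * (\<Sum>j<m. C (j + 3) $ i * C (j + 3) $ k)) *v
      (((-1) ^ (i - 1) * ((lam * real (n i) - 2) / (2 * lam * real (n i)))) *\<^sub>R Y
       + (((-1) ^ (i - 1) / (lam * real (n i))) *\<^sub>R (\<mu> 1 - \<mu> 2) + C 2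
          - (1 / sqrt (real (n 1 + n 2))) *\<^sub>R C 1)))"
proof -
  interpret finite_ip "obs_index n" "dot (obs_index n)" by (rule finite_ip_dot[OF finite_obs_index])
  define n1 n2 where "n1 = real (n 1)" and "n2 = real (n 2)"
  have n1s: "real (n (Suc 0)) = n1" by (simp add: n1_def)
  have n': "n1 > 0" "n2 > 0" using n by (auto simp: n1_def n2_def)
  have lam: "lam > 0" using n' by (simp add: lam_def n1_def n2_def add_pos_pos)
  define xb where "xb = (\<lambda>j. sample_mean (n j) (X j))"
  define E where "E = (\<lambda>j. xb j - \<mu> j)"
  have sE: "(\<Sum>l=1..n j. X j l - \<mu> j) = real (n j) *\<^sub>R E j" if "j \<in> {1, 2}" for j
    using sample_mean_deviation[of "n j" "X j" "\<mu> j"] that n by (auto simp: E_def xb_def)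
  note sE1 = sE[of 1, simplified] and sE2 = sE[of 2, simplified]
  have Cc: "C j = (\<Sum>k\<in>obs_index n. contrast n j k *\<^sub>R \<eta> k)" if "j < 3" for j
    unfolding C_def using that by (intro sum.cong) (auto simp: u)
  have C0: "sqrt lam *\<^sub>R C 0 = E 1 - E 2"
  proof -
    have "C 0 = (1 / n1 / sqrt lam) *\<^sub>R (\<Sum>l=1..n 1. X 1 l - \<mu> 1) + (- 1 / n2 / sqrt lam) *\<^sub>R (\<Sum>l=1..n 2. X 2 l - \<mu> 2)"
      unfolding scaleR_sum_right
      by (simp add: Cc sum_obs_index contrast_def \<eta>_def lam_def n1_def n2_def)
    then show ?thesis using n' lam by (simp add: sE1 sE2 n1s n2_def[symmetric] scaleR_add_right scaleR_diff_right)
  qed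
  have C1: "(1 / sqrt (n1 + n2)) *\<^sub>R C 1 = (n1 / (n1 + n2)) *\<^sub>R E 1 + (n2 / (n1 + n2)) *\<^sub>R E 2"
  proof -
    have "C 1 = (1 / sqrt (n1 + n2)) *\<^sub>R (\<Sum>l=1..n 1. X 1 l - \<mu> 1) + (1 / sqrt (n1 + n2)) *\<^sub>R (\<Sum>l=1..n 2. X 2 l - \<mu> 2)"
      unfolding scaleR_sum_right
      by (simp add: Cc sum_obs_index contrast_def \<eta>_def n1_def n2_def)
    then show ?thesis using n' by (simp add: sE1 sE2 n1s n2_def[symmetric] scaleR_add_right scaleR_diff_right)
  qed
  have C2: "C 2 = x - \<mu> i"
    by (simp add: Cc sum_obs_index contrast_def \<eta>_def)
  have Y: "xb 1 - xb 2 = Y" unfolding Y_def C0 by (simp add: E_def)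
  have h: "x - (1 / 2) *\<^sub>R (xb 1 + xb 2) = ((-1) ^ (i - 1) * ((lam * real (n i) - 2) / (2 * lam * real (n i)))) *\<^sub>R Y
       + (((-1) ^ (i - 1) / (lam * real (n i))) *\<^sub>R (\<mu> 1 - \<mu> 2) + C 2
          - (1 / sqrt (real (n 1 + n 2))) *\<^sub>R C 1)"
  proof -
    have ln: "lam * n1 = (n1 + n2) / n2" "lam * n2 = (n1 + n2) / n1"
      using n' by (simp_all add: lam_def n1s n2_def[symmetric] field_simps)
    have c1: "1 / (lam * n1) = n2 / (n1 + n2)" "1 / (lam * n2) = n1 / (n1 + n2)"
      unfolding ln by simp_all
    have nz: "n1 + n2 \<noteq> 0" using n' by simp
    have "((n1 + n2) / n2 - 2) / (2 * ((n1 + n2) / n2)) = (n1 - n2) / (2 * (n1 + n2))"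
      "((n1 + n2) / n1 - 2) / (2 * ((n1 + n2) / n1)) = (n2 - n1) / (2 * (n1 + n2))"
      using n' nz by (simp_all add: divide_simps)
    then have c2: "(lam * n1 - 2) / (2 * lam * n1) = (n1 - n2) / (2 * (n1 + n2))"
      "(lam * n2 - 2) / (2 * lam * n2) = (n2 - n1) / (2 * (n1 + n2))"
      unfolding mult.assoc ln by simp_all
    have nn: "real (n 1 + n 2) = n1 + n2" by (simp add: n1_def n2_def)
    have xb: "xb 1 = \<mu> 1 + E 1" "xb 2 = \<mu> 2 + E 2" by (simp_all add: E_def)
    \<comment> \<open>\<open>\<alpha>\<close> is the weight of the first sample in the grand mean;
      the grand mean exceeds the midpoint by \<open>\<alpha> - 1 / 2\<close> times the difference of
      the sample means.\<close>
    define \<alpha> where "\<alpha> = n1 / (n1 + n2)"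
    have \<alpha>: "n1 / (n1 + n2) = \<alpha>" "n2 / (n1 + n2) = 1 - \<alpha>" "(n1 - n2) / (2 * (n1 + n2)) = \<alpha> - 1 / 2"
      "(n2 - n1) / (2 * (n1 + n2)) = 1 / 2 - \<alpha>"
      using nz by (simp_all add: \<alpha>_def field_simps)
    have k1: "(-1) ^ (i - 1) * ((lam * real (n i) - 2) / (2 * lam * real (n i))) = \<alpha> - 1 / 2"
      using i c2[unfolded \<alpha>] by (elim insertE emptyE) (simp_all add: n1s n2_def[symmetric])
    have k2: "(-1) ^ (i - 1) / (lam * real (n i)) = (if i = 1 then 1 - \<alpha> else - \<alpha>)"
      using i c1[unfolded \<alpha>] by (elim insertE emptyE) (simp_all add: n1s n2_def[symmetric])
    from i show ?thesis
      unfolding Y[symmetric] xb C2 nn C1 k1 k2 \<alpha>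
      by (elim insertE emptyE) (simp_all add: vec_eq_iff algebra_simps)
  qed
  have S: "pooled_cov (n 1) (X 1) (n 2) (X 2) = (\<chi> i k. (1 / real m) * (\<Sum>j<m. C (j + 3) $ i * C (j + 3) $ k))"
  proof -
    \<comment> \<open>Deviations from the respective sample means, with 0 for the new observation.
      They are orthogonal to the three contrasts, and in every later direction they have the same
      coordinates as \<open>\<eta>\<close>, since there \<open>u j\<close> vanishes at
      \<open>None\<close> and sums to 0 over each sample.\<close>
    define D where "D = (\<lambda>k. case k of None \<Rightarrow> 0 | Some (j, l) \<Rightarrow> X j l - xb j)"
    have cardK: "card {..<3 + m} = card (obs_index n)" using m by (simp add: card_obs_index)
    have D: "D (Some (j, l)) = \<eta> (Some (j, l)) - E j" "D None = 0" for j l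
      by (simp_all add: D_def \<eta>_def E_def)
    have D0: "(\<Sum>l=1..n j. D (Some (j, l))) = 0" if "j \<in> {1, 2}" for j
      using sample_mean_deviation[of "n j" "X j" "xb j"] that n by (auto simp: D_def xb_def)
    have uD': "(\<Sum>k\<in>obs_index n. u j k *\<^sub>R D k) = (if j < 3 then 0 else C j)" if j: "j < 3 + m" for j
    proof (cases "j < 3")
      case True
      have "(\<Sum>k\<in>obs_index n. u j k *\<^sub>R D k) = (\<Sum>k\<in>obs_index n. contrast n j k *\<^sub>R D k)"
        using True by (intro sum.cong) (auto simp: u)
      also have "\<dots> = 0"
        unfolding sum_obs_index contrast_def
        by (simp add: D(2) scaleR_sum_right[symmetric] D0[of 1, simplified] D0[of 2, simplified])
      finally show ?thesis using True by simp
    next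
      case False
      \<comment> \<open>Orthogonality of \<open>u j\<close> to contrast 1 gives
        \<open>s1 + s2 = 0\<close>, and orthogonality to contrast 0 then forces both totals to
        vanish.\<close>
      define s1 s2 where "s1 = (\<Sum>l=1..n 1. u j (Some (1, l)))" and "s2 = (\<Sum>l=1..n 2. u j (Some (2, l)))"
      have ort: "dot (obs_index n) (contrast n q) (u j) = 0" if "q < 3" for q
      proof -
        have "dot (obs_index n) (contrast n q) (u j) = dot (obs_index n) (u q) (u j)"
          using that by (intro cong) (simp add: u)
        also have "\<dots> = 0" using o that j False by (auto simp: orthonormal_def)
        finally show ?thesis .
      qed
      have un: "u j None = 0"
        using ort[of 2] by (simp add: dot_def sum_obs_index contrast_def)
      have "(s1 + s2) / sqrt (n1 + n2) = 0"
        using ort[of 1] unfolding s1_def s2_def add_divide_distrib sum_divide_distrib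
        by (simp add: dot_def sum_obs_index contrast_def n1_def n2_def)
      then have s12: "s2 = - s1" using n' by (simp add: eq_neg_iff_add_eq_0 add.commute)
      have "s1 * (1 / n1 / sqrt lam) + s2 * (- 1 / n2 / sqrt lam) = 0"
        using ort[of 0] unfolding s1_def s2_def sum_distrib_right
        by (simp add: dot_def sum_obs_index contrast_def n1_def n2_def lam_def)
      then have "s1 * (1 / n1 + 1 / n2) / sqrt lam = 0"
        by (simp add: s12 add_divide_distrib distrib_left)
      then have "s1 * (1 / n1 + 1 / n2) = 0" using lam by simp
      moreover have "1 / n1 + 1 / n2 > 0" using n' by (simp add: add_pos_pos)
      ultimately have s: "s1 = 0" "s2 = 0" using s12 by auto
      have "(\<Sum>k\<in>obs_index n. u j k *\<^sub>R D k) = C j - s1 *\<^sub>R E 1 - s2 *\<^sub>R E 2"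
        unfolding C_def sum_obs_index s1_def s2_def
        by (simp add: D un scaleR_diff_right sum_subtractf scaleR_sum_left)
      then show ?thesis using False s by simp
    qed
    have uD: "dot (obs_index n) (\<lambda>k. D k $ r) (u j) = (if j < 3 then 0 else C j $ r)" if "j < 3 + m" for r j
    proof -
      have "dot (obs_index n) (\<lambda>k. D k $ r) (u j) = (\<Sum>k\<in>obs_index n. u j k *\<^sub>R D k) $ r"
        by (simp add: dot_def mult.commute)
      then show ?thesis unfolding uD'[OF that] by simp
    qed
    have shift: "(\<Sum>j<3 + m. if j < 3 then 0 else g j) = (\<Sum>j<m. g (j + 3))" for g :: "nat \<Rightarrow> real" and m :: nat
      by (simp add: numeral_3_eq_3 sum.lessThan_Suc_shift del: sum.lessThan_Suc)
    have DD: "dot (obs_index n) (\<lambda>k. D k $ r) (\<lambda>k. D k $ q) = (\<Sum>j<m. C (j + 3) $ r * C (j + 3) $ q)" for r q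
    proof -
      have "dot (obs_index n) (\<lambda>k. D k $ r) (\<lambda>k. D k $ q)
        = (\<Sum>j<3 + m. dot (obs_index n) (\<lambda>k. D k $ r) (u j) * dot (obs_index n) (\<lambda>k. D k $ q) (u j))"
        by (rule parseval[OF _ cardK o]) simp
      also have "\<dots> = (\<Sum>j<3 + m. if j < 3 then 0 else C j $ r * C j $ q)"
        by (intro sum.cong) (simp_all add: uD)
      finally show ?thesis unfolding shift .
    qed
    have nm: "real (n 1) + real (n 2) - 2 = real m" using m by linarith
    have "pooled_cov (n 1) (X 1) (n 2) (X 2) $ r $ q = (1 / real m) * dot (obs_index n) (\<lambda>k. D k $ r) (\<lambda>k. D k $ q)" for r q
      unfolding pooled_cov_component[OF n] nm dot_def sum_obs_index by (simp add: D_def xb_def)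
    then show ?thesis by (simp add: vec_eq_iff DD)
  qed
  show ?thesis
    unfolding discriminant_def xb_def[symmetric] S[symmetric] using Y h by (simp add: xb_def)
qed

theorem theorem3:
  fixes n :: "nat \<Rightarrow> nat" and i :: nat
    and \<mu> :: "nat \<Rightarrow> real^'p" and \<Sigma> :: "real^'p^'p"
    and M :: "'a measure" and X :: "nat \<Rightarrow> nat \<Rightarrow> 'a \<Rightarrow> real^'p" and x :: "'a \<Rightarrow> real^'p"
    and N :: "'b measure" and \<xi> z\<^sub>0 u \<xi>\<^sub>1 \<xi>\<^sub>2 w\<^sub>0 :: "'b \<Rightarrow> real"
  defines "p \<equiv> CARD('p)"
    and "lam \<equiv> 1 / real (n 1) + 1 / real (n 2)"
    and "\<Delta> \<equiv> sqrt ((\<mu> 1 - \<mu> 2) \<bullet> (matrix_inv \<Sigma> *v (\<mu> 1 - \<mu> 2)))"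
  defines "d_hat \<equiv> (\<lambda>\<omega>. discriminant (n 1) (\<lambda>l. X 1 l \<omega>) (n 2) (\<lambda>l. X 2 l \<omega>) (x \<omega>))"
    and "\<delta>_sq \<equiv> (\<lambda>s w. real (n 1) * real (n 2) / (real (n i))\<^sup>2 *
                  (\<Delta>\<^sup>2 * s / (lam * s + (\<Delta> + sqrt lam * w)\<^sup>2)))"
  assumes "p \<ge> 2" and "n 1 \<ge> 1" and "n 2 \<ge> 1" and "p < n 1 + n 2 - 2"
    and "pos_def_matrix \<Sigma>" and "i \<in> {1, 2}"
    and "prob_space M"
    and "\<And>j l. j \<in> {1, 2} \<Longrightarrow> l \<in> {1..n j} \<Longrightarrow> distributed M lborel (X j l) (mvn_density (\<mu> j) \<Sigma>)"
    and "distributed M lborel x (mvn_density (\<mu> i) \<Sigma>)"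
    and "prob_space.indep_vars M (\<lambda>_. borel) (\<lambda>k. case k of None \<Rightarrow> x | Some (j, l) \<Rightarrow> X j l)
           (insert None (Some ` (SIGMA j:{1, 2}. {1..n j})))"
    and "prob_space N"
    and "\<xi> \<in> borel_measurable N" and "distr N borel \<xi> = chi_squared (n 1 + n 2 - p - 1)"
    and "\<xi>\<^sub>2 \<in> borel_measurable N" and "distr N borel \<xi>\<^sub>2 = chi_squared (p - 1)"
    and "distributed N lborel z\<^sub>0 std_normal_density"
    and "distributed N lborel w\<^sub>0 std_normal_density"
    and "prob_space.indep_var N borel \<xi>\<^sub>2 borel w\<^sub>0"
    and "cond_distributed N borel (\<lambda>\<omega>. (\<xi>\<^sub>2 \<omega>, w\<^sub>0 \<omega>)) borel \<xi>\<^sub>1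
           (\<lambda>(s, w). noncentral_chi_squared (p - 1) (\<delta>_sq s w))"
    and "cond_distributed N borel (\<lambda>\<omega>. (\<xi>\<^sub>1 \<omega>, \<xi>\<^sub>2 \<omega>, w\<^sub>0 \<omega>)) borel u
           (\<lambda>(r, s, w). noncentral_F (p - 1) (n 1 + n 2 - p) (r / real (n 1 + n 2)))"
    and "prob_space.indep_vars3 N borel \<xi> borel z\<^sub>0 borel (\<lambda>\<omega>. (u \<omega>, \<xi>\<^sub>1 \<omega>, \<xi>\<^sub>2 \<omega>, w\<^sub>0 \<omega>))"
  shows "distr M borel d_hat = distr N borel (\<lambda>\<omega>.
    (real (n 1) + real (n 2) - 2) / \<xi> \<omega> *
      ((-1) ^ (i - 1) * ((lam * real (n i) - 2) / (2 * lam * real (n i))) *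
          (lam * \<xi>\<^sub>2 \<omega> + (\<Delta> + sqrt lam * w\<^sub>0 \<omega>)\<^sup>2)
       + (-1) ^ (i - 1) / (lam * real (n i)) * (\<Delta>\<^sup>2 + sqrt lam * \<Delta> * w\<^sub>0 \<omega>)
       + sqrt (1 + 1 / (real (n 1) + real (n 2))
               + (real p - 1) / (real (n 1) + real (n 2) - real p) * u \<omega>)
         * sqrt (lam * \<xi>\<^sub>2 \<omega> + (\<Delta> + sqrt lam * w\<^sub>0 \<omega>)\<^sup>2) * z\<^sub>0 \<omega>))"
proof -
  interpret M: prob_space M by fact
  have p2: "2 \<le> CARD('p)" using \<open>p \<ge> 2\<close> by (simp add: p_def)
  have n: "n 1 \<ge> 1" "n 2 \<ge> 1" by fact+
  have i: "i \<in> {1, 2}" by fact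
  define m where "m = n 1 + n 2 - 2"
  have pm: "CARD('p) < m" using \<open>p < n 1 + n 2 - 2\<close> by (simp add: m_def p_def)
  have m3: "n 1 + n 2 + 1 = Suc (Suc (Suc m))" using pm by (simp add: m_def)
  have m3': "3 + m = Suc (Suc (Suc m))" by simp
  have nm: "real (n 1) + real (n 2) - 2 = real m" using m3 by linarith
  have n': "real (n 1) > 0" "real (n 2) > 0" "real (n i) > 0" using n i by auto
  have lam: "lam > 0" using n' by (simp add: lam_def add_pos_pos)

  \<comment> \<open>The samples as one standard normal array\<close>
  define A where "A = matrix_inv \<Sigma>"
  define \<delta> where "\<delta> = \<mu> 1 - \<mu> 2"
  have pd: "pos_def_matrix A"
    unfolding A_def by (rule pos_def_matrix_inv(2)) fact
  \<comment> \<open>Any index serves; in the basis \<open>b\<close> it names the direction of the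
    mean difference.\<close>
  obtain a0 :: 'p where True by simp
  obtain b :: "'p \<Rightarrow> real^'p" where
    b1: "\<And>a a'. b a \<bullet> (A *v b a') = (if a = a' then 1 else 0)" and
    b2: "\<And>v. v = (\<Sum>a\<in>UNIV. (v \<bullet> (A *v b a)) *\<^sub>R b a)" and
    b3: "\<And>v. v \<bullet> (A *v v) = (\<Sum>a\<in>UNIV. (v \<bullet> (A *v b a))\<^sup>2)" and
    b4: "\<And>a. a \<noteq> a0 \<Longrightarrow> \<delta> \<bullet> (A *v b a) = 0" and
    b5: "\<delta> \<bullet> (A *v b a0) = sqrt (\<delta> \<bullet> (A *v \<delta>))"
    by (rule pos_def_orthonormal_basis[OF pd p2, where ?a0.0 = a0 and \<delta> = \<delta>]) blast
  have \<delta>: "\<delta> = (\<Sum>a\<in>UNIV. (if a = a0 then \<Delta> else 0) *\<^sub>R b a)"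
  proof -
    have "\<delta> \<bullet> (A *v b a) = (if a = a0 then \<Delta> else 0)" for a
      using b4 b5 by (simp add: \<Delta>_def A_def \<delta>_def)
    then show ?thesis using b2[of \<delta>] by simp
  qed
  define obs where "obs = (\<lambda>k. case k of None \<Rightarrow> x | Some (j, l) \<Rightarrow> X j l)"
  define mean where "mean = (\<lambda>k :: (nat \<times> nat) option. case k of None \<Rightarrow> \<mu> i | Some (j, l) \<Rightarrow> \<mu> j)"
  let ?K = "obs_index n"
  have fK: "finite ?K" by (rule finite_obs_index)
  have ind: "M.indep_vars (\<lambda>_. borel) obs ?K"
    unfolding obs_def obs_index_def by fact
  have dist: "distributed M lborel (obs k) (mvn_density (mean k) \<Sigma>)" if "k \<in> ?K" for k
    using that \<open>distributed M lborel x (mvn_density (\<mu> i) \<Sigma>)\<close>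
      \<open>\<And>j l. j \<in> {1, 2} \<Longrightarrow> l \<in> {1..n j} \<Longrightarrow> distributed M lborel (X j l) (mvn_density (\<mu> j) \<Sigma>)\<close>
    unfolding obs_index_def obs_def mean_def by auto
  define \<zeta> where "\<zeta> = (\<lambda>k \<omega>. \<lambda>a\<in>UNIV. (obs k \<omega> - mean k) \<bullet> (A *v b a))"
  have ind\<zeta>: "M.indep_vars (\<lambda>_. \<Pi>\<^sub>M a\<in>UNIV. borel) \<zeta> ?K"
    unfolding \<zeta>_def by (rule M.indep_vars_compose2[OF ind]) measurable
  have std\<zeta>: "distr M (\<Pi>\<^sub>M a\<in>UNIV. borel) (\<zeta> k) = stdn UNIV" if "k \<in> ?K" for k
    unfolding \<zeta>_def A_def using b1 b3 dist[OF that]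
    by (intro distr_mvn_coordinates \<open>prob_space M\<close>) (simp_all add: A_def)
  define Z where "Z = (\<lambda>\<omega>. \<lambda>i\<in>?K \<times> UNIV. \<zeta> (fst i) \<omega> (snd i))"
  have dZ: "distr M (\<Pi>\<^sub>M i\<in>?K \<times> UNIV. borel) Z = stdn (?K \<times> UNIV)"
    unfolding Z_def by (rule M.distr_iid_coordinates[OF fK _ ind\<zeta> std\<zeta>]) (auto simp: obs_index_def)
  have [measurable]: "Z \<in> measurable M (\<Pi>\<^sub>M i\<in>?K \<times> UNIV. borel)"
    unfolding Z_def
  proof (rule measurable_restrict)
    fix i assume "i \<in> ?K \<times> (UNIV :: 'p set)"
    then have "\<zeta> (fst i) \<in> measurable M (\<Pi>\<^sub>M a\<in>UNIV. borel)"
      using ind\<zeta> unfolding M.indep_vars_def by auto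
    then show "(\<lambda>\<omega>. \<zeta> (fst i) \<omega> (snd i)) \<in> borel_measurable M"
      by (rule measurable_compose) (rule measurable_component_singleton, simp)
  qed
  interpret ipK: finite_ip ?K "dot ?K" by (rule finite_ip_dot[OF fK])
  have cK: "card ?K = Suc (Suc (Suc m))" unfolding card_obs_index m3 ..
  have "3 < card ?K" using cK pm p2 by simp
  \<comment> \<open>The three contrasts are completed to an orthonormal basis of the space of
    observations; the columns from position 3 on will form the scatter matrix.\<close>
  then obtain e where e: "ipK.orthonormal e {..<card ?K}"
    "\<And>k j. j < 3 \<Longrightarrow> k \<in> ?K \<Longrightarrow> e j k = contrast n j k"
    by (rule ipK.qr_extend[OF _ orthonormal_contrast[OF n], where v = "\<lambda>_. 0"]) blast
  let ?I = "(UNIV :: 'p set) \<times> {..<Suc (Suc (Suc m))}"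
  define T where "T = (\<lambda>z. \<lambda>i\<in>?I. \<Sum>k\<in>?K. e (snd i) k * z (k, fst i))"
  have dT: "distr (stdn (?K \<times> UNIV)) (\<Pi>\<^sub>M i\<in>?I. borel) T = stdn ?I"
    unfolding T_def by (rule distr_stdn_combine_samples) (use fK e(1) cK in auto)
  have [measurable]: "T \<in> measurable (\<Pi>\<^sub>M i\<in>?K \<times> UNIV. borel) (\<Pi>\<^sub>M i\<in>?I. borel)"
    unfolding T_def
    by (intro measurable_restrict borel_measurable_sum borel_measurable_times borel_measurable_const
      measurable_component_singleton) auto
  have dTZ: "distr M (\<Pi>\<^sub>M i\<in>?I. borel) (\<lambda>\<omega>. T (Z \<omega>)) = stdn ?I"
    unfolding dT[symmetric] dZ[symmetric] by (subst distr_distr) (auto simp: comp_def)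

  \<comment> \<open>The discriminant as a function of the array\<close>
  define C where "C = (\<lambda>z (j :: nat). \<Sum>a\<in>UNIV. z (a, j) *\<^sub>R b a :: real^'p)"
  define c where "c = (-1) ^ (i - 1) * ((lam * real (n i) - 2) / (2 * lam * real (n i)))"
  define \<nu> where "\<nu> = (-1) ^ (i - 1) / (lam * real (n i))"
  define Yv where "Yv = (\<lambda>z. \<delta> + sqrt lam *\<^sub>R C z 0)"
  \<comment> \<open>This is the new observation minus the grand mean:
    \<open>\<nu> *\<^sub>R \<delta>\<close> is its mean, and columns 2 and 1 are the fluctuations of
    the two terms.\<close>
  define hv where "hv = (\<lambda>z. \<nu> *\<^sub>R \<delta> + C z 2 - (1 / sqrt (real (n 1 + n 2))) *\<^sub>R C z 1)"
  define Sm :: "('p \<times> nat \<Rightarrow> real) \<Rightarrow> real^'p^'p"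
    where "Sm = (\<lambda>z. \<chi> i k. (1 / real m) * (\<Sum>j<m. C z (j + 3) $ i * C z (j + 3) $ k))"
  define D where "D = (\<lambda>z. Yv z \<bullet> (matrix_inv (Sm z) *v (c *\<^sub>R Yv z + hv z)))"
  have D_eq: "d_hat \<omega> = D (T (Z \<omega>))" for \<omega>
  proof -
    define \<eta> where "\<eta> = (\<lambda>k. obs k \<omega> - mean k)"
    have \<eta>: "\<eta> = (\<lambda>k. case k of None \<Rightarrow> x \<omega> - \<mu> i | Some (j, l) \<Rightarrow> X j l \<omega> - \<mu> j)"
      by (auto simp: \<eta>_def obs_def mean_def split: option.splits)
    have CT: "C (T (Z \<omega>)) j = (\<Sum>k\<in>?K. e j k *\<^sub>R \<eta> k)" if "j < Suc (Suc (Suc m))" for j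
    proof -
      have "(\<Sum>k\<in>?K. e j k *\<^sub>R \<eta> k) \<bullet> (A *v b a) = T (Z \<omega>) (a, j)" for a
        using that by (simp add: T_def Z_def \<zeta>_def \<eta>_def inner_sum_left)
      then show ?thesis using b2[of "\<Sum>k\<in>?K. e j k *\<^sub>R \<eta> k"] by (simp add: C_def)
    qed
    have Sm_eq: "Sm (T (Z \<omega>)) = (\<chi> i k. (1 / real m) *
        (\<Sum>j<m. (\<Sum>k\<in>?K. e (j + 3) k *\<^sub>R \<eta> k) $ i * (\<Sum>k\<in>?K. e (j + 3) k *\<^sub>R \<eta> k) $ k))"
      unfolding Sm_def by (intro arg_cong[where f = vec_lambda] ext arg_cong2[where f = "(*)"] sum.cong refl) (simp_all add: CT)
    have CT': "C (T (Z \<omega>)) 0 = (\<Sum>k\<in>?K. e 0 k *\<^sub>R \<eta> k)" "C (T (Z \<omega>)) 1 = (\<Sum>k\<in>?K. e 1 k *\<^sub>R \<eta> k)"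
      "C (T (Z \<omega>)) 2 = (\<Sum>k\<in>?K. e 2 k *\<^sub>R \<eta> k)"
      by (rule CT, simp)+
    have "n 1 + n 2 + 1 = 3 + m" "ipK.orthonormal e {..<3 + m}"
      using m3 e(1) unfolding cK m3' by simp_all
    then have "discriminant (n 1) (\<lambda>l. X 1 l \<omega>) (n 2) (\<lambda>l. X 2 l \<omega>) (x \<omega>) = D (T (Z \<omega>))"
      unfolding D_def Sm_eq Yv_def hv_def CT' \<eta> c_def \<nu>_def \<delta>_def lam_def
      by (rule discriminant_eq[where X = "\<lambda>j l. X j l \<omega>", OF n i _ _ e(2)])
    then show ?thesis by (simp add: d_hat_def)
  qed
  have Cm: "(\<lambda>z. C z j $ k) \<in> borel_measurable (\<Pi>\<^sub>M i\<in>?I. borel)" if "j < Suc (Suc (Suc m))" for j k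
    unfolding C_def sum_component vector_scaleR_component using that
    by (intro borel_measurable_sum borel_measurable_times borel_measurable_const measurable_component_singleton) auto
  have Dm: "D \<in> borel_measurable (\<Pi>\<^sub>M i\<in>?I. borel)"
  proof -
    have [measurable]: "(\<lambda>z. Yv z $ k) \<in> borel_measurable (\<Pi>\<^sub>M i\<in>?I. borel)" for k
      unfolding Yv_def using Cm[of 0] by simp
    have [measurable]: "(\<lambda>z. hv z $ k) \<in> borel_measurable (\<Pi>\<^sub>M i\<in>?I. borel)" for k
      unfolding hv_def using Cm[of 1] Cm[of 2] by simp
    have "(\<lambda>z. Sm z $ i $ k) \<in> borel_measurable (\<Pi>\<^sub>M i\<in>?I. borel)" for i k
      unfolding Sm_def vec_lambda_beta
      by (intro borel_measurable_sum borel_measurable_times borel_measurable_const Cm) auto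
    then have [measurable]: "(\<lambda>z. matrix_inv (Sm z) $ i $ k) \<in> borel_measurable (\<Pi>\<^sub>M i\<in>?I. borel)" for i k
      by (rule measurable_matrix_inv)
    show ?thesis
      unfolding D_def inner_vec_def matrix_vector_mult_def vec_lambda_beta vector_add_component vector_scaleR_component
        inner_real_def by measurable
  qed
  have d_hat_m [measurable]: "d_hat \<in> borel_measurable M"
    unfolding D_eq using Dm by measurable

  \<comment> \<open>Equality of the nested integrals\<close>
  define nn where "nn = real (n 1 + n 2)"
  have nn: "nn > 0" "nn = real (n 1) + real (n 2)" using n by (auto simp: nn_def)
  let ?R = "UNIV - {a0}"
  let ?N = std_normal_measure
  let ?\<kappa> = "chi_squared (n 1 + n 2 - p)"
  let ?\<xi> = "chi_squared (n 1 + n 2 - p - 1)"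
  have df: "m - (p - 2) = n 1 + n 2 - p" "m - (p - 1) = n 1 + n 2 - p - 1"
    using pm p2 by (auto simp: m_def p_def)
  \<comment> \<open>\<open>q s w\<close> is the squared length of the difference of the sample
    means: its coordinate at \<open>a0\<close> is \<open>\<Delta> + sqrt lam * w\<close>, and the
    other coordinates contribute \<open>lam * s\<close>. The argument \<open>t\<close> of
    \<open>H\<close> stands for the quotient of two chi-squared variables, the numerator being
    non-central.\<close>
  define q where "q = (\<lambda>s w. lam * s + (\<Delta> + sqrt lam * w)\<^sup>2)"
  define H where "H = (\<lambda>xi z t s w. real m / xi * (c * q s w + \<nu> * (\<Delta>\<^sup>2 + sqrt lam * \<Delta> * w)
      + sqrt (1 + 1 / nn + t) * sqrt (q s w) * z))"
  interpret \<kappa>: sigma_finite_measure ?\<kappa> by (rule sigma_finite_chi_squared)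
  interpret \<xi>: sigma_finite_measure ?\<xi> by (rule sigma_finite_chi_squared)
  have [measurable]: "(\<lambda>(s, w). q s w) \<in> borel_measurable (borel \<Otimes>\<^sub>M borel)" unfolding q_def by measurable
  have \<delta>_sq_m: "(\<lambda>(w, s). \<delta>_sq s w) \<in> borel_measurable (borel \<Otimes>\<^sub>M borel)" unfolding \<delta>_sq_def by measurable
  have key: "(\<integral>\<^sup>+\<omega>. f (d_hat \<omega>) \<partial>M) = (\<integral>\<^sup>+\<omega>. f (H (\<xi> \<omega>) (z\<^sub>0 \<omega>)
      ((real p - 1) / (real (n 1) + real (n 2) - real p) * u \<omega>) (\<xi>\<^sub>2 \<omega>) (w\<^sub>0 \<omega>)) \<partial>N)"
    if f [measurable]: "f \<in> borel_measurable borel" for f :: "real \<Rightarrow> ennreal"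
  proof -
    \<comment> \<open>\<open>\<Theta>\<close>, \<open>L\<close> and \<open>\<Omega>\<close> are the
      successive inner integrals of the law for a fixed difference of the sample means;
      \<open>w\<close> and \<open>s\<close> are all that they retain of this difference.\<close>
    define \<Theta> where "\<Theta> = (\<lambda>(\<zeta>, w, s). \<integral>\<^sup>+\<kappa>. \<integral>\<^sup>+z. \<integral>\<^sup>+xi. f (H xi z (\<zeta> / \<kappa>) s w) \<partial>?\<xi> \<partial>?N \<partial>?\<kappa>)"
    have [measurable]: "\<Theta> \<in> borel_measurable (borel \<Otimes>\<^sub>M borel \<Otimes>\<^sub>M borel)"
      unfolding \<Theta>_def H_def by measurable
    have K1: "(\<lambda>r. noncentral_chi_squared (p - 1) (r / nn)) \<in> measurable borel (subprob_algebra borel)"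
      by (rule measurable_prob_algebraD) measurable
    have K2: "(\<lambda>(w, s). noncentral_chi_squared (p - 1) (\<delta>_sq s w)) \<in> measurable (borel \<Otimes>\<^sub>M borel) (subprob_algebra borel)"
      using measurable_compose[OF \<delta>_sq_m measurable_prob_algebraD[OF measurable_noncentral_chi_squared]]
      by (simp add: case_prod_unfold)
    define L where "L = (\<lambda>(r, w, s). \<integral>\<^sup>+\<zeta>. \<Theta> (\<zeta>, w, s) \<partial>noncentral_chi_squared (p - 1) (r / nn))"
    have [measurable]: "L \<in> borel_measurable (borel \<Otimes>\<^sub>M borel \<Otimes>\<^sub>M borel)"
      unfolding L_def case_prod_unfold
      by (rule nn_integral_measurable_subprob_algebra2[where N = borel])
         (measurable, rule measurable_compose[OF measurable_fst K1])
    define \<Omega> where "\<Omega> = (\<lambda>w s. \<integral>\<^sup>+r. L (r, w, s) \<partial>noncentral_chi_squared (p - 1) (\<delta>_sq s w))"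
    have [measurable]: "(\<lambda>(w, s). \<Omega> w s) \<in> borel_measurable (borel \<Otimes>\<^sub>M borel)"
      unfolding \<Omega>_def case_prod_unfold
      by (rule nn_integral_measurable_subprob_algebra2[where N = borel])
         (measurable, use K2 in \<open>simp add: case_prod_unfold\<close>)
    define fD where "fD = (\<lambda>z. f (D z))"
    have fDm: "fD \<in> borel_measurable (\<Pi>\<^sub>M i\<in>?I. borel)" unfolding fD_def using Dm by measurable
    define F where "F = (\<lambda>y g x V. fD (join (Suc (Suc m)) y (join (Suc m) g (join m x V))))"
    have fD1: "(\<lambda>z. fD (join (Suc (Suc m)) y z)) \<in> borel_measurable (\<Pi>\<^sub>M i\<in>UNIV \<times> {..<Suc (Suc m)}. borel)" for y
      by (rule measurable_compose[OF measurable_join_right fDm])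
    have fD2: "(\<lambda>z. fD (join (Suc (Suc m)) y (join (Suc m) g z))) \<in> borel_measurable (\<Pi>\<^sub>M i\<in>UNIV \<times> {..<Suc m}. borel)" for y g
      by (rule measurable_compose[OF measurable_join_right fD1])
    have Fm: "F y g x \<in> borel_measurable (\<Pi>\<^sub>M i\<in>UNIV \<times> {..<m}. borel)" for y g x
      unfolding F_def by (rule measurable_compose[OF measurable_join_right fD2])
    have "(\<integral>\<^sup>+\<omega>. f (d_hat \<omega>) \<partial>M) = (\<integral>\<^sup>+z. fD z \<partial>distr M (\<Pi>\<^sub>M i\<in>?I. borel) (\<lambda>\<omega>. T (Z \<omega>)))"
      unfolding D_eq using fDm by (subst nn_integral_distr) (auto simp: fD_def)
    also have "\<dots> = (\<integral>\<^sup>+y. \<integral>\<^sup>+g. \<integral>\<^sup>+x. \<integral>\<^sup>+V. F y g x V \<partial>stdn (UNIV \<times> {..<m}) \<partial>stdn UNIV \<partial>stdn UNIV \<partial>stdn UNIV)"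
      unfolding dTZ F_def
      by (simp only: nn_integral_stdn_join[OF fDm] nn_integral_stdn_join[OF fD1] nn_integral_stdn_join[OF fD2])
    also have "\<dots> = (\<integral>\<^sup>+y. \<Omega> (y a0) (\<Sum>a\<in>?R. (y a)\<^sup>2) \<partial>stdn UNIV)"
    proof (rule nn_integral_cong_AE)
      \<comment> \<open>A coordinate off the direction of the mean difference is almost surely
        nonzero; this keeps the difference of the sample means away from 0, whatever its coordinate
        at \<open>a0\<close> is.\<close>
      have "\<not> card (UNIV :: 'p set) \<le> Suc 0" using p2 by simp
      then obtain a1 :: 'p where ne: "a0 \<noteq> a1"
        using card_le_Suc0_iff_eq[of "UNIV :: 'p set"] by (metis finite)
      have da1: "dot UNIV (\<lambda>a. if a = a1 then 1 else 0) v = v a1" for v :: "'p \<Rightarrow> real"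
        by (simp add: dot_def if_distrib[of "\<lambda>x. x * _"] cong: if_cong)
      have "AE y in stdn (UNIV :: 'p set). y a1 \<noteq> 0"
        using AE_stdn_dot_nonzero[of "UNIV :: 'p set" "\<lambda>a. if a = a1 then 1 else 0"] by (simp add: da1)
      then show "AE y in stdn UNIV. (\<integral>\<^sup>+g. \<integral>\<^sup>+x. \<integral>\<^sup>+V. F y g x V \<partial>stdn (UNIV \<times> {..<m}) \<partial>stdn UNIV \<partial>stdn UNIV)
        = \<Omega> (y a0) (\<Sum>a\<in>?R. (y a)\<^sup>2)"
      proof eventually_elim
        case (elim y)
        define yc where "yc = (\<lambda>a. (if a = a0 then \<Delta> else 0) + sqrt lam * y a)"
        define s where "s = (\<Sum>a\<in>?R. (y a)\<^sup>2)"
        have Y: "dot UNIV yc yc = q s (y a0)"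
        proof -
          have "dot UNIV yc yc = yc a0 * yc a0 + (\<Sum>a\<in>?R. yc a * yc a)"
            unfolding dot_def by (rule sum.remove) auto
          also have "(\<Sum>a\<in>?R. yc a * yc a) = lam * s"
          proof -
            have ss: "sqrt lam * (sqrt lam * t) = lam * t" for t using lam by (simp add: mult.assoc[symmetric])
            show ?thesis by (simp add: s_def yc_def sum_distrib_left power2_eq_square mult_ac ss)
          qed
          finally show ?thesis by (simp add: q_def yc_def power2_eq_square)
        qed
        have "s > 0"
          unfolding s_def using elim ne by (intro sum_pos2[of _ a1]) auto
        then have Y0: "dot UNIV yc yc \<noteq> 0" unfolding Y q_def using lam
          by (metis add_pos_nonneg less_irrefl mult_pos_pos zero_le_power2)
        have spec: "F y g x V = f (real m * (c * dot UNIV yc \<theta>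
            + dot UNIV (\<lambda>a. (if a = a0 then \<nu> * \<Delta> else 0) + x a - g a * (1 / sqrt nn)) \<theta>))"
          if l: "lin_indep_rows UNIV {..<m} V"
            and sol: "\<And>a. (\<Sum>b\<in>UNIV. gram {..<m} V a b * \<theta> b) = yc a" for g x V \<theta>
        proof -
          define z where "z = join (Suc (Suc m)) y (join (Suc m) g (join m x V))"
          define hc where "hc = (\<lambda>a. (if a = a0 then \<nu> * \<Delta> else 0) + x a - g a * (1 / sqrt nn))"
          have Cz: "C z 0 = (\<Sum>a\<in>UNIV. y a *\<^sub>R b a)" "C z 1 = (\<Sum>a\<in>UNIV. g a *\<^sub>R b a)"
            "C z 2 = (\<Sum>a\<in>UNIV. x a *\<^sub>R b a)"
            by (simp_all add: C_def z_def join_def)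
          have CV: "C z (j + 3) = (\<Sum>a\<in>UNIV. V (a, j) *\<^sub>R b a)" if "j < m" for j
            using that by (simp add: C_def z_def join_def)
          have Yz: "Yv z = (\<Sum>a\<in>UNIV. yc a *\<^sub>R b a)"
            unfolding Yv_def Cz \<delta> yc_def by (simp only: scaleR_sum_right scaleR_add_left sum.distrib scaleR_scaleR)
          have hz: "hv z = (\<Sum>a\<in>UNIV. hc a *\<^sub>R b a)"
          proof -
            have "\<nu> *\<^sub>R \<delta> = (\<Sum>a\<in>UNIV. (if a = a0 then \<nu> * \<Delta> else 0) *\<^sub>R b a)"
              unfolding \<delta> scaleR_sum_right by (intro sum.cong) auto
            then show ?thesis
              unfolding hv_def Cz hc_def nn_def[symmetric]
              by (simp add: scaleR_sum_right scaleR_add_left scaleR_diff_left sum.distrib sum_subtractf)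
          qed
          have "D z = (\<Sum>a\<in>UNIV. yc a *\<^sub>R b a) \<bullet> (matrix_inv (\<chi> i k. (1 / real m) *
              (\<Sum>j<m. (\<Sum>a\<in>UNIV. V (a, j) *\<^sub>R b a) $ i * (\<Sum>a\<in>UNIV. V (a, j) *\<^sub>R b a) $ k))
              *v (\<Sum>a\<in>UNIV. (c * yc a + hc a) *\<^sub>R b a))"
          proof -
            have "c *\<^sub>R Yv z + hv z = (\<Sum>a\<in>UNIV. (c * yc a + hc a) *\<^sub>R b a)"
              unfolding Yz hz by (simp add: scaleR_sum_right scaleR_add_left sum.distrib)
            moreover have "Sm z = (\<chi> i k. (1 / real m) *
              (\<Sum>j<m. (\<Sum>a\<in>UNIV. V (a, j) *\<^sub>R b a) $ i * (\<Sum>a\<in>UNIV. V (a, j) *\<^sub>R b a) $ k))"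
              unfolding Sm_def
              by (intro arg_cong[where f = vec_lambda] ext arg_cong2[where f = "(*)"] sum.cong refl) (simp_all only: CV lessThan_iff)
            ultimately show ?thesis unfolding D_def Yz by simp
          qed
          also have "\<dots> = real m * (\<Sum>a\<in>UNIV. (c * yc a + hc a) * \<theta> a)"
            by (rule discriminant_form_solution[OF b1 b2 _ _ l sol]) (use pm in auto)
          also have "(\<Sum>a\<in>UNIV. (c * yc a + hc a) * \<theta> a) = c * dot UNIV yc \<theta> + dot UNIV hc \<theta>"
            unfolding dot_def sum_distrib_left sum.distrib[symmetric]
            by (intro sum.cong) (simp_all add: algebra_simps)
          finally show ?thesis by (simp add: F_def fD_def z_def hc_def)
        qed
        \<comment> \<open>The constant in \<open>\<delta>_sq\<close> arises from
          \<open>lam = nn / (n 1 * n 2)\<close>: with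
          \<open>\<nu>\<^sup>2 = 1 / (lam * n i)\<^sup>2\<close>, the product
          \<open>nn * \<nu>\<^sup>2 * lam\<close> is
          \<open>n 1 * n 2 / (n i)\<^sup>2\<close>.\<close>
        have nc: "nn * (\<nu> * \<Delta>)\<^sup>2 * (dot UNIV yc yc - (yc a0)\<^sup>2) / dot UNIV yc yc = \<delta>_sq s (y a0)"
        proof -
          have "lam = nn / (real (n 1) * real (n 2))"
            using n' by (simp add: lam_def nn(2) field_simps)
          then have "nn = lam * (real (n 1) * real (n 2))" using n' by simp
          moreover have "\<nu>\<^sup>2 = 1 / (lam * real (n i))\<^sup>2"
            by (simp add: \<nu>_def power_divide power_mult[symmetric] mult.commute)
          ultimately have "nn * \<nu>\<^sup>2 * lam = real (n 1) * real (n 2) / (real (n i))\<^sup>2"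
            using lam by (simp add: power2_eq_square)
          moreover have "dot UNIV yc yc - (yc a0)\<^sup>2 = lam * s" unfolding Y by (simp add: q_def yc_def)
          moreover have "nn * (\<nu> * \<Delta>)\<^sup>2 * (lam * s) / q s (y a0) = (nn * \<nu>\<^sup>2 * lam) * (\<Delta>\<^sup>2 * s / q s (y a0))"
            by (simp add: power_mult_distrib)
          ultimately show ?thesis unfolding Y \<delta>_sq_def q_def by simp
        qed
        have "(\<integral>\<^sup>+g. \<integral>\<^sup>+x. \<integral>\<^sup>+V. F y g x V \<partial>stdn (UNIV \<times> {..<m}) \<partial>stdn UNIV \<partial>stdn UNIV) =
          (\<integral>\<^sup>+r. \<integral>\<^sup>+\<zeta>. \<integral>\<^sup>+\<kappa>. \<integral>\<^sup>+z. \<integral>\<^sup>+\<xi>. f (real m / \<xi> * (c * dot UNIV yc yc + \<nu> * \<Delta> * yc a0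
              + sqrt (1 + 1 / nn + \<zeta> / \<kappa>) * sqrt (dot UNIV yc yc) * z))
            \<partial>chi_squared (card {..<m} - (CARD('p) - 1)) \<partial>?N \<partial>chi_squared (card {..<m} - (CARD('p) - 2))
            \<partial>noncentral_chi_squared (CARD('p) - 1) (r / nn)
            \<partial>noncentral_chi_squared (CARD('p) - 1) (nn * (\<nu> * \<Delta>)\<^sup>2 * (dot UNIV yc yc - (yc a0)\<^sup>2) / dot UNIV yc yc))"
          by (rule discriminant_law_fixed_difference[OF _ p2 _ Y0 nn(1) f Fm spec]) (use pm in auto)
        also have "\<dots> = \<Omega> (y a0) s"
          unfolding nc unfolding card_lessThan p_def[symmetric] df \<Omega>_def L_def \<Theta>_def Y H_def case_prod_conv
          by (intro nn_integral_cong arg_cong[where f = f]) (simp add: yc_def power2_eq_square algebra_simps)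
        finally show ?case by (simp add: s_def)
      qed
    qed
    \<comment> \<open>The coordinate \<open>y a0\<close> becomes \<open>w\<^sub>0\<close>, and the
      sum of squares of the remaining \<open>p - 1\<close> coordinates becomes
      \<open>\<xi>\<^sub>2\<close>.\<close>
    also have "\<dots> = (\<integral>\<^sup>+y. (\<lambda>w yR. \<Omega> w (\<Sum>a\<in>?R. (yR a)\<^sup>2)) (y a0) (\<lambda>a\<in>?R. y a) \<partial>stdn UNIV)"
      by simp
    also have "\<dots> = (\<integral>\<^sup>+yR. \<integral>\<^sup>+w. \<Omega> w (\<Sum>a\<in>?R. (yR a)\<^sup>2) \<partial>?N \<partial>stdn ?R)"
    proof (rule nn_integral_stdn_split_one)
      have "(\<lambda>yR. \<Sum>a\<in>?R. (yR a)\<^sup>2) \<in> borel_measurable (\<Pi>\<^sub>M a\<in>?R. (borel :: real measure))"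
        by (intro borel_measurable_sum borel_measurable_power measurable_component_singleton)
      then show "(\<lambda>(w, yR). \<Omega> w (\<Sum>a\<in>?R. (yR a)\<^sup>2)) \<in> borel_measurable (borel \<Otimes>\<^sub>M (\<Pi>\<^sub>M a\<in>?R. borel))"
        by measurable
    qed auto
    also have "\<dots> = (\<integral>\<^sup>+s. \<integral>\<^sup>+w. \<Omega> w s \<partial>?N \<partial>chi_squared (card ?R))"
      by (rule nn_integral_stdn_chi_squared[where f = "\<lambda>s. \<integral>\<^sup>+w. \<Omega> w s \<partial>?N"]) (simp, measurable)
    also have "card ?R = p - 1" by (simp add: p_def card_Diff_subset)
    also have "(\<integral>\<^sup>+s. \<integral>\<^sup>+w. \<Omega> w s \<partial>?N \<partial>chi_squared (p - 1)) =
      (\<integral>\<^sup>+s. \<integral>\<^sup>+w. \<integral>\<^sup>+r. \<integral>\<^sup>+u. \<integral>\<^sup>+z. \<integral>\<^sup>+x. f (H x z ((real p - 1) / (real (n 1) + real (n 2) - real p) * u) s w)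
        \<partial>?\<xi> \<partial>?N \<partial>noncentral_F (p - 1) (n 1 + n 2 - p) (r / nn)
        \<partial>noncentral_chi_squared (p - 1) (\<delta>_sq s w) \<partial>?N \<partial>chi_squared (p - 1))"
    proof -
      \<comment> \<open>The factor \<open>(p - 1) / (n 1 + n 2 - p)\<close> undoes the division by
        the degrees of freedom in \<open>noncentral_F\<close>, so that its product with
        \<open>u\<close> is the plain quotient \<open>\<zeta> / \<kappa>\<close>.\<close>
      have pp: "real (p - 1) = real p - 1" "real (n 1 + n 2 - p) = real (n 1) + real (n 2) - real p"
        using p2 pm by (auto simp: p_def m_def of_nat_diff)
      have pp0: "real p - 1 \<noteq> 0" "real (n 1) + real (n 2) - real p \<noteq> 0"
        using p2 pm by (auto simp: p_def m_def)
      have "(\<integral>\<^sup>+u. \<integral>\<^sup>+z. \<integral>\<^sup>+x. f (H x z ((real p - 1) / (real (n 1) + real (n 2) - real p) * u) s w)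
        \<partial>?\<xi> \<partial>?N \<partial>noncentral_F (p - 1) (n 1 + n 2 - p) (r / nn)) = L (r, w, s)" for r w s
      proof -
        have "(\<lambda>u. \<integral>\<^sup>+z. \<integral>\<^sup>+x. f (H x z ((real p - 1) / (real (n 1) + real (n 2) - real p) * u) s w) \<partial>?\<xi> \<partial>?N) \<in> borel_measurable borel"
          unfolding H_def by measurable
        from nn_integral_noncentral_F[OF this, of "p - 1" "n 1 + n 2 - p" "r / nn"]
        show ?thesis using pp0 unfolding pp by (simp add: L_def \<Theta>_def)
      qed
      then show ?thesis unfolding \<Omega>_def by simp
    qed
    also have "\<dots> = (\<integral>\<^sup>+\<omega>. f (H (\<xi> \<omega>) (z\<^sub>0 \<omega>)
      ((real p - 1) / (real (n 1) + real (n 2) - real p) * u \<omega>) (\<xi>\<^sub>2 \<omega>) (w\<^sub>0 \<omega>)) \<partial>N)"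
      unfolding nn_def
    proof (rule nn_integral_representation[symmetric, where f = "\<lambda>x z u s w. f (H x z ((real p - 1) / (real (n 1) + real (n 2) - real p) * u) s w)"])
      show "(\<lambda>(x, z, u, s, w). f (H x z ((real p - 1) / (real (n 1) + real (n 2) - real p) * u) s w))
        \<in> borel_measurable (borel \<Otimes>\<^sub>M borel \<Otimes>\<^sub>M borel \<Otimes>\<^sub>M borel \<Otimes>\<^sub>M borel)"
        unfolding H_def q_def by measurable
    qed fact+
    finally show ?thesis .
  qed
  have [measurable]: "z\<^sub>0 \<in> borel_measurable N" "w\<^sub>0 \<in> borel_measurable N" "u \<in> borel_measurable N"
    using \<open>distributed N lborel z\<^sub>0 std_normal_density\<close> \<open>distributed N lborel w\<^sub>0 std_normal_density\<close>
      \<open>cond_distributed N borel (\<lambda>\<omega>. (\<xi>\<^sub>1 \<omega>, \<xi>\<^sub>2 \<omega>, w\<^sub>0 \<omega>)) borel u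
           (\<lambda>(r, s, w). noncentral_F (p - 1) (n 1 + n 2 - p) (r / real (n 1 + n 2)))\<close>
    by (auto dest: distributed_measurable simp: cond_distributed_def)
  note [measurable] = \<open>\<xi> \<in> borel_measurable N\<close> \<open>\<xi>\<^sub>2 \<in> borel_measurable N\<close>
  let ?h = "\<lambda>\<omega>. H (\<xi> \<omega>) (z\<^sub>0 \<omega>) ((real p - 1) / (real (n 1) + real (n 2) - real p) * u \<omega>) (\<xi>\<^sub>2 \<omega>) (w\<^sub>0 \<omega>)"
  have hm [measurable]: "?h \<in> borel_measurable N"
    unfolding H_def q_def by measurable
  have "distr M borel d_hat = distr N borel ?h"
  proof (rule measure_eqI)
    fix S assume "S \<in> sets (distr M borel d_hat)"
    then have S [measurable]: "S \<in> sets borel" by simp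
    have "emeasure (distr M borel d_hat) S = (\<integral>\<^sup>+\<omega>. indicator S (d_hat \<omega>) \<partial>M)"
      using nn_integral_distr[OF d_hat_m, of "indicator S"] S by simp
    also have "\<dots> = (\<integral>\<^sup>+\<omega>. indicator S (?h \<omega>) \<partial>N)" by (rule key) measurable
    also have "\<dots> = emeasure (distr N borel ?h) S"
      using nn_integral_distr[OF hm, of "indicator S"] S by simp
    finally show "emeasure (distr M borel d_hat) S = emeasure (distr N borel ?h) S" .
  qed simp
  then show ?thesis unfolding H_def q_def c_def \<nu>_def nn(2) nm .
qed

end
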